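(* Let $G$ be a finitely generated infinite amenable group of finite Assouad–Nagata dimension. Then $G$ is not a simple group.
   Context: Word metric: for a group $G$ with a finite symmetric generating set $S$, $l_S(g)$ is the minimal $l$ such that $g=s_1\cdots s_l$ with $s_i\in S$, and $d_S(h,g)=l_S(h^{-1}g)$. The Assouad–Nagata dimension of a finitely generated group is that of the metric space $(G,d_S)$; it does not depend on the choice of $S$. Assouad–Nagata dimension: for $r>0$, a collection of subsets of a metric space is $r$-disjoint if the distance between any two distinct subsets of the collection is greater than $r$. A metric space $M$ has Assouad–Nagata dimension at most $d$ (with $d$ a non-negative integer) if there is $K\ge 1$ such that for every $r>1$ there is a partition of $M$ into subsets, colored with $d+1$ colors, such that every subset has diameter at most $Kr$ and, for each color, the collection of subsets of this color is $r$-disjoint. The Assouad–Nagata dimension is the minimum of such $d$ (infinity if there is none). *)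

theory Defs
  imports
    "HOL-Analysis.Analysis"
    "HOL-Algebra.Algebra"
    "HOL-Library.Extended_Nat"
    "HOL-Library.Disjoint_Sets"
begin

section \<open>Word metrics\<close>

definition finite_symmetric_generating_set :: "('a, 'b) monoid_scheme \<Rightarrow> 'a set \<Rightarrow> bool" where
  "finite_symmetric_generating_set G S \<longleftrightarrow>
     finite S \<and> S \<subseteq> carrier G \<and> (\<forall>s\<in>S. inv\<^bsub>G\<^esub> s \<in> S) \<and> generate G S = carrier G"

definition word_length :: "('a, 'b) monoid_scheme \<Rightarrow> 'a set \<Rightarrow> 'a \<Rightarrow> nat" where
  "word_length G S g =
     (LEAST l. \<exists>ws. length ws = l \<and> set ws \<subseteq> S \<and> foldr (\<otimes>\<^bsub>G\<^esub>) ws \<one>\<^bsub>G\<^esub> = g)"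

definition word_dist :: "('a, 'b) monoid_scheme \<Rightarrow> 'a set \<Rightarrow> 'a \<Rightarrow> 'a \<Rightarrow> real" where
  "word_dist G S h g = real (word_length G S (inv\<^bsub>G\<^esub> h \<otimes>\<^bsub>G\<^esub> g))"


section \<open>Assouad--Nagata dimension\<close>

text \<open>
  The metric space is given by a carrier \<open>M\<close> and a distance \<open>d\<close>, of which
  only the values on \<open>M\<close> matter. The real infimum is meaningful only for nonempty sets;
  the blocks of a partition in the sense of \<^const>\<open>partition_on\<close> are nonempty.
\<close>

definition set_distance :: "('a \<Rightarrow> 'a \<Rightarrow> real) \<Rightarrow> 'a set \<Rightarrow> 'a set \<Rightarrow> real" where
  "set_distance d A B = (INF (x, y)\<in>A \<times> B. d x y)"

definition r_disjoint :: "('a \<Rightarrow> 'a \<Rightarrow> real) \<Rightarrow> real \<Rightarrow> 'a set set \<Rightarrow> bool" where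
  "r_disjoint d r \<A> \<longleftrightarrow> (\<forall>A\<in>\<A>. \<forall>B\<in>\<A>. A \<noteq> B \<longrightarrow> set_distance d A B > r)"

text \<open>
  \<open>c\<close> is the colouring of the blocks, with the \<open>n + 1\<close> colours \<open>0, \<dots>, n\<close>.
  The diameter bound is stated pointwise, since a real supremum would be
  unspecified on unbounded sets.
\<close>

definition AN_dim_at_most :: "'a set \<Rightarrow> ('a \<Rightarrow> 'a \<Rightarrow> real) \<Rightarrow> nat \<Rightarrow> bool" where
  "AN_dim_at_most M d n \<longleftrightarrow>
     (\<exists>K\<ge>1::real. \<forall>r>1::real. \<exists>P (c :: 'a set \<Rightarrow> nat).
        partition_on M P \<and> c ` P \<subseteq> {..n} \<and>
        (\<forall>A\<in>P. \<forall>x\<in>A. \<forall>y\<in>A. d x y \<le> K * r) \<and>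
        (\<forall>i\<le>n. r_disjoint d r {A \<in> P. c A = i}))"

definition AN_dim :: "'a set \<Rightarrow> ('a \<Rightarrow> 'a \<Rightarrow> real) \<Rightarrow> enat" where
  "AN_dim M d = (INF n\<in>{n. AN_dim_at_most M d n}. enat n)"


section \<open>Amenable and simple groups\<close>

text \<open>
  Amenability of a discrete group: a left-invariant finitely additive probability
  measure on all subsets.
\<close>

definition amenable :: "('a, 'b) monoid_scheme \<Rightarrow> bool" where
  "amenable G \<longleftrightarrow>
     (\<exists>\<mu> :: 'a set \<Rightarrow> real.
        (\<forall>A. A \<subseteq> carrier G \<longrightarrow> \<mu> A \<ge> 0) \<and>
        \<mu> (carrier G) = 1 \<and>
        (\<forall>A B. A \<subseteq> carrier G \<longrightarrow> B \<subseteq> carrier G \<longrightarrow> A \<inter> B = {} \<longrightarrow> \<mu> (A \<union> B) = \<mu> A + \<mu> B) \<and>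
        (\<forall>g\<in>carrier G. \<forall>A. A \<subseteq> carrier G \<longrightarrow> \<mu> (g <#\<^bsub>G\<^esub> A) = \<mu> A))"

text \<open>
  The library locale \<^locale>\<open>simple_group\<close> demands \<open>order G > 1\<close>, and \<open>order G = 0\<close>
  for infinite \<open>G\<close>; so it covers finite groups only. Here nontriviality is stated
  directly.
\<close>

definition is_simple :: "('a, 'b) monoid_scheme \<Rightarrow> bool" where
  "is_simple G \<longleftrightarrow>
     group G \<and> carrier G \<noteq> {\<one>\<^bsub>G\<^esub>} \<and> (\<forall>N. N \<lhd> G \<longrightarrow> N = {\<one>\<^bsub>G\<^esub>} \<or> N = carrier G)"

lemma is_simple_iff_simple_group:
  assumes "finite (carrier G)"
  shows "is_simple G \<longleftrightarrow> simple_group G"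
proof -
  have "order G > 1 \<longleftrightarrow> carrier G \<noteq> {\<one>\<^bsub>G\<^esub>}" if "group G"
  proof -
    interpret group G by fact
    have one: "{\<one>\<^bsub>G\<^esub>} \<subseteq> carrier G" by simp
    show ?thesis
    proof
      show "order G > 1 \<Longrightarrow> carrier G \<noteq> {\<one>\<^bsub>G\<^esub>}" by (auto simp: order_def)
    next
      assume "carrier G \<noteq> {\<one>\<^bsub>G\<^esub>}"
      with one have "{\<one>\<^bsub>G\<^esub>} \<subset> carrier G" by blast
      from psubset_card_mono[OF assms this] show "order G > 1" by (simp add: order_def)
    qed
  qed
  then show ?thesis
    unfolding is_simple_def simple_group_def simple_group_axioms_def by blast
qed


section \<open>The word metric is a metric\<close>

context group
begin

lemma foldr_mult_closed: "set ws \<subseteq> carrier G \<Longrightarrow> foldr (\<otimes>) ws \<one> \<in> carrier G"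
  by (induction ws) auto

lemma foldr_mult_append:
  "set us \<subseteq> carrier G \<Longrightarrow> set vs \<subseteq> carrier G \<Longrightarrow>
     foldr (\<otimes>) (us @ vs) \<one> = foldr (\<otimes>) us \<one> \<otimes> foldr (\<otimes>) vs \<one>"
proof (induction us)
  case Nil
  then show ?case by (simp add: foldr_mult_closed)
next
  case (Cons a us)
  then show ?case
    using foldr_mult_closed[of us] foldr_mult_closed[of vs] by (simp add: m_assoc)
qed

lemma foldr_mult_inv:
  "set ws \<subseteq> carrier G \<Longrightarrow>
     foldr (\<otimes>) (rev (map (\<lambda>x. inv x) ws)) \<one> = inv (foldr (\<otimes>) ws \<one>)"
proof (induction ws)
  case (Cons a ws)
  have "set (rev (map (\<lambda>x. inv x) ws)) \<subseteq> carrier G" using Cons.prems by auto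
  then show ?case
    using Cons foldr_mult_closed[of ws] foldr_mult_append[of "rev (map (\<lambda>x. inv x) ws)" "[inv a]"]
    by (simp add: inv_mult_group)
qed simp

lemma word_length_le:
  "set ws \<subseteq> S \<Longrightarrow> foldr (\<otimes>) ws \<one> = g \<Longrightarrow> word_length G S g \<le> length ws"
  unfolding word_length_def by (rule Least_le) blast

lemma word_exists:
  assumes "finite_symmetric_generating_set G S" "g \<in> carrier G"
  shows "\<exists>ws. set ws \<subseteq> S \<and> foldr (\<otimes>) ws \<one> = g"
proof -
  from assms have SG: "S \<subseteq> carrier G" and sym: "\<And>s. s \<in> S \<Longrightarrow> inv s \<in> S"
    and g: "g \<in> generate G S"
    by (auto simp: finite_symmetric_generating_set_def)
  from g show ?thesis
  proof (induction rule: generate.induct)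
    case one
    show ?case by (rule exI[of _ "[]"]) simp
  next
    case (incl h)
    then show ?case using SG by (intro exI[of _ "[h]"]) auto
  next
    case (inv h)
    then show ?case using SG sym[of h] by (intro exI[of _ "[inv h]"]) auto
  next
    case (eng h1 h2)
    then obtain us vs where uv: "set us \<subseteq> S" "foldr (\<otimes>) us \<one> = h1"
      "set vs \<subseteq> S" "foldr (\<otimes>) vs \<one> = h2" by blast
    then have "foldr (\<otimes>) (us @ vs) \<one> = h1 \<otimes> h2"
      using foldr_mult_append[of us vs] SG by auto
    with uv show ?case by (intro exI[of _ "us @ vs"]) auto
  qed
qed

lemma word_of_minimal_length:
  assumes "finite_symmetric_generating_set G S" "g \<in> carrier G"
  obtains ws where "set ws \<subseteq> S" "foldr (\<otimes>) ws \<one> = g" "length ws = word_length G S g"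
proof -
  have "\<exists>l ws. length ws = l \<and> set ws \<subseteq> S \<and> foldr (\<otimes>) ws \<one> = g"
    using word_exists[OF assms] by blast
  from LeastI_ex[OF this] show ?thesis
    using that unfolding word_length_def by blast
qed

lemma word_length_inv_le:
  assumes S: "finite_symmetric_generating_set G S" and g: "g \<in> carrier G"
  shows "word_length G S (inv g) \<le> word_length G S g"
proof -
  obtain ws where ws: "set ws \<subseteq> S" "foldr (\<otimes>) ws \<one> = g" "length ws = word_length G S g"
    using word_of_minimal_length[OF S g] .
  have "S \<subseteq> carrier G" and "\<And>s. s \<in> S \<Longrightarrow> inv s \<in> S"
    using S by (auto simp: finite_symmetric_generating_set_def)
  then show ?thesis
    using word_length_le[of "rev (map (\<lambda>x. inv x) ws)" S "inv g"] foldr_mult_inv[of ws] ws by auto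
qed

lemma word_length_mult_le:
  assumes S: "finite_symmetric_generating_set G S" and gh: "g \<in> carrier G" "h \<in> carrier G"
  shows "word_length G S (g \<otimes> h) \<le> word_length G S g + word_length G S h"
proof -
  obtain us where us: "set us \<subseteq> S" "foldr (\<otimes>) us \<one> = g" "length us = word_length G S g"
    using word_of_minimal_length[OF S gh(1)] .
  obtain vs where vs: "set vs \<subseteq> S" "foldr (\<otimes>) vs \<one> = h" "length vs = word_length G S h"
    using word_of_minimal_length[OF S gh(2)] .
  have "S \<subseteq> carrier G" using S by (auto simp: finite_symmetric_generating_set_def)
  then show ?thesis
    using word_length_le[of "us @ vs" S "g \<otimes> h"] foldr_mult_append[of us vs] us vs by auto
qed

lemma word_length_eq_0_iff:
  assumes S: "finite_symmetric_generating_set G S" and g: "g \<in> carrier G"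
  shows "word_length G S g = 0 \<longleftrightarrow> g = \<one>"
proof
  assume "word_length G S g = 0"
  then show "g = \<one>" using word_of_minimal_length[OF S g] by (metis foldr_Nil id_apply length_0_conv)
next
  assume "g = \<one>"
  then show "word_length G S g = 0" using word_length_le[of "[]" S g] by simp
qed

text \<open>
  The locale \<^locale>\<open>Metric_space\<close> demands symmetry and nonnegativity also outside
  the carrier, hence the cut-off.
\<close>

lemma Metric_space_word_dist:
  assumes S: "finite_symmetric_generating_set G S"
  shows "Metric_space (carrier G)
           (\<lambda>x y. if x \<in> carrier G \<and> y \<in> carrier G then word_dist G S x y else 0)"
proof -
  have sym_le: "word_length G S (inv v \<otimes> u) \<le> word_length G S (inv u \<otimes> v)"
    if "u \<in> carrier G" "v \<in> carrier G" for u v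
    using word_length_inv_le[OF S, of "inv u \<otimes> v"] that by (simp add: inv_mult_group)
  have sym: "word_dist G S x y = word_dist G S y x" if "x \<in> carrier G" "y \<in> carrier G" for x y
    using sym_le[of x y] sym_le[of y x] that by (simp add: word_dist_def)
  have zero: "word_dist G S x y = 0 \<longleftrightarrow> x = y" if "x \<in> carrier G" "y \<in> carrier G" for x y
    using that word_length_eq_0_iff[OF S, of "inv x \<otimes> y"]
    by (metis inv_closed inv_equality inv_inv l_inv m_closed of_nat_eq_0_iff word_dist_def)
  have triangle: "word_dist G S x z \<le> word_dist G S x y + word_dist G S y z"
    if "x \<in> carrier G" "y \<in> carrier G" "z \<in> carrier G" for x y z
  proof -
    have "(inv x \<otimes> y) \<otimes> (inv y \<otimes> z) = inv x \<otimes> z"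
      using that by (metis inv_closed inv_solve_left m_assoc m_closed)
    then show ?thesis
      using word_length_mult_le[OF S, of "inv x \<otimes> y" "inv y \<otimes> z"] that
      by (simp add: word_dist_def)
  qed
  have nonneg: "0 \<le> word_dist G S x y" for x y by (simp add: word_dist_def)
  show ?thesis
    by unfold_locales (auto simp: nonneg sym zero triangle)
qed

end

end

theory Submission
  imports Defs "HOL-Analysis.Finite_Function_Topology"
begin

text \<open>Amenability and finite Assouad--Nagata dimension give, at every scale \<open>r\<close>, a probability
  density \<open>f\<close> on a ball of radius \<open>O(r)\<close> with \<open>\<Sum> |\<nabla>f|\<^sup>2 / f = O(r\<^sup>-\<^sup>2)\<close>: average the squares of the
  bump functions of a coloured partition over the group. So there is no spectral gap, and normalised
  coboundaries converge to a harmonic cocycle \<open>b\<close>, recorded by its Gram kernel \<open>B x y = \<langle>b x, b y\<rangle>\<close>.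
  The operators \<open>r\<^sup>-\<^sup>2 \<Sum>\<^sub>z f(z) \<langle>b z, -\<rangle> b z\<close> have bounded trace and are asymptotically invariant, hence
  have an invariant limit \<open>T\<close> of trace class. Harmonicity gives \<open>\<Sum>\<^sub>s (|b (s z)|\<^sup>2 - |b z|\<^sup>2) = 1\<close>, and
  summation by parts against \<open>f\<close> shows \<open>T \<noteq> 0\<close>. The eigenspace of the largest eigenvalue of \<open>T\<close> is a
  finite-dimensional representation. If it is not trivial, the group has a proper normal subgroup of
  finite index by Malcev's theorem; if it is trivial, pairing \<open>b\<close> with a fixed vector is a nonzero
  homomorphism to the reals. Neither is possible for an infinite simple group.

  No Hilbert space is completed: eigenvectors are sequences of approximate ones, and their matrix
  coefficients are limits along a filter on which all bounded sequences converge.\<close>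

section \<open>Semidefinite forms of trace class\<close>

text \<open>The two estimates on \<open>T\<close> compete, and the linear control of diameters
  reconciles them. The trace stays bounded because |b z| is at most the length of z and the density
  lives within radius O(r). Non-vanishing needs a gradient of size 1/r at that same scale:
  Cauchy-Schwarz bounds the sum of |grad f| |<b z, b s>| by the root of the sum of |grad f|^2 / f,
  which is O(1/r), times the root of the sum of f(z) <b z, b s>^2, which is r times the root of <T b
  s, b s>; the powers of r cancel. An l^1 bound on the gradient would only say that the pairing is
  O(1), and in a general amenable group a Foelner function of precision 1/r may need a radius much
  larger than r. The bounded trace is used twice: it limits the multiplicity of the largest
  eigenvalue, and it makes \<open>T\<close> compact, so that almost top eigenvectors cannot be
  weakly null and their pairing with the cocycle survives in the limit.\<close>

text \<open>The limits are the coordinates of a cluster point of \<open>n \<mapsto> (x n)\<^sub>x\<close> in a product of compact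
  intervals indexed by all bounded sequences \<open>x\<close>.\<close>

lemma bounded_limit_filter:
  "\<exists>U :: nat filter. U \<noteq> bot \<and> U \<le> sequentially \<and>
     (\<forall>x :: nat \<Rightarrow> real. Bseq x \<longrightarrow> (x \<longlongrightarrow> Lim U x) U)"
proof -
  have "\<exists>M. \<forall>x :: nat \<Rightarrow> real. Bseq x \<longrightarrow> (\<forall>n. \<bar>x n\<bar> \<le> M x)"
    by (rule choice) (metis Bseq_def real_norm_def)
  then obtain M where M: "\<And>x n. Bseq x \<Longrightarrow> \<bar>x n\<bar> \<le> M (x :: nat \<Rightarrow> real)"
    by blast
  define C where "C = (\<Pi>\<^sub>E x\<in>UNIV. {- \<bar>M x\<bar> .. \<bar>M x\<bar>})"
  define e where "e n = (\<lambda>x :: nat \<Rightarrow> real. if Bseq x then x n else 0)" for n :: nat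
  have "compactin (product_topology (\<lambda>_. euclidean) UNIV) C"
    unfolding C_def compactin_PiE by simp
  then have "compact C"
    by (simp add: euclidean_product_topology)
  have "x n \<in> {- \<bar>M x\<bar> .. \<bar>M x\<bar>}" if "Bseq x" for x n
    using M[OF that, of n] unfolding atLeastAtMost_iff by linarith
  then have "e n \<in> C" for n
    by (auto simp: e_def C_def)
  then obtain y where y: "inf (nhds y) (filtermap e sequentially) \<noteq> bot"
    using \<open>compact C\<close> unfolding compact_filter
    by (metis (mono_tags, lifting) eventually_filtermap eventually_sequentiallyI filtermap_bot_iff trivial_limit_sequentially)
  \<comment> \<open>Pulling the neighbourhoods of the cluster point back along \<open>e\<close>
    makes all bounded sequences converge at once, since evaluation at \<open>x\<close> is continuous
    on the product.\<close>
  define U where "U = inf (filtercomap e (nhds y)) sequentially"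
  have "U \<noteq> bot"
  proof
    assume "U = bot"
    then have "filtermap e U = bot" by simp
    moreover have "inf (nhds y) (filtermap e sequentially) \<le> filtermap e U"
    proof (rule filter_leI)
      fix P assume "eventually P (filtermap e U)"
      then obtain Q R where Q: "eventually Q (filtercomap e (nhds y))" and R: "eventually R sequentially"
        and QR: "\<And>n. Q n \<Longrightarrow> R n \<Longrightarrow> P (e n)"
        unfolding U_def eventually_filtermap eventually_inf by blast
      from Q obtain Q' where Q': "eventually Q' (nhds y)" "\<And>n. Q' (e n) \<Longrightarrow> Q n"
        unfolding eventually_filtercomap by blast
      have "eventually (\<lambda>F. Q' F \<longrightarrow> P F) (filtermap e sequentially)"
        unfolding eventually_filtermap using R by eventually_elim (use Q' QR in blast)
      with Q'(1) show "eventually P (inf (nhds y) (filtermap e sequentially))"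
        unfolding eventually_inf by blast
    qed
    ultimately show False using y by (simp add: bot.extremum_unique)
  qed
  moreover have "U \<le> sequentially" by (simp add: U_def)
  moreover have "(x \<longlongrightarrow> y x) U" if "Bseq x" for x :: "nat \<Rightarrow> real"
  proof -
    have "(e \<longlongrightarrow> y) U"
      unfolding U_def filterlim_def
      by (meson filtermap_filtercomap filtermap_mono inf_le1 order_trans)
    have "((\<lambda>n. e n x) \<longlongrightarrow> y x) U"
    proof (rule topological_tendstoI)
      fix S :: "real set" assume "open S" "y x \<in> S"
      then have "open ((\<lambda>F :: (nat \<Rightarrow> real) \<Rightarrow> real. F x) -` S)" "y \<in> (\<lambda>F. F x) -` S"
        by (auto intro: open_vimage[OF _ continuous_on_product_coordinates])
      then show "\<forall>\<^sub>F n in U. e n x \<in> S"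
        using topological_tendstoD[OF \<open>(e \<longlongrightarrow> y) U\<close>] by fastforce
    qed
    then show ?thesis using that by (simp add: e_def)
  qed
  ultimately show ?thesis by (metis tendsto_Lim)
qed

lemma tendsto_zero_of_square_le:
  fixes x y :: "'i \<Rightarrow> real"
  assumes "(y \<longlongrightarrow> 0) F" "\<forall>\<^sub>F n in F. (x n)\<^sup>2 \<le> y n"
  shows "(x \<longlongrightarrow> 0) F"
proof (rule Lim_null_comparison)
  show "((\<lambda>n. sqrt (y n)) \<longlongrightarrow> 0) F" using tendsto_real_sqrt[OF assms(1)] by simp
  show "\<forall>\<^sub>F n in F. norm (x n) \<le> sqrt (y n)"
    using assms(2) by eventually_elim (simp add: real_le_rsqrt)
qed

section \<open>Positive semidefinite bilinear forms\<close>

text \<open>Degenerate forms are allowed and vectors of length 0 are never divided out; statements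
  about Hilbert space vectors become statements about values of \<open>B\<close>.\<close>

locale psd_form =
  fixes B :: "'v::real_vector \<Rightarrow> 'v \<Rightarrow> real"
  assumes bilin: "bilinear B" and sym: "B x y = B y x" and nonneg: "0 \<le> B x x"
begin

lemmas add_left = bilinear_ladd[OF bilin] and add_right = bilinear_radd[OF bilin]
  and diff_left = bilinear_lsub[OF bilin] and diff_right = bilinear_rsub[OF bilin]
  and scale_left = bilinear_lmul[OF bilin] and scale_right = bilinear_rmul[OF bilin]
  and zero_left [simp] = bilinear_lzero[OF bilin] and zero_right [simp] = bilinear_rzero[OF bilin]

lemma sum_left: "B (\<Sum>i\<in>I. f i) y = (\<Sum>i\<in>I. B (f i) y)"
  using bilin by (simp add: bilinear_def linear_sum[of "\<lambda>x. B x y"])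

lemma sum_right: "B x (\<Sum>i\<in>I. f i) = (\<Sum>i\<in>I. B x (f i))"
  using bilin by (simp add: bilinear_def linear_sum[of "B x"])

lemmas expand = add_left add_right diff_left diff_right scale_left scale_right

lemma scale_self: "B (a *\<^sub>R x) (a *\<^sub>R x) = a\<^sup>2 * B x x"
  by (simp add: expand power2_eq_square)

lemma parallelogram: "B (x + y) (x + y) + B (x - y) (x - y) = 2 * B x x + 2 * B y y"
  by (simp add: expand)

lemma add_le: "B (x + y) (x + y) \<le> 2 * B x x + 2 * B y y"
  using parallelogram[of x y] nonneg[of "x - y"] by linarith

lemma diff_le: "B (x - y) (x - y) \<le> 2 * B x x + 2 * B y y"
  using parallelogram[of x y] nonneg[of "x + y"] by linarith

lemma cauchy_schwarz: "(B x y)\<^sup>2 \<le> B x x * B y y"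
proof -
  have q: "0 \<le> a\<^sup>2 * B x x - 2 * a * b * B x y + b\<^sup>2 * B y y" for a b
    using nonneg[of "a *\<^sub>R x - b *\<^sub>R y"]
    by (simp add: expand sym[of y x] power2_eq_square algebra_simps)
  show ?thesis
  proof (cases "B y y = 0")
    case False
    then have "B y y > 0" using nonneg[of y] by linarith
    moreover have "0 \<le> B y y * (B x x * B y y - (B x y)\<^sup>2)"
      using q[of "B y y" "B x y"] by (simp add: power2_eq_square algebra_simps)
    ultimately show ?thesis by (simp add: zero_le_mult_iff)
  next
    case True
    have "B x y = 0"
    proof (rule ccontr)
      assume "B x y \<noteq> 0"
      \<comment> \<open>For \<open>B y y = 0\<close> the quadratic polynomial is linear in its
        second parameter, and this value makes it -1.\<close>
      then show False using q[of 1 "(B x x + 1) / (2 * B x y)"] True nonneg[of x]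
        by (simp add: field_simps)
    qed
    with True show ?thesis by simp
  qed
qed

lemma abs_le: "B x x \<le> a\<^sup>2 \<Longrightarrow> B y y \<le> b\<^sup>2 \<Longrightarrow> 0 \<le> a \<Longrightarrow> 0 \<le> b \<Longrightarrow> \<bar>B x y\<bar> \<le> a * b"
proof -
  assume *: "B x x \<le> a\<^sup>2" "B y y \<le> b\<^sup>2" "0 \<le> a" "0 \<le> b"
  have "(B x y)\<^sup>2 \<le> a\<^sup>2 * b\<^sup>2"
    using cauchy_schwarz[of x y] mult_mono[OF *(1,2)] nonneg[of y] by fastforce
  then show ?thesis using * by (metis abs_le_square_iff abs_mult abs_of_nonneg power_mult_distrib)
qed

lemma norm_add_le:
  assumes "B x x \<le> a\<^sup>2" "B y y \<le> b\<^sup>2" "0 \<le> a" "0 \<le> b"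
  shows "B (x + y) (x + y) \<le> (a + b)\<^sup>2"
proof -
  have "B (x + y) (x + y) = B x x + 2 * B x y + B y y" by (simp add: expand sym[of y x])
  also have "\<dots> \<le> a\<^sup>2 + 2 * (a * b) + b\<^sup>2" using assms abs_le[OF assms] by linarith
  finally show ?thesis by (simp add: power2_eq_square algebra_simps)
qed

lemma sum_le: "finite I \<Longrightarrow> B (\<Sum>i\<in>I. f i) (\<Sum>i\<in>I. f i) \<le> card I * (\<Sum>i\<in>I. B (f i) (f i))"
proof -
  have "B (\<Sum>i\<in>I. f i) (\<Sum>i\<in>I. f i) = (\<Sum>i\<in>I. \<Sum>j\<in>I. B (f i) (f j))"
    by (simp add: sum_left sum_right, rule sum.swap)
  also have "\<dots> \<le> (\<Sum>i\<in>I. \<Sum>j\<in>I. (B (f i) (f i) + B (f j) (f j)) / 2)"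
  proof (intro sum_mono)
    fix i j
    show "B (f i) (f j) \<le> (B (f i) (f i) + B (f j) (f j)) / 2"
      using nonneg[of "f i - f j"] by (simp add: expand sym[of "f j" "f i"])
  qed
  also have "\<dots> = card I * (\<Sum>i\<in>I. B (f i) (f i))"
    by (simp add: sum.distrib add_divide_distrib flip: sum_distrib_left sum_divide_distrib)
  finally show ?thesis .
qed

definition orthonormal :: "nat \<Rightarrow> (nat \<Rightarrow> 'v) \<Rightarrow> bool" where
  "orthonormal k e \<longleftrightarrow> (\<forall>i<k. \<forall>j<k. B (e i) (e j) = (if i = j then 1 else 0))"

definition residual :: "nat \<Rightarrow> (nat \<Rightarrow> 'v) \<Rightarrow> 'v \<Rightarrow> 'v" where
  "residual k e x = x - (\<Sum>i<k. B x (e i) *\<^sub>R e i)"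

lemma residual_orthogonal:
  assumes "orthonormal k e" "j < k" shows "B (residual k e x) (e j) = 0"
proof -
  have "(\<Sum>i<k. B x (e i) * B (e i) (e j)) = (\<Sum>i<k. if i = j then B x (e i) else 0)"
    using assms by (intro sum.cong) (auto simp: orthonormal_def)
  then show ?thesis using assms
    by (simp add: residual_def diff_left sum_left scale_left)
qed

lemma residual_norm:
  assumes "orthonormal k e"
  shows "B (residual k e x) (residual k e x) = B x x - (\<Sum>i<k. (B x (e i))\<^sup>2)"
proof -
  have "B (residual k e x) (residual k e x) = B (residual k e x) x"
    by (subst (2) residual_def)
      (simp add: diff_right sum_right scale_right residual_orthogonal[OF assms])
  also have "\<dots> = B x x - (\<Sum>i<k. (B x (e i))\<^sup>2)"
    by (simp add: residual_def diff_left sum_left scale_left power2_eq_square sym[of "e i" x for i])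
  finally show ?thesis .
qed

lemma bessel: "orthonormal k e \<Longrightarrow> (\<Sum>i<k. (B x (e i))\<^sup>2) \<le> B x x"
  using residual_norm[of k e x] nonneg[of "residual k e x"] by linarith

lemma residual_le: "orthonormal k e \<Longrightarrow> B (residual k e x) (residual k e x) \<le> B x x"
  using residual_norm[of k e x] by (simp add: sum_nonneg)

lemma coeff_le_1:
  assumes "orthonormal k e" "B x x \<le> 1" "i < k" shows "(B x (e i))\<^sup>2 \<le> 1"
  using cauchy_schwarz[of x "e i"] assms by (simp add: orthonormal_def)

lemma orthonormal_extend:
  assumes "orthonormal k e" "\<And>i. i < k \<Longrightarrow> B w (e i) = 0" "B w w > 0"
  shows "orthonormal (Suc k) (e(k := (1 / sqrt (B w w)) *\<^sub>R w))"
proof -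
  define u where "u = (1 / sqrt (B w w)) *\<^sub>R w"
  have "B u u = 1" using assms(3) by (simp add: u_def scale_self power_divide)
  moreover have "B u (e i) = 0" if "i < k" for i using assms(2)[OF that] by (simp add: u_def scale_left)
  moreover have "B (e i) u = 0" if "i < k" for i using calculation(2)[OF that] sym by simp
  ultimately show ?thesis using assms(1)
    by (auto simp: orthonormal_def less_Suc_eq simp flip: u_def)
qed

end

section \<open>The largest eigenvalue of a form of trace class\<close>

text \<open>\<open>T\<close> is the form of a positive operator on the completion of
  \<open>B\<close>. Its trace is expressed by finite orthonormal systems of the uncompleted space,
  and one constant \<open>C\<close> bounds both operator norm and trace.\<close>

locale trace_class_forms = B: psd_form B + T: psd_form T
  for B T :: "'v::real_vector \<Rightarrow> 'v \<Rightarrow> real" +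
  fixes C :: real
  assumes bound: "T x x \<le> C * B x x"
    and trace: "B.orthonormal k e \<Longrightarrow> (\<Sum>i<k. T (e i) (e i)) \<le> C"
    and nontrivial: "\<exists>x. T x x > 0"
begin

lemma pos_of_T_pos: "T x x > 0 \<Longrightarrow> B x x > 0"
  using bound[of x] B.nonneg[of x] by (cases "B x x = 0") auto

lemma normalised: "B x x > 0 \<Longrightarrow> B ((1 / sqrt (B x x)) *\<^sub>R x) ((1 / sqrt (B x x)) *\<^sub>R x) = 1"
  by (simp add: B.scale_self power_divide)

lemma T_normalised: "B x x > 0 \<Longrightarrow>
    T ((1 / sqrt (B x x)) *\<^sub>R x) ((1 / sqrt (B x x)) *\<^sub>R x) = T x x / B x x"
  by (simp add: T.scale_self power_divide)

definition top where "top = (SUP x\<in>{x. B x x = 1}. T x x)"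

lemma T_le_C: "B x x = 1 \<Longrightarrow> T x x \<le> C"
  using bound[of x] by simp

lemma bdd_above_T: "bdd_above ((\<lambda>x. T x x) ` {x. B x x = 1})"
  using T_le_C by (intro bdd_aboveI2[of _ _ C]) simp

lemma unit_le_top: "B x x = 1 \<Longrightarrow> T x x \<le> top"
  unfolding top_def by (rule cSUP_upper[OF _ bdd_above_T]) simp

lemma le_top: "T x x \<le> top * B x x"
proof (cases "B x x = 0")
  case True then show ?thesis using bound[of x] by simp
next
  case False
  then have "B x x > 0" using B.nonneg[of x] by linarith
  then show ?thesis using unit_le_top[OF normalised, of x] T_normalised[of x] by (simp add: field_simps)
qed

lemma top_pos: "top > 0"
proof -
  obtain x where "T x x > 0" using nontrivial by blast
  then have "0 < top * B x x" using le_top[of x] by linarith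
  then show ?thesis using pos_of_T_pos[OF \<open>T x x > 0\<close>] by (simp add: zero_less_mult_iff)
qed

text \<open>Eigenvectors for \<open>top\<close> may exist only in the completion. Orthonormal
  vectors whose Rayleigh quotients are within \<open>\<delta>\<close> of \<open>top\<close> replace
  an orthonormal system of eigenvectors.\<close>

definition top_system where
  "top_system d \<delta> v \<longleftrightarrow> B.orthonormal d v \<and> (\<forall>i<d. top - \<delta> \<le> T (v i) (v i))"

lemma top_system_1: "\<delta> > 0 \<Longrightarrow> \<exists>v. top_system 1 \<delta> v"
proof -
  assume "\<delta> > 0"
  obtain x0 where "T x0 x0 > 0" using nontrivial by blast
  then have ne: "{x. B x x = 1} \<noteq> {}" using normalised[OF pos_of_T_pos] by blast
  have "\<exists>x\<in>{x. B x x = 1}. top - \<delta> < T x x"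
    by (rule less_cSUP_iff[THEN iffD1, OF ne bdd_above_T]) (use \<open>\<delta> > 0\<close> in \<open>simp flip: top_def\<close>)
  then obtain x where "B x x = 1" "top - \<delta> < T x x" by blast
  then have "top_system 1 \<delta> (\<lambda>_. x)" by (simp add: top_system_def B.orthonormal_def)
  then show ?thesis by blast
qed

text \<open>Each vector contributes at least \<open>top / 2\<close> to the trace.\<close>

lemma top_system_size: "top_system d (top / 2) v \<Longrightarrow> d \<le> 2 * C / top"
proof -
  assume v: "top_system d (top / 2) v"
  have "real d * (top / 2) = (\<Sum>i<d. top - top / 2)" by simp
  also have "\<dots> \<le> (\<Sum>i<d. T (v i) (v i))" using v by (intro sum_mono) (auto simp: top_system_def)
  also have "\<dots> \<le> C" using v trace by (simp add: top_system_def)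
  finally show ?thesis using top_pos by (simp add: field_simps)
qed

text \<open>\<open>d\<close> is the largest size that occurs at every precision, in effect the
  multiplicity of the largest eigenvalue; it exists because sizes at precision
  \<open>top / 2\<close> are bounded. \<open>\<delta>\<close> is a precision at which size
  \<open>d + 1\<close> is impossible.\<close>

lemma maximal_top_systems:
  obtains d \<delta> v where "d \<ge> 1" "\<delta> > 0" "\<And>n. top_system d (1 / real (Suc n)) (v n)"
    "\<And>w. \<not> top_system (Suc d) \<delta> w"
proof -
  define P where "P d \<longleftrightarrow> (\<forall>\<delta>>0. \<exists>v. top_system d \<delta> v)" for d
  have P1: "P 1" unfolding P_def using top_system_1 by blast
  have bd: "d \<le> nat \<lfloor>2 * C / top\<rfloor>" if "P d" for d
  proof -
    have "\<exists>v. top_system d (top / 2) v"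
      using that[unfolded P_def, rule_format, of "top / 2"] top_pos half_gt_zero by blast
    then show ?thesis using top_system_size le_nat_floor by blast
  qed
  define d where "d = (GREATEST d. P d)"
  have "P d" unfolding d_def by (rule GreatestI_nat[of P, OF P1]) (use bd in blast)
  have "d \<ge> 1" unfolding d_def by (rule Greatest_le_nat[of P, OF P1]) (use bd in blast)
  have "\<not> P (Suc d)" using Greatest_le_nat[of P "Suc d"] bd unfolding d_def[symmetric]
    by (metis Suc_n_not_le_n)
  then obtain \<delta> where "\<delta> > 0" "\<And>w. \<not> top_system (Suc d) \<delta> w" unfolding P_def by blast
  moreover have "\<forall>n. \<exists>v. top_system d (1 / real (Suc n)) v"
    using \<open>P d\<close> unfolding P_def by simp
  then obtain v where "\<And>n. top_system d (1 / real (Suc n)) (v n)" by metis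
  ultimately show ?thesis using that[OF \<open>d \<ge> 1\<close>, of \<delta> v] by blast
qed

text \<open>\<open>top * B - T\<close> is positive semidefinite, so a combination of approximate top eigenvectors
  is one again.\<close>

sublocale gap: psd_form "\<lambda>x y. top * B x y - T x y"
proof
  have "linear (\<lambda>y. top * B x y - T x y)" for x
    by (rule linearI) (simp_all add: B.add_right T.add_right B.scale_right T.scale_right algebra_simps)
  moreover have "linear (\<lambda>x. top * B x y - T x y)" for y
    by (rule linearI) (simp_all add: B.add_left T.add_left B.scale_left T.scale_left algebra_simps)
  ultimately show "bilinear (\<lambda>x y. top * B x y - T x y)"
    by (simp add: bilinear_def)
  show "top * B x y - T x y = top * B y x - T y x" for x y
    by (simp only: B.sym[of x y] T.sym[of x y])
  show "0 \<le> top * B x x - T x x" for x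
    using le_top[of x] by simp
qed

text \<open>The residual of \<open>u\<close> is a combination of \<open>d + 1\<close> almost top
  eigenvectors with coefficients at most 1 in absolute value, hence nearly null for the gap form. If
  it were long, its normalisation would extend \<open>v\<close> to size \<open>d + 1\<close> at
  precision \<open>\<delta>\<close>. So the span of \<open>v\<close> nearly contains every almost
  top eigenvector.\<close>

lemma residual_small:
  assumes v: "top_system d \<epsilon> v" and max: "\<And>w. \<not> top_system (Suc d) \<delta> w"
    and "0 \<le> \<epsilon>" "\<epsilon> < \<delta>" and u: "B u u = 1" "top - \<epsilon> \<le> T u u"
  shows "B (B.residual d v u) (B.residual d v u) \<le> (real d + 1)\<^sup>2 / \<delta> * \<epsilon>"
proof -
  let ?w = "B.residual d v u"
  let ?Q = "\<lambda>x. top * B x x - T x x"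
  define f where "f i = (if i < d then (- B u (v i)) *\<^sub>R v i else u)" for i
  have o: "B.orthonormal d v" using v by (simp add: top_system_def)
  have Qf: "?Q (f i) \<le> \<epsilon>" if "i < Suc d" for i
  proof (cases "i < d")
    case True
    have "?Q (f i) = (B u (v i))\<^sup>2 * ?Q (v i)"
      using True by (simp add: f_def B.scale_self T.scale_self right_diff_distrib del: scaleR_minus_left)
    also have "\<dots> \<le> 1 * ?Q (v i)"
      using B.coeff_le_1[OF o _ True, of u] u gap.nonneg[of "v i"] by (intro mult_right_mono) auto
    also have "\<dots> \<le> \<epsilon>" using v True by (auto simp: top_system_def B.orthonormal_def)
    finally show ?thesis .
  qed (use u in \<open>simp add: f_def\<close>)
  have "?w = (\<Sum>i<Suc d. f i)"
    by (simp add: B.residual_def f_def sum_negf)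
  \<comment> \<open>One factor \<open>d + 1\<close> is the number of summands in
    \<open>gap.sum_le\<close>, the other comes from adding up \<open>\<epsilon>\<close>.\<close>
  then have "?Q ?w \<le> (real d + 1) * (\<Sum>i<Suc d. ?Q (f i))"
    using gap.sum_le[of "{..<Suc d}" f] by (simp add: add.commute)
  also have "\<dots> \<le> (real d + 1) * (\<Sum>i<Suc d. \<epsilon>)"
    using Qf by (intro mult_left_mono sum_mono) auto
  finally have Qw: "?Q ?w \<le> (real d + 1)\<^sup>2 * \<epsilon>"
    by (simp add: power2_eq_square algebra_simps)
  show ?thesis
  proof (cases "B ?w ?w = 0")
    case True then show ?thesis using assms by simp
  next
    case False
    then have pos: "B ?w ?w > 0" using B.nonneg[of ?w] by linarith
    let ?v = "v(d := (1 / sqrt (B ?w ?w)) *\<^sub>R ?w)"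
    have "B.orthonormal (Suc d) ?v"
      by (rule B.orthonormal_extend[OF o B.residual_orthogonal[OF o] pos])
    \<comment> \<open>The old vectors are precise enough because
      \<open>\<epsilon> < \<delta>\<close>, so the new one must be at fault.\<close>
    with max[of ?v] v \<open>\<epsilon> < \<delta>\<close> have "T (?v d) (?v d) < top - \<delta>"
      unfolding top_system_def by (fastforce simp: less_Suc_eq)
    then have "T ?w ?w / B ?w ?w < top - \<delta>" using T_normalised[OF pos] by simp
    then have "\<delta> * B ?w ?w \<le> ?Q ?w" using pos by (simp add: field_simps)
    with Qw have "\<delta> * B ?w ?w \<le> (real d + 1)\<^sup>2 * \<epsilon>" by linarith
    then show ?thesis using assms by (simp add: field_simps)
  qed
qed

text \<open>A positive operator of finite trace is compact. Take a finite orthonormal system that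
  exhausts the trace up to \<open>\<epsilon> / 4\<close>: off its span \<open>T\<close> is small,
  and in its span only finitely many coefficients matter, each of which tends to 0.\<close>

lemma weakly_null_imp_T_null:
  assumes b: "\<And>n::nat. B (v n) (v n) \<le> 1" and w: "\<And>x. ((\<lambda>n. B x (v n)) \<longlongrightarrow> 0) U"
    and "\<epsilon> > 0"
  shows "\<forall>\<^sub>F n in U. T (v n) (v n) < \<epsilon>"
proof -
  define tr where "tr = Sup {s. \<exists>k e. B.orthonormal k e \<and> s = (\<Sum>i<k. T (e i) (e i))}"
  let ?S = "{s. \<exists>k e. B.orthonormal k e \<and> s = (\<Sum>i<k. T (e i) (e i))}"
  have bdd: "bdd_above ?S" using trace by (auto intro!: bdd_aboveI[of _ C])
  have "B.orthonormal 0 (\<lambda>_. 0)" by (simp add: B.orthonormal_def)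
  then have ne: "?S \<noteq> {}" by blast
  obtain k e where e: "B.orthonormal k e" and tr: "(\<Sum>i<k. T (e i) (e i)) > tr - \<epsilon> / 4"
    using less_cSup_iff[OF ne bdd, of "tr - \<epsilon> / 4"] \<open>\<epsilon> > 0\<close> unfolding tr_def[symmetric] by auto
  have res: "T (B.residual k e x) (B.residual k e x) \<le> \<epsilon> / 4" if "B x x \<le> 1" for x
  proof (cases "B (B.residual k e x) (B.residual k e x) = 0")
    case True then show ?thesis using bound[of "B.residual k e x"] \<open>\<epsilon> > 0\<close> by simp
  next
    case False
    let ?w = "B.residual k e x"
    have pos: "B ?w ?w > 0" using False B.nonneg[of ?w] by linarith
    let ?e = "e(k := (1 / sqrt (B ?w ?w)) *\<^sub>R ?w)"
    have "B.orthonormal (Suc k) ?e"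
      by (rule B.orthonormal_extend[OF e B.residual_orthogonal[OF e] pos])
    \<comment> \<open>Appending the normalised residual adds its Rayleigh quotient to the partial
      trace, which can grow by less than \<open>\<epsilon> / 4\<close>.\<close>
    then have "(\<Sum>i<Suc k. T (?e i) (?e i)) \<le> tr"
      unfolding tr_def by (intro cSup_upper bdd) blast
    moreover have "(\<Sum>i<Suc k. T (?e i) (?e i)) = (\<Sum>i<k. T (e i) (e i)) + T ?w ?w / B ?w ?w"
      by (simp add: T_normalised[OF pos])
    ultimately have "T ?w ?w / B ?w ?w \<le> \<epsilon> / 4" using tr by linarith
    moreover have "B ?w ?w \<le> 1" using B.residual_le[OF e, of x] that by linarith
    moreover have "T ?w ?w = T ?w ?w / B ?w ?w * B ?w ?w" using pos by simp
    ultimately show ?thesis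
      using mult_mono[of "T ?w ?w / B ?w ?w" "\<epsilon> / 4" "B ?w ?w" 1] pos \<open>\<epsilon> > 0\<close> by simp
  qed
  have "((\<lambda>n. real k * (\<Sum>i<k. (B (e i) (v n))\<^sup>2 * T (e i) (e i))) \<longlongrightarrow> real k * (\<Sum>i<k. 0\<^sup>2 * T (e i) (e i))) U"
    by (intro tendsto_intros w)
  then have "\<forall>\<^sub>F n in U. real k * (\<Sum>i<k. (B (e i) (v n))\<^sup>2 * T (e i) (e i)) < \<epsilon> / 4"
    using \<open>\<epsilon> > 0\<close> by (intro order_tendstoD(2)[where y = 0]) auto
  then show ?thesis
  proof eventually_elim
    case (elim n)
    let ?p = "\<Sum>i<k. B (v n) (e i) *\<^sub>R e i"
    have "v n = B.residual k e (v n) + ?p" by (simp add: B.residual_def)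
    then have "T (v n) (v n) \<le> 2 * T (B.residual k e (v n)) (B.residual k e (v n)) + 2 * T ?p ?p"
      using T.add_le by metis
    moreover have "T ?p ?p \<le> real k * (\<Sum>i<k. (B (e i) (v n))\<^sup>2 * T (e i) (e i))"
      using T.sum_le[of "{..<k}" "\<lambda>i. B (v n) (e i) *\<^sub>R e i"]
      by (simp add: T.expand B.sym[of "v n"] power2_eq_square mult.assoc)
    ultimately show ?case using res[OF b[of n]] elim by linarith
  qed
qed

end

section \<open>Isometric actions that preserve a form of trace class\<close>

text \<open>\<open>b\<close> is a cocycle for the action, and its values span the space. The neutral
  element acts trivially only up to \<open>B\<close>-null vectors, since the action constructed
  later is not unital.\<close>

locale trace_class_action = trace_class_forms B T C + Groups.group mul e iv
  for B T :: "'v::real_vector \<Rightarrow> 'v \<Rightarrow> real" and C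
    and mul :: "'a \<Rightarrow> 'a \<Rightarrow> 'a" (infixl "\<cdot>" 70) and e :: 'a and iv +
  fixes act :: "'a \<Rightarrow> 'v \<Rightarrow> 'v" and b :: "'a \<Rightarrow> 'v"
  assumes linear_act: "linear (act g)"
    and act_mul: "act (g \<cdot> h) x = act g (act h x)"
    and act_e: "B (act e x) y = B x y"
    and B_act: "B (act g x) (act g y) = B x y"
    and T_act: "T (act g x) (act g y) = T x y"
    and b_mul: "b (g \<cdot> h) = b g + act g (b h)"
    and b_span: "\<exists>F a. finite F \<and> x = (\<Sum>g\<in>F. a g *\<^sub>R b g)"
begin

text \<open>The action carries a maximal system of almost top eigenvectors nearly into its own span,
  so the matrix coefficients converge to a representation \<open>\<rho>\<close>. If
  \<open>\<rho>\<close> is trivial, the first vector is asymptotically invariant and its limiting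
  pairing with the cocycle is additive.\<close>

lemma linear_rep_or_character:
  obtains (rep) d :: nat and \<rho> :: "'a \<Rightarrow> nat \<Rightarrow> nat \<Rightarrow> real"
    where "\<And>g h i j. i < d \<Longrightarrow> j < d \<Longrightarrow> \<rho> (g \<cdot> h) i j = (\<Sum>k<d. \<rho> g i k * \<rho> h k j)"
      "\<And>i j. i < d \<Longrightarrow> j < d \<Longrightarrow> \<rho> e i j = (if i = j then 1 else 0)"
      "\<exists>g i j. i < d \<and> j < d \<and> \<rho> g i j \<noteq> (if i = j then 1 else 0)"
  | (character) c :: "'a \<Rightarrow> real"
    where "\<And>g h. c (g \<cdot> h) = c g + c h" "\<exists>g. c g \<noteq> 0"
proof -
  obtain U :: "nat filter" where U: "U \<noteq> bot" "U \<le> sequentially"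
    and Ulim: "\<And>x :: nat \<Rightarrow> real. Bseq x \<Longrightarrow> (x \<longlongrightarrow> Lim U x) U"
    using bounded_limit_filter by blast
  obtain d \<delta> v where d: "d \<ge> 1" and \<delta>: "\<delta> > 0"
    and v: "\<And>n. top_system d (1 / real (Suc n)) (v n)"
    and max: "\<And>w. \<not> top_system (Suc d) \<delta> w"
    by (rule maximal_top_systems) (rule that)
  have o: "B.orthonormal d (v n)" for n using v[of n] by (simp add: top_system_def)
  have v1: "B (v n i) (v n i) = 1" if "i < d" for n i
    using o[of n] that by (simp add: B.orthonormal_def)
  have \<epsilon>0: "((\<lambda>n. 1 / real (Suc n)) \<longlongrightarrow> 0) U"
    using LIMSEQ_inverse_real_of_nat filterlim_mono[OF _ order_refl U(2)]
    by (simp add: inverse_eq_divide)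
  have ev_\<delta>: "\<forall>\<^sub>F n in U. 1 / real (Suc n) < \<delta>"
    using order_tendstoD(2)[OF \<epsilon>0 \<delta>] .
  \<comment> \<open>By maximality of \<open>d\<close> these residuals tend to 0: the span of
    \<open>v n\<close> is asymptotically invariant.\<close>
  define r where "r g n j = B.residual d (v n) (act g (v n j))" for g n j
  have r0: "((\<lambda>n. B (r g n j) (r g n j)) \<longlongrightarrow> 0) U" if "j < d" for g j
  proof (rule Lim_null_comparison)
    show "((\<lambda>n. (real d + 1)\<^sup>2 / \<delta> * (1 / real (Suc n))) \<longlongrightarrow> 0) U"
      using tendsto_mult_right_zero[OF \<epsilon>0] by blast
    show "\<forall>\<^sub>F n in U. norm (B (r g n j) (r g n j)) \<le> (real d + 1)\<^sup>2 / \<delta> * (1 / real (Suc n))"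
      using ev_\<delta>
    proof eventually_elim
      case (elim n)
      have "B (r g n j) (r g n j) \<le> (real d + 1)\<^sup>2 / \<delta> * (1 / real (Suc n))"
        unfolding r_def
        by (rule residual_small[OF v max _ elim])
          (use v[of n] that in \<open>auto simp: B_act T_act v1 top_system_def\<close>)
      then show ?case using B.nonneg by simp
    qed
  qed
  have coeff: "(B (act g (v n j)) (v n i))\<^sup>2 \<le> 1" if "i < d" "j < d" for g n i j
    using B.coeff_le_1[OF o _ that(1), of "act g (v n j)"] that by (simp add: B_act v1)
  define \<rho> where "\<rho> g i j = Lim U (\<lambda>n. B (act g (v n j)) (v n i))" for g i j
  have \<rho>: "((\<lambda>n. B (act g (v n j)) (v n i)) \<longlongrightarrow> \<rho> g i j) U" if "i < d" "j < d" for g i j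
    unfolding \<rho>_def using coeff[OF that] by (intro Ulim BseqI'[of _ 1]) (simp add: abs_square_le_1)
  have mult: "\<rho> (g \<cdot> h) i j = (\<Sum>k<d. \<rho> g i k * \<rho> h k j)" if ij: "i < d" "j < d" for g h i j
  proof (rule tendsto_unique[OF U(1) \<rho>[OF ij]])
    \<comment> \<open>Expanding \<open>act h (v n j)\<close> along \<open>v n\<close> gives the
      matrix product up to the residual.\<close>
    have eq: "B (act (g \<cdot> h) (v n j)) (v n i)
        = (\<Sum>k<d. B (act g (v n k)) (v n i) * B (act h (v n j)) (v n k)) + B (act g (r h n j)) (v n i)" for n
    proof -
      define S where "S = (\<Sum>k<d. B (act h (v n j)) (v n k) *\<^sub>R v n k)"
      have "act h (v n j) = S + r h n j"
        by (simp add: r_def B.residual_def S_def)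
      then have "act g (act h (v n j)) = act g S + act g (r h n j)"
        by (simp add: linear_add[OF linear_act])
      moreover have "act g S = (\<Sum>k<d. B (act h (v n j)) (v n k) *\<^sub>R act g (v n k))"
        by (simp add: S_def linear_sum[OF linear_act] linear_scale[OF linear_act])
      ultimately have "act g (act h (v n j))
          = (\<Sum>k<d. B (act h (v n j)) (v n k) *\<^sub>R act g (v n k)) + act g (r h n j)"
        by simp
      then show ?thesis by (simp add: act_mul B.add_left B.sum_left B.scale_left mult.commute)
    qed
    have "((\<lambda>n. B (act g (r h n j)) (v n i)) \<longlongrightarrow> 0) U"
    proof (rule tendsto_zero_of_square_le[OF r0[OF ij(2)]])
      show "\<forall>\<^sub>F n in U. (B (act g (r h n j)) (v n i))\<^sup>2 \<le> B (r h n j) (r h n j)"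
        using B.cauchy_schwarz[of "act g (r h n j)" "v n i" for n] by (simp add: B_act v1 ij)
    qed
    then have "((\<lambda>n. B (act (g \<cdot> h) (v n j)) (v n i)) \<longlongrightarrow> (\<Sum>k<d. \<rho> g i k * \<rho> h k j) + 0) U"
      unfolding eq by (intro tendsto_intros \<rho>) (use ij in auto)
    then show "((\<lambda>n. B (act (g \<cdot> h) (v n j)) (v n i)) \<longlongrightarrow> (\<Sum>k<d. \<rho> g i k * \<rho> h k j)) U" by simp
  qed
  have one: "\<rho> e i j = (if i = j then 1 else 0)" if ij: "i < d" "j < d" for i j
  proof (rule tendsto_unique[OF U(1) \<rho>[OF ij]])
    have "B (act e (v n j)) (v n i) = (if i = j then 1 else 0)" for n
      using o[of n] ij by (auto simp: act_e B.orthonormal_def)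
    then show "((\<lambda>n. B (act e (v n j)) (v n i)) \<longlongrightarrow> (if i = j then 1 else 0)) U" by simp
  qed
  show thesis
  proof (cases "\<exists>g i j. i < d \<and> j < d \<and> \<rho> g i j \<noteq> (if i = j then 1 else 0)")
    case True
    show thesis by (rule rep[OF mult one True])
  next
    case False
    define w where "w n = v n 0" for n
    have w1: "B (w n) (w n) = 1" for n using v1[of 0] d by (simp add: w_def)
    have "\<rho> g 0 0 = 1" for g using False d by force
    then have inv1: "((\<lambda>n. B (act g (w n)) (w n)) \<longlongrightarrow> 1) U" for g
      using \<rho>[of 0 0 g] d by (simp add: w_def)
    have inv: "((\<lambda>n. B x (act g (w n) - w n)) \<longlongrightarrow> 0) U" for g x
    proof (rule tendsto_zero_of_square_le)
      have "((\<lambda>n. B x x * (2 - 2 * B (act g (w n)) (w n))) \<longlongrightarrow> B x x * (2 - 2 * 1)) U"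
        by (intro tendsto_intros inv1)
      then show "((\<lambda>n. B x x * (2 - 2 * B (act g (w n)) (w n))) \<longlongrightarrow> 0) U" by simp
      show "\<forall>\<^sub>F n in U. (B x (act g (w n) - w n))\<^sup>2 \<le> B x x * (2 - 2 * B (act g (w n)) (w n))"
      proof (rule always_eventually, rule allI)
        fix n
        have "B (act g (w n) - w n) (act g (w n) - w n) = 2 - 2 * B (act g (w n)) (w n)"
          by (simp add: B.diff_left B.diff_right B_act w1 B.sym[of "w n" "act g (w n)"])
        then show "(B x (act g (w n) - w n))\<^sup>2 \<le> B x x * (2 - 2 * B (act g (w n)) (w n))"
          using B.cauchy_schwarz[of x "act g (w n) - w n"] by simp
      qed
    qed
    define c where "c g = Lim U (\<lambda>n. B (b g) (w n))" for g
    have c: "((\<lambda>n. B (b g) (w n)) \<longlongrightarrow> c g) U" for g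
      unfolding c_def using B.cauchy_schwarz[of "b g" "w n" for n]
      by (intro Ulim BseqI'[of _ "sqrt (B (b g) (b g))"]) (simp add: w1 real_le_rsqrt)
    have c_mul: "c (g \<cdot> h) = c g + c h" for g h
    proof (rule tendsto_unique[OF U(1) c])
      have "((\<lambda>n. B (b g) (w n) + B (b h) (w n) - B (act g (b h)) (act g (w n) - w n)) \<longlongrightarrow> c g + c h - 0) U"
        by (intro tendsto_intros c inv)
      then show "((\<lambda>n. B (b (g \<cdot> h)) (w n)) \<longlongrightarrow> c g + c h) U"
        by (simp add: b_mul B.add_left B.diff_right B_act)
    qed
    \<comment> \<open>If \<open>c\<close> vanished, \<open>w\<close> would be weakly null, because
      the cocycle spans the space; by compactness \<open>T (w n) (w n)\<close> would tend to 0
      instead of \<open>top\<close>.\<close>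
    have "\<exists>g. c g \<noteq> 0"
    proof (rule ccontr)
      assume "\<not> ?thesis"
      then have c0: "((\<lambda>n. B (b g) (w n)) \<longlongrightarrow> 0) U" for g using c[of g] by simp
      have "((\<lambda>n. B x (w n)) \<longlongrightarrow> 0) U" for x
      proof -
        obtain F a where "x = (\<Sum>g\<in>F. a g *\<^sub>R b g)" using b_span[of x] by blast
        moreover have "((\<lambda>n. \<Sum>g\<in>F. a g * B (b g) (w n)) \<longlongrightarrow> (\<Sum>g\<in>F. a g * 0)) U"
          by (intro tendsto_intros c0)
        ultimately show ?thesis by (simp add: B.sum_left B.scale_left)
      qed
      then have "\<forall>\<^sub>F n in U. T (w n) (w n) < top / 2"
        using w1 top_pos by (intro weakly_null_imp_T_null) simp_all
      moreover have "\<forall>\<^sub>F n in U. 1 / real (Suc n) < top / 2"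
        using order_tendstoD(2)[OF \<epsilon>0, of "top / 2"] top_pos half_gt_zero by blast
      ultimately have "\<forall>\<^sub>F n in U. False"
      proof eventually_elim
        case (elim n)
        have "top - 1 / real (Suc n) \<le> T (w n) (w n)"
          using v[of n] d by (simp add: top_system_def w_def)
        with elim show ?case by linarith
      qed
      then show False using U(1) by (simp add: trivial_limit_def)
    qed
    with c_mul show thesis by (rule character)
  qed
qed

end

section \<open>Linear groups and characters\<close>

hide_const (open) up_ring.coeff up_ring.monom module.smult Polynomials.degree Polynomials.lead_coeff

section \<open>Finite quotients of finitely generated subrings of the reals\<close>

definition real_subring :: "real set \<Rightarrow> bool" where
  "real_subring R \<longleftrightarrow> 1 \<in> R \<and> (\<forall>x\<in>R. \<forall>y\<in>R. x - y \<in> R \<and> x * y \<in> R)"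

definition proper_ideal :: "real set \<Rightarrow> real set \<Rightarrow> bool" where
  "proper_ideal R I \<longleftrightarrow> I \<subseteq> R \<and> 0 \<in> I \<and> (\<forall>x\<in>I. \<forall>y\<in>I. x - y \<in> I) \<and> (\<forall>x\<in>R. \<forall>y\<in>I. x * y \<in> I) \<and> 1 \<notin> I"

definition finite_index :: "real set \<Rightarrow> real set \<Rightarrow> bool" where
  "finite_index R I \<longleftrightarrow> (\<exists>F. finite F \<and> F \<subseteq> R \<and> (\<forall>x\<in>R. \<exists>y\<in>F. x - y \<in> I))"

text \<open>Requiring \<open>a\<close> to be a unit modulo \<open>I\<close>, rather than only \<open>a \<notin> I\<close>, makes the property
  inductive: it allows several elements to be treated at once through their product.\<close>

definition units_mod_finite :: "real set \<Rightarrow> bool" where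
  "units_mod_finite R \<longleftrightarrow>
     (\<forall>a\<in>R. a \<noteq> 0 \<longrightarrow> (\<exists>I. proper_ideal R I \<and> finite_index R I \<and> (\<exists>u\<in>R. a * u - 1 \<in> I)))"

definition coeffs_in :: "real set \<Rightarrow> real poly \<Rightarrow> bool" where
  "coeffs_in R p \<longleftrightarrow> (\<forall>i. coeff p i \<in> R)"

definition adjoin :: "real set \<Rightarrow> real \<Rightarrow> real set" where
  "adjoin R b = {poly p b |p. coeffs_in R p}"

context
  fixes R :: "real set"
  assumes R: "real_subring R"
begin

lemma ring_diff: "x \<in> R \<Longrightarrow> y \<in> R \<Longrightarrow> x - y \<in> R"
  and ring_mult: "x \<in> R \<Longrightarrow> y \<in> R \<Longrightarrow> x * y \<in> R"
  and ring_1: "1 \<in> R"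
  using R by (auto simp: real_subring_def)

lemma ring_0: "0 \<in> R"
  using ring_diff[OF ring_1 ring_1] by simp

lemma ring_minus: "x \<in> R \<Longrightarrow> - x \<in> R"
  using ring_diff[OF ring_0, of x] by simp

lemma ring_add: "x \<in> R \<Longrightarrow> y \<in> R \<Longrightarrow> x + y \<in> R"
  using ring_diff[OF _ ring_minus, of x y] by simp

lemma ring_sum: "(\<And>i. i \<in> A \<Longrightarrow> f i \<in> R) \<Longrightarrow> sum f A \<in> R"
  by (induction A rule: infinite_finite_induct) (auto simp: ring_0 ring_add)

lemma ring_power: "x \<in> R \<Longrightarrow> x ^ n \<in> R"
  by (induction n) (auto simp: ring_1 ring_mult)

lemma coeffs_in_diff: "coeffs_in R p \<Longrightarrow> coeffs_in R q \<Longrightarrow> coeffs_in R (p - q)"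
  by (simp add: coeffs_in_def ring_diff)

lemma coeffs_in_add: "coeffs_in R p \<Longrightarrow> coeffs_in R q \<Longrightarrow> coeffs_in R (p + q)"
  by (simp add: coeffs_in_def ring_add)

lemma coeffs_in_mult: "coeffs_in R p \<Longrightarrow> coeffs_in R q \<Longrightarrow> coeffs_in R (p * q)"
  by (simp add: coeffs_in_def coeff_mult ring_sum ring_mult)

lemma coeffs_in_smult: "a \<in> R \<Longrightarrow> coeffs_in R p \<Longrightarrow> coeffs_in R (smult a p)"
  by (simp add: coeffs_in_def ring_mult)

lemma coeffs_in_monom: "a \<in> R \<Longrightarrow> coeffs_in R (monom a n)"
  by (simp add: coeffs_in_def ring_0)

lemma coeffs_in_pCons: "a \<in> R \<Longrightarrow> coeffs_in R p \<Longrightarrow> coeffs_in R (pCons a p)"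
  by (auto simp: coeffs_in_def coeff_pCons split: nat.split)

lemma coeffs_in_const: "a \<in> R \<Longrightarrow> coeffs_in R [:a:]"
  by (auto simp: coeffs_in_def coeff_pCons ring_0 split: nat.split)

lemma adjoin_subring: "real_subring (adjoin R b)"
  unfolding real_subring_def adjoin_def
proof (intro conjI ballI)
  show "1 \<in> {poly p b |p. coeffs_in R p}"
    using coeffs_in_const[OF ring_1] by (auto intro!: exI[of _ "[:1:]"])
next
  fix x y assume "x \<in> {poly p b |p. coeffs_in R p}" "y \<in> {poly p b |p. coeffs_in R p}"
  then obtain p q where *: "x = poly p b" "y = poly q b" "coeffs_in R p" "coeffs_in R q" by blast
  show "x - y \<in> {poly p b |p. coeffs_in R p}"
    using * coeffs_in_diff by (auto intro!: exI[of _ "p - q"])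
  show "x * y \<in> {poly p b |p. coeffs_in R p}"
    using * coeffs_in_mult by (auto intro!: exI[of _ "p * q"])
qed

lemma adjoin_base: "R \<subseteq> adjoin R b"
proof
  fix x assume "x \<in> R"
  then have "x = poly [:x:] b" "coeffs_in R [:x:]" by (simp_all add: coeffs_in_const)
  then show "x \<in> adjoin R b" unfolding adjoin_def by blast
qed

lemma adjoin_gen: "b \<in> adjoin R b"
proof -
  have "b = poly [:0, 1:] b" "coeffs_in R [:0, 1:]"
    using coeffs_in_pCons[OF ring_0 coeffs_in_const[OF ring_1]] by simp_all
  then show ?thesis unfolding adjoin_def by blast
qed

text \<open>The leading coefficient of \<open>p\<close> need not be invertible, so each elimination
  of the top term multiplies \<open>f\<close> by it once more; \<open>N\<close> counts these
  rounds.\<close>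

lemma pseudo_division:
  assumes p: "coeffs_in R p" "p \<noteq> 0" and f: "coeffs_in R f"
  shows "\<exists>N w r. coeffs_in R w \<and> coeffs_in R r \<and> smult (lead_coeff p ^ N) f = p * w + r \<and>
           (r = 0 \<or> degree r < degree p)"
  using f
proof (induction "degree f" arbitrary: f rule: less_induct)
  case less
  have c: "lead_coeff p \<in> R" using p by (simp add: coeffs_in_def)
  show ?case
  proof (cases "f = 0 \<or> degree f < degree p")
    case True
    show ?thesis
      by (rule exI[of _ 0], rule exI[of _ 0], rule exI[of _ f])
        (use True less.prems in \<open>auto simp: coeffs_in_def ring_0\<close>)
  next
    case False
    define m where "m = monom (lead_coeff f) (degree f - degree p)"
    define g where "g = smult (lead_coeff p) f - p * m"
    have m: "coeffs_in R m" unfolding m_def by (rule coeffs_in_monom) (use less.prems in \<open>simp add: coeffs_in_def\<close>)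
    have g: "coeffs_in R g" unfolding g_def
      by (intro coeffs_in_diff coeffs_in_smult coeffs_in_mult c p less.prems m)
    have split: "smult (lead_coeff p) f = p * m + g" by (simp add: g_def)
    show ?thesis
    proof (cases "g = 0")
      case True
      show ?thesis
        by (rule exI[of _ 1], rule exI[of _ m], rule exI[of _ 0])
          (use True split m in \<open>auto simp: coeffs_in_def ring_0\<close>)
    next
      case g0: False
      have "coeff (p * m) (degree f) = lead_coeff p * lead_coeff f"
        using False coeff_mult_degree_sum[of p m] by (simp add: m_def degree_monom_eq)
      then have "coeff g (degree f) = 0" by (simp add: g_def)
      moreover have "degree g \<le> degree f" unfolding g_def m_def
        using False p by (intro degree_diff_le) (auto simp: degree_mult_eq degree_monom_eq)
      ultimately have "degree g < degree f"
        using g0 eq_zero_or_degree_less by blast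
      from less.hyps[OF this g] obtain N w r where IH: "coeffs_in R w" "coeffs_in R r"
        "smult (lead_coeff p ^ N) g = p * w + r" "r = 0 \<or> degree r < degree p" by blast
      have "smult (lead_coeff p ^ Suc N) f = smult (lead_coeff p ^ N) (smult (lead_coeff p) f)"
        by (simp add: mult.commute)
      also have "\<dots> = p * (smult (lead_coeff p ^ N) m + w) + r"
        by (simp add: split smult_add_right IH(3) distrib_left)
      finally have "smult (lead_coeff p ^ Suc N) f = p * (smult (lead_coeff p ^ N) m + w) + r" .
      moreover have "coeffs_in R (smult (lead_coeff p ^ N) m + w)"
        by (intro coeffs_in_add coeffs_in_smult ring_power c m IH)
      ultimately show ?thesis using IH(2,4) by blast
    qed
  qed
qed

context
  fixes I :: "real set"
  assumes I: "proper_ideal R I"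
begin

lemma ideal_diff: "x \<in> I \<Longrightarrow> y \<in> I \<Longrightarrow> x - y \<in> I"
  and ideal_mult: "x \<in> R \<Longrightarrow> y \<in> I \<Longrightarrow> x * y \<in> I"
  and ideal_0: "0 \<in> I" and ideal_sub: "I \<subseteq> R" and ideal_1: "1 \<notin> I"
  using I by (auto simp: proper_ideal_def)

lemma ideal_minus: "x \<in> I \<Longrightarrow> - x \<in> I"
  using ideal_diff[OF ideal_0, of x] by simp

lemma ideal_add: "x \<in> I \<Longrightarrow> y \<in> I \<Longrightarrow> x + y \<in> I"
  using ideal_diff[OF _ ideal_minus, of x y] by simp

lemma ideal_sum: "(\<And>i. i \<in> A \<Longrightarrow> f i \<in> I) \<Longrightarrow> sum f A \<in> I"
  by (induction A rule: infinite_finite_induct) (auto simp: ideal_0 ideal_add)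

lemma ideal_cancel_unit:
  assumes "u \<in> R" "c * u - 1 \<in> I" "x \<in> R" "c * x \<in> I"
  shows "x \<in> I"
proof -
  have "u * (c * x) - x * (c * u - 1) \<in> I"
    by (rule ideal_diff[OF ideal_mult[OF assms(1,4)] ideal_mult[OF assms(3,2)]])
  then show ?thesis by (simp add: algebra_simps)
qed

lemma ideal_power_unit:
  assumes "u \<in> R" "c \<in> R" "c * u - 1 \<in> I"
  shows "c ^ N \<notin> I"
proof (induction N)
  case 0 then show ?case using ideal_1 by simp
next
  case (Suc N)
  then show ?case using ideal_cancel_unit[OF assms(1,3) ring_power[OF assms(2)], of N] by auto
qed

lemma coeffs_in_ideal_diff: "coeffs_in I p \<Longrightarrow> coeffs_in I q \<Longrightarrow> coeffs_in I (p - q)"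
  by (simp add: coeffs_in_def ideal_diff)

lemma coeffs_in_ideal_add: "coeffs_in I p \<Longrightarrow> coeffs_in I q \<Longrightarrow> coeffs_in I (p + q)"
  by (simp add: coeffs_in_def ideal_add)

lemma coeffs_in_ideal_mult: "coeffs_in R p \<Longrightarrow> coeffs_in I q \<Longrightarrow> coeffs_in I (p * q)"
  by (simp add: coeffs_in_def coeff_mult ideal_sum ideal_mult)

lemma coeffs_in_ideal_monom: "a \<in> I \<Longrightarrow> coeffs_in I (monom a n)"
  by (simp add: coeffs_in_def ideal_0)

lemma coeffs_in_ideal_sub: "coeffs_in I p \<Longrightarrow> coeffs_in R p"
  using ideal_sub by (auto simp: coeffs_in_def)

context
  fixes q :: "real poly" and u :: real
  assumes q: "coeffs_in R q" "degree q \<ge> 1" and u: "u \<in> R" "lead_coeff q * u - 1 \<in> I"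
begin

text \<open>Over the quotient of \<open>R\<close> by \<open>I\<close>, the polynomial
  \<open>q\<close> has positive degree and invertible leading coefficient, so \<open>q * h\<close>
  is constant only for \<open>h = 0\<close>; the coefficients of \<open>h\<close> are shown to lie
  in \<open>I\<close> from the top down.\<close>

lemma mult_cong_const_imp:
  assumes h: "coeffs_in R h" and s: "coeffs_in I (q * h - [:s:])"
  shows "s \<in> I"
proof -
  let ?n = "degree q"
  have hI: "coeff h k \<in> I" for k
  proof (induction "degree h - k" arbitrary: k rule: less_induct)
    case less
    show ?case
    proof (cases "k \<le> degree h")
      case False then show ?thesis by (simp add: coeff_eq_0 ideal_0)
    next
      case True
      have hi: "coeff h j \<in> I" if "j > k" for j
      proof (cases "j \<le> degree h")
        case True with that show ?thesis by (intro less) auto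
      qed (simp add: coeff_eq_0 ideal_0)
      \<comment> \<open>All terms of this coefficient of \<open>q * h\<close> other than the leading
        one involve coefficients of \<open>h\<close> above \<open>k\<close>.\<close>
      have "(\<Sum>i\<in>{..?n + k} - {?n}. coeff q i * coeff h (?n + k - i)) \<in> I"
      proof (rule ideal_sum)
        fix i assume i: "i \<in> {..?n + k} - {?n}"
        show "coeff q i * coeff h (?n + k - i) \<in> I"
        proof (cases "i < ?n")
          case True
          then show ?thesis using q by (intro ideal_mult hi) (auto simp: coeffs_in_def)
        next
          case False
          with i show ?thesis by (simp add: coeff_eq_0 ideal_0)
        qed
      qed
      moreover have "coeff [:s:] (?n + k) = 0"
        using q(2) by (cases "?n + k") (auto simp: coeff_pCons)
      then have "coeff (q * h) (?n + k) \<in> I"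
        using s[unfolded coeffs_in_def, rule_format, of "?n + k"] by simp
      moreover have "coeff (q * h) (?n + k)
          = lead_coeff q * coeff h k + (\<Sum>i\<in>{..?n + k} - {?n}. coeff q i * coeff h (?n + k - i))"
        unfolding coeff_mult by (subst sum.remove[of _ ?n]) auto
      ultimately have "lead_coeff q * coeff h k \<in> I"
        using ideal_diff by fastforce
      then show ?thesis
        using ideal_cancel_unit[OF u] h by (simp add: coeffs_in_def)
    qed
  qed
  have "coeffs_in I (q * h - (q * h - [:s:]))"
    by (intro coeffs_in_ideal_diff s coeffs_in_ideal_mult q) (simp add: coeffs_in_def hI)
  then show ?thesis by (auto simp: coeffs_in_def dest: spec[of _ 0])
qed

text \<open>The ideal of \<open>adjoin R b\<close> generated by \<open>I\<close> and
  \<open>poly q b\<close>, described by polynomial representatives. Whether it is proper depends on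
  the relations between \<open>b\<close> and \<open>R\<close>, hence the premise of
  \<open>extension_ideal\<close>.\<close>

definition extension :: "real \<Rightarrow> real set" where
  "extension b = {poly (i + q * h) b |i h. coeffs_in I i \<and> coeffs_in R h}"

lemma extensionI: "coeffs_in I i \<Longrightarrow> coeffs_in R h \<Longrightarrow> x = poly (i + q * h) b \<Longrightarrow> x \<in> extension b"
  unfolding extension_def by blast

lemma ideal_sub_extension: "I \<subseteq> extension b"
proof
  fix x assume "x \<in> I"
  then show "x \<in> extension b"
    using coeffs_in_ideal_monom[of x 0] coeffs_in_const[OF ring_0]
    by (intro extensionI[of "[:x:]" 0]) (simp_all add: monom_0)
qed

lemma poly_extension: "poly q b \<in> extension b"
  using coeffs_in_ideal_monom[OF ideal_0, of 0] coeffs_in_const[OF ring_1]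
  by (intro extensionI[of 0 1]) (simp_all add: monom_0 one_pCons)

lemma extension_ideal:
  assumes "1 \<notin> extension b"
  shows "proper_ideal (adjoin R b) (extension b)"
  unfolding proper_ideal_def
proof (intro conjI ballI)
  show "extension b \<subseteq> adjoin R b"
  proof
    fix x assume "x \<in> extension b"
    then obtain i h where ih: "coeffs_in I i" "coeffs_in R h" "x = poly (i + q * h) b"
      unfolding extension_def by blast
    moreover have "coeffs_in R (i + q * h)"
      using ih by (intro coeffs_in_add coeffs_in_mult q) (simp_all add: coeffs_in_ideal_sub)
    ultimately show "x \<in> adjoin R b" unfolding adjoin_def by blast
  qed
  show "0 \<in> extension b" using ideal_sub_extension ideal_0 by blast
next
  fix x y assume "x \<in> extension b" "y \<in> extension b"
  then obtain i h j k where *: "coeffs_in I i" "coeffs_in R h" "x = poly (i + q * h) b"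
     "coeffs_in I j" "coeffs_in R k" "y = poly (j + q * k) b" unfolding extension_def by blast
  have "x - y = poly ((i - j) + q * (h - k)) b" by (simp add: * right_diff_distrib)
  then show "x - y \<in> extension b"
    using * by (intro extensionI[OF coeffs_in_ideal_diff coeffs_in_diff])
next
  fix x y assume "x \<in> adjoin R b" "y \<in> extension b"
  then obtain p j k where *: "coeffs_in R p" "x = poly p b"
     "coeffs_in I j" "coeffs_in R k" "y = poly (j + q * k) b" unfolding extension_def adjoin_def by blast
  have "x * y = poly (p * j + q * (p * k)) b" by (simp add: * distrib_left mult_ac)
  then show "x * y \<in> extension b"
    using * by (intro extensionI[OF coeffs_in_ideal_mult coeffs_in_mult])
qed fact

text \<open>The leading coefficient of \<open>q\<close> is invertible only modulo \<open>I\<close>,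
  so it cancels the top term of \<open>p\<close> up to a coefficient in \<open>I\<close>; that
  leftover term is moved into \<open>i\<close>.\<close>

lemma division_mod_ideal:
  assumes "coeffs_in R p"
  shows "\<exists>r i h. coeffs_in R r \<and> coeffs_in I i \<and> coeffs_in R h \<and> p = r + i + q * h \<and> degree r < degree q"
  using assms
proof (induction "degree p" arbitrary: p rule: less_induct)
  case less
  let ?n = "degree q" and ?m = "degree p"
  show ?case
  proof (cases "?m < ?n")
    case True
    then show ?thesis using less.prems
      by (intro exI[of _ p] exI[of _ 0]) (auto simp: coeffs_in_def ring_0 ideal_0)
  next
    case False
    define t where "t = monom (u * lead_coeff p) (?m - ?n)"
    define p' where "p' = p - q * t"
    define z where "z = monom (coeff p' ?m) ?m"
    have pR: "lead_coeff p \<in> R" using less.prems by (simp add: coeffs_in_def)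
    have t: "coeffs_in R t" unfolding t_def by (intro coeffs_in_monom ring_mult u pR)
    have p': "coeffs_in R p'" unfolding p'_def by (intro coeffs_in_diff coeffs_in_mult less.prems q t)
    have "coeff (t * q) (?n + (?m - ?n)) = u * lead_coeff p * lead_coeff q"
      unfolding t_def by (simp add: coeff_monom_mult)
    then have "coeff (q * t) (?n + (?m - ?n)) = u * lead_coeff p * lead_coeff q"
      by (simp only: mult.commute[of t q])
    then have "coeff p' ?m = lead_coeff p * (1 - lead_coeff q * u)"
      using False by (simp add: p'_def algebra_simps)
    also have "\<dots> = - (lead_coeff p * (lead_coeff q * u - 1))" by (simp add: algebra_simps)
    also have "\<dots> \<in> I" by (intro ideal_minus ideal_mult pR u)
    finally have "coeff p' ?m \<in> I" .
    then have z: "coeffs_in I z" unfolding z_def by (rule coeffs_in_ideal_monom)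
    have "degree (q * t) \<le> ?n + (?m - ?n)"
      unfolding t_def by (meson add_left_mono degree_monom_le degree_mult_le order_trans)
    then have "degree p' \<le> ?m" unfolding p'_def using False by (intro degree_diff_le) auto
    then have "degree (p' - z) \<le> ?m" unfolding z_def by (intro degree_diff_le degree_monom_le)
    moreover have "coeff (p' - z) ?m = 0" by (simp add: z_def)
    ultimately have "p' - z = 0 \<or> degree (p' - z) < ?m" using eq_zero_or_degree_less by blast
    then have deg: "degree (p' - z) < ?m" using False q(2) by auto
    have "coeffs_in R (p' - z)" by (intro coeffs_in_diff p' coeffs_in_ideal_sub z)
    from less.hyps[OF deg this] obtain r i h where IH: "coeffs_in R r" "coeffs_in I i" "coeffs_in R h"
      "p' - z = r + i + q * h" "degree r < ?n" by blast
    have "p = r + (i + z) + q * (h + t)"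
      using IH(4) by (simp add: p'_def algebra_simps)
    moreover have "coeffs_in I (i + z)" "coeffs_in R (h + t)"
      by (intro coeffs_in_ideal_add coeffs_in_add IH z t)+
    ultimately show ?thesis using IH(1,5) by blast
  qed
qed

text \<open>A remainder modulo \<open>q\<close> has at most \<open>degree q\<close> coefficients,
  and each matters only modulo \<open>I\<close>: lists of length \<open>degree q\<close> over
  representatives of \<open>R\<close> modulo \<open>I\<close> suffice.\<close>

lemma extension_finite_index:
  assumes "finite_index R I"
  shows "finite_index (adjoin R b) (extension b)"
proof -
  obtain F where F: "finite F" "F \<subseteq> R" "\<forall>x\<in>R. \<exists>y\<in>F. x - y \<in> I"
    using assms unfolding finite_index_def by blast
  then obtain cl where cl: "\<And>x. x \<in> R \<Longrightarrow> cl x \<in> F \<and> x - cl x \<in> I" by metis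
  let ?n = "degree q"
  let ?F = "(\<lambda>ys. poly (Poly ys) b) ` {ys. set ys \<subseteq> F \<and> length ys = ?n}"
  have Poly: "coeffs_in R (Poly ys)" if "set ys \<subseteq> F" for ys
    using that F(2) by (force simp: coeffs_in_def nth_default_def ring_0)
  show ?thesis unfolding finite_index_def
  proof (intro exI[of _ ?F] conjI ballI)
    show "finite ?F" using finite_lists_length_eq[OF F(1)] by blast
    show "?F \<subseteq> adjoin R b" using Poly by (auto simp: adjoin_def)
    fix x assume "x \<in> adjoin R b"
    then obtain p where p: "coeffs_in R p" "x = poly p b" by (auto simp: adjoin_def)
    obtain r i h where r: "coeffs_in R r" "coeffs_in I i" "coeffs_in R h" "p = r + i + q * h" "degree r < ?n"
      using division_mod_ideal[OF p(1)] by blast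
    define ys where "ys = map (\<lambda>k. cl (coeff r k)) [0..<?n]"
    have rR: "coeff r k \<in> R" for k using r(1) by (simp add: coeffs_in_def)
    have "set ys \<subseteq> F" "length ys = ?n" using cl[OF rR] by (auto simp: ys_def)
    moreover have "coeffs_in I (r - Poly ys)"
      unfolding coeffs_in_def
    proof
      fix k
      show "coeff (r - Poly ys) k \<in> I"
      proof (cases "k < ?n")
        case True
        then show ?thesis using cl[OF rR] by (simp add: ys_def nth_default_def)
      next
        case False
        then show ?thesis using r(5) by (simp add: ys_def nth_default_def coeff_eq_0 ideal_0)
      qed
    qed
    then have "coeffs_in I (r - Poly ys + i)" using r(2) by (rule coeffs_in_ideal_add)
    then have "x - poly (Poly ys) b \<in> extension b"
      by (rule extensionI[OF _ r(3)]) (simp add: p(2) r(4))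
    ultimately show "\<exists>y\<in>?F. x - y \<in> extension b" by blast
  qed
qed

end

end

text \<open>Elements of \<open>adjoin R b\<close> are algebraic over \<open>R\<close>, so a nonzero
  one has a nonzero multiple in \<open>R\<close>. Dividing the relation \<open>p\<close> of least
  degree by \<open>g\<close> shows that, up to sign, a multiple of \<open>poly g b\<close> is the
  value of a remainder of smaller degree; minimality of \<open>p\<close> keeps it nonzero, and the
  descent ends at a constant.\<close>

lemma algebraic_divides_base:
  assumes p: "coeffs_in R p" "p \<noteq> 0" "poly p b = 0"
    and min: "\<And>f. coeffs_in R f \<Longrightarrow> poly f b = 0 \<Longrightarrow> f \<noteq> 0 \<Longrightarrow> degree p \<le> degree f"
    and g: "coeffs_in R g" "poly g b \<noteq> 0"
  shows "\<exists>a\<in>adjoin R b. \<exists>e\<in>R. e \<noteq> 0 \<and> poly g b * a = e"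
proof -
  have low: "\<exists>a\<in>adjoin R b. \<exists>e\<in>R. e \<noteq> 0 \<and> poly g b * a = e"
    if "coeffs_in R g" "poly g b \<noteq> 0" "degree g < degree p" for g
    using that
  proof (induction "degree g" arbitrary: g rule: less_induct)
    case less
    show ?case
    proof (cases "degree g = 0")
      case True
      then obtain e where "g = [:e:]" using degree_eq_zeroE by blast
      then show ?thesis using less.prems ring_1 adjoin_base
        by (intro bexI[of _ 1] bexI[of _ e]) (auto simp: coeffs_in_def dest: spec[of _ 0])
    next
      case False
      have g0: "g \<noteq> 0" using less.prems by auto
      obtain N w r where wr: "coeffs_in R w" "coeffs_in R r" "smult (lead_coeff g ^ N) p = g * w + r"
        "r = 0 \<or> degree r < degree g"
        using pseudo_division[OF less.prems(1) g0 p(1)] by blast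
      have "poly (smult (lead_coeff g ^ N) p) b = 0" using p by simp
      then have eval: "poly g b * poly w b = - poly r b" unfolding wr(3) by simp
      have "r \<noteq> 0"
      proof
        assume r: "r = 0"
        then have "poly w b = 0" using eval less.prems by simp
        moreover have gw: "smult (lead_coeff g ^ N) p = g * w" using wr r by simp
        then have w0: "w \<noteq> 0" using p g0 by auto
        ultimately have "degree p \<le> degree w" using min wr by blast
        moreover have "degree p = degree g + degree w"
          using arg_cong[OF gw, of degree] g0 w0 by (simp add: degree_mult_eq)
        ultimately show False using False by simp
      qed
      then have dr: "degree r < degree g" using wr by blast
      then have "poly r b \<noteq> 0" using min[OF wr(2)] \<open>r \<noteq> 0\<close> less.prems(3) by auto
      from less.hyps[OF dr wr(2) this] dr less.prems(3) obtain a e where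
        a: "a \<in> adjoin R b" "e \<in> R" "e \<noteq> 0" "poly r b * a = e" by auto
      have "- (poly w b * a) \<in> adjoin R b"
      proof -
        have "poly w b \<in> adjoin R b" using wr(1) unfolding adjoin_def by blast
        moreover have "0 \<in> adjoin R b" using adjoin_base ring_0 by blast
        ultimately have "0 - poly w b * a \<in> adjoin R b"
          using a(1) adjoin_subring unfolding real_subring_def by blast
        then show ?thesis by simp
      qed
      moreover have "poly g b * (- (poly w b * a)) = e"
        using eval a(4) by (simp add: mult.assoc[symmetric])
      ultimately show ?thesis using a by blast
    qed
  qed
  \<comment> \<open>A polynomial of arbitrary degree is first reduced modulo \<open>p\<close>, which
    only multiplies its value at \<open>b\<close> by a power of the leading coefficient.\<close>
  obtain N w r where wr: "coeffs_in R w" "coeffs_in R r" "smult (lead_coeff p ^ N) g = p * w + r"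
    "r = 0 \<or> degree r < degree p"
    using pseudo_division[OF p(1,2) g(1)] by blast
  have cN: "lead_coeff p ^ N \<in> R" using p(1) by (intro ring_power) (simp add: coeffs_in_def)
  have eval: "poly r b = lead_coeff p ^ N * poly g b"
    using arg_cong[OF wr(3), of "\<lambda>f. poly f b"] p(3) by simp
  then have r0: "poly r b \<noteq> 0" using g p by simp
  then have "degree r < degree p" using wr(4) by auto
  from low[OF wr(2) r0 this] obtain a e where a: "a \<in> adjoin R b" "e \<in> R" "e \<noteq> 0" "poly r b * a = e" by blast
  have "lead_coeff p ^ N * a \<in> adjoin R b"
    using cN adjoin_base a adjoin_subring unfolding real_subring_def by blast
  moreover have "poly g b * (lead_coeff p ^ N * a) = e"
    using a(4) unfolding eval by (simp add: mult_ac)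
  ultimately show ?thesis using a(2,3) by blast
qed

end

text \<open>If \<open>b\<close> is transcendental over \<open>R\<close>, the leading coefficient of
  \<open>g\<close> has to become invertible. If \<open>b\<close> is algebraic, two elements of
  \<open>R\<close> have to: the leading coefficient of a minimal relation and a multiple
  \<open>e\<close> of \<open>a\<close>; an ideal for their product does both.\<close>

lemma units_mod_finite_adjoin:
  assumes R: "real_subring R" and U: "units_mod_finite R"
  shows "units_mod_finite (adjoin R b)"
  unfolding units_mod_finite_def
proof (intro ballI impI)
  fix a assume "a \<in> adjoin R b" and a0: "a \<noteq> 0"
  then obtain g where g: "coeffs_in R g" "a = poly g b" by (auto simp: adjoin_def)
  have g0: "g \<noteq> 0" using g(2) a0 by auto
  show "\<exists>I. proper_ideal (adjoin R b) I \<and> finite_index (adjoin R b) I \<and> (\<exists>u\<in>adjoin R b. a * u - 1 \<in> I)"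
  proof (cases "\<exists>p. coeffs_in R p \<and> p \<noteq> 0 \<and> poly p b = 0")
    case False
    have cR: "lead_coeff g \<in> R" using g(1) by (simp add: coeffs_in_def)
    obtain I u where I: "proper_ideal R I" "finite_index R I" and u: "u \<in> R" "lead_coeff g * u - 1 \<in> I"
      using U cR g0 unfolding units_mod_finite_def by (metis leading_coeff_0_iff)
    \<comment> \<open>This is X g - 1; modulo it \<open>b\<close> is an inverse of
      \<open>a\<close>.\<close>
    define q where "q = pCons (- 1) g"
    have q: "coeffs_in R q" unfolding q_def
      by (intro coeffs_in_pCons[OF R] g ring_minus[OF R] ring_1[OF R])
    have dq: "degree q \<ge> 1" and lq: "lead_coeff q = lead_coeff g" using g0 by (simp_all add: q_def)
    note ctx = R I(1) q dq u(1) u(2)[folded lq]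
    have "1 \<notin> extension R I q b"
    proof
      assume "1 \<in> extension R I q b"
      then obtain i h where ih: "coeffs_in I i" "coeffs_in R h" "poly (i + q * h) b = 1"
        unfolding extension_def[OF ctx] by auto
      have "coeffs_in R (i + q * h - 1)"
        using ih coeffs_in_const[OF R ring_1[OF R]] coeffs_in_ideal_sub[OF R I(1)]
        by (intro coeffs_in_diff[OF R] coeffs_in_add[OF R] coeffs_in_mult[OF R] q) (simp_all add: one_pCons)
      moreover have "poly (i + q * h - 1) b = 0" using ih(3) by simp
      ultimately have "i + q * h - 1 = 0" using False by blast
      then have "q * h - [:1:] = 0 - i" by (simp add: one_pCons algebra_simps)
      moreover have "coeffs_in I (0 - i)"
        by (rule coeffs_in_ideal_diff[OF R I(1) _ ih(1)]) (simp add: coeffs_in_def ideal_0[OF R I(1)])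
      ultimately have "1 \<in> I" using mult_cong_const_imp[OF ctx ih(2), of 1] by simp
      then show False using ideal_1[OF R I(1)] by blast
    qed
    note 1 = extension_ideal[OF ctx this] extension_finite_index[OF ctx I(2)]
    have "a * b - 1 \<in> extension R I q b"
      using poly_extension[OF ctx, of b] by (simp add: q_def g(2) algebra_simps)
    then show ?thesis using 1 adjoin_gen[OF R, of b] by blast
  next
    case True
    then obtain p0 where p0: "coeffs_in R p0 \<and> p0 \<noteq> 0 \<and> poly p0 b = 0" by blast
    define p where "p = (ARG_MIN degree p. coeffs_in R p \<and> p \<noteq> 0 \<and> poly p b = 0)"
    note arg_min = arg_min_nat_lemma[of "\<lambda>p. coeffs_in R p \<and> p \<noteq> 0 \<and> poly p b = 0", OF p0, of degree,
        folded p_def]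
    have p: "coeffs_in R p" "p \<noteq> 0" "poly p b = 0" using arg_min by blast+
    have min: "degree p \<le> degree f" if "coeffs_in R f" "poly f b = 0" "f \<noteq> 0" for f
      using arg_min that by blast
    obtain a' e where a': "a' \<in> adjoin R b" "e \<in> R" "e \<noteq> 0" "a * a' = e"
      using algebraic_divides_base[OF R p min g(1)] a0 g(2) by blast
    have cR: "lead_coeff p \<in> R" using p(1) by (simp add: coeffs_in_def)
    obtain I u where I: "proper_ideal R I" "finite_index R I" and u: "u \<in> R" "(lead_coeff p * e) * u - 1 \<in> I"
      using U ring_mult[OF R cR a'(2)] a'(3) p(2) unfolding units_mod_finite_def
      by (metis leading_coeff_0_iff mult_eq_0_iff)
    have u1: "lead_coeff p * (e * u) - 1 \<in> I" and u2: "e * (lead_coeff p * u) - 1 \<in> I"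
      using u(2) by (simp_all add: mult_ac)
    have uR: "e * u \<in> R" "lead_coeff p * u \<in> R" using ring_mult[OF R] a'(2) u(1) cR by blast+
    have dp: "degree p \<ge> 1"
    proof (rule ccontr)
      assume "\<not> degree p \<ge> 1"
      then obtain k where "p = [:k:]" using degree_eq_zeroE[of p] by (metis less_one not_le)
      with p(2,3) show False by simp
    qed
    note ctx = R I(1) p(1) dp uR(1) u1
    have "1 \<notin> extension R I p b"
    proof
      assume "1 \<in> extension R I p b"
      then obtain i h where ih: "coeffs_in I i" "coeffs_in R h" "poly (i + p * h) b = 1"
        unfolding extension_def[OF ctx] by auto
      have "coeffs_in R (i + p * h - 1)"
        using ih coeffs_in_const[OF R ring_1[OF R]] coeffs_in_ideal_sub[OF R I(1)]
        by (intro coeffs_in_diff[OF R] coeffs_in_add[OF R] coeffs_in_mult[OF R] p) (simp_all add: one_pCons)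
      \<comment> \<open>The polynomial \<open>i + p * h - 1\<close> vanishes at \<open>b\<close>, so
        pseudo-division by the minimal \<open>p\<close> leaves no remainder. Then
        \<open>mult_cong_const_imp\<close> puts a power of the leading coefficient, a unit modulo
        \<open>I\<close>, into \<open>I\<close>.\<close>
      from pseudo_division[OF R p(1,2) this] obtain N w r where wr: "coeffs_in R w" "coeffs_in R r"
        "smult (lead_coeff p ^ N) (i + p * h - 1) = p * w + r" "r = 0 \<or> degree r < degree p" by blast
      let ?c = "lead_coeff p ^ N"
      have cN: "?c \<in> R" by (rule ring_power[OF R cR])
      have "poly (p * w + r) b = 0" unfolding wr(3)[symmetric] using ih(3) by simp
      then have "poly r b = 0" using p(3) by simp
      then have "r = 0" using min[OF wr(2)] wr(4) by force
      define t where "t = smult ?c h"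
      have "smult ?c (i + p * h - 1) = smult ?c i + p * t - [:?c:]"
        by (simp add: t_def smult_diff_right smult_add_right one_pCons)
      then have eq: "p * (w - t) - [:- ?c:] = smult ?c i"
        using wr(3) \<open>r = 0\<close> by (simp add: right_diff_distrib flip: minus_pCons) (simp add: algebra_simps)
      have "coeffs_in I (smult ?c i)"
        using ih(1) ideal_mult[OF R I(1) cN] by (simp add: coeffs_in_def)
      then have "- ?c \<in> I"
        using mult_cong_const_imp[OF ctx, of "w - t" "- ?c"] eq
          coeffs_in_diff[OF R wr(1) coeffs_in_smult[OF R cN ih(2)]] by (simp add: t_def)
      then have "?c \<in> I" using ideal_minus[OF R I(1)] by fastforce
      then show False using ideal_power_unit[OF R I(1) uR(1) cR u1] by blast
    qed
    note 1 = extension_ideal[OF ctx this] extension_finite_index[OF ctx I(2)]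
    have "a * (a' * (lead_coeff p * u)) - 1 = e * (lead_coeff p * u) - 1"
      using a'(4) by (simp add: mult.assoc[symmetric])
    then have "a * (a' * (lead_coeff p * u)) - 1 \<in> extension R I p b"
      using subsetD[OF ideal_sub_extension[OF ctx] u2] by (simp only:)
    moreover have "a' * (lead_coeff p * u) \<in> adjoin R b"
      using ring_mult[OF adjoin_subring[OF R] a'(1)] uR(2) adjoin_base[OF R] by blast
    ultimately show ?thesis using 1 by blast
  qed
qed

lemma units_mod_finite_Ints: "units_mod_finite \<int>"
  unfolding units_mod_finite_def
proof (intro ballI impI)
  fix a :: real assume "a \<in> \<int>" "a \<noteq> 0"
  then obtain z :: int where z: "a = of_int z" "z \<noteq> 0" by (auto elim: Ints_cases)
  \<comment> \<open>\<open>z\<close> times \<open>- sgn z\<close> equals \<open>1 - m\<close>, so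
    \<open>- sgn z\<close> inverts \<open>z\<close> modulo \<open>m\<close>; and \<open>m\<close> is
    at least 2, which makes the ideal proper.\<close>
  define m where "m = \<bar>z\<bar> + 1"
  have m: "m \<ge> 2" using z(2) by (simp add: m_def)
  define I :: "real set" where "I = {of_int (m * k) |k. True}"
  have mem: "of_int x \<in> I \<longleftrightarrow> m dvd x" for x
    unfolding I_def dvd_def by (auto simp only: of_int_eq_iff mem_Collect_eq)
  have "proper_ideal \<int> I"
    unfolding proper_ideal_def
  proof (intro conjI ballI)
    show "I \<subseteq> \<int>" by (auto simp: I_def)
    show "0 \<in> I" using mem[of 0] by simp
    show "1 \<notin> I" using mem[of 1] m by simp
  next
    fix x y assume "x \<in> I" "y \<in> I"
    then obtain k l where "x = of_int (m * k)" "y = of_int (m * l)" by (auto simp: I_def)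
    then have "x - y = of_int (m * (k - l))" by (simp add: algebra_simps)
    then show "x - y \<in> I" unfolding I_def by blast
  next
    fix x y :: real assume "x \<in> \<int>" "y \<in> I"
    then obtain l where l: "y = of_int (m * l)" by (auto simp: I_def)
    from \<open>x \<in> \<int>\<close> obtain k where "x = of_int k" by (rule Ints_cases)
    with l have "x * y = of_int (m * (k * l))" by (simp add: algebra_simps)
    then show "x * y \<in> I" unfolding I_def by blast
  qed
  moreover have "finite_index \<int> I"
    unfolding finite_index_def
  proof (intro exI[of _ "of_int ` {0..<m}"] conjI ballI)
    fix x :: real assume "x \<in> \<int>"
    then obtain k where k: "x = of_int k" by (auto elim: Ints_cases)
    have "x - of_int (k mod m) \<in> I" using mem[of "k - k mod m"] k by (simp add: mod_eq_dvd_iff[symmetric])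
    moreover have "k mod m \<in> {0..<m}" using m by simp
    ultimately show "\<exists>y\<in>of_int ` {0..<m}. x - y \<in> I" by blast
  qed auto
  moreover have "a * of_int (- sgn z) - 1 \<in> I"
  proof -
    have "a * of_int (- sgn z) - 1 = (of_int (- m) :: real)"
      unfolding z(1) m_def by (simp add: abs_sgn[of z] flip: of_int_mult)
    then show ?thesis using mem[of "- m"] by simp
  qed
  ultimately show "\<exists>I. proper_ideal \<int> I \<and> finite_index \<int> I \<and> (\<exists>u\<in>\<int>. a * u - 1 \<in> I)"
    by (blast intro: Ints_of_int)
qed

lemma finite_subset_units_mod_finite:
  assumes "finite Y"
  shows "\<exists>R. real_subring R \<and> Y \<subseteq> R \<and> units_mod_finite R"
  using assms
proof (induction Y)
  case empty
  have "real_subring \<int>" by (auto simp: real_subring_def)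
  then show ?case using units_mod_finite_Ints by blast
next
  case (insert b Y)
  then obtain R where R: "real_subring R" "Y \<subseteq> R" "units_mod_finite R" by blast
  then show ?case
    using adjoin_subring[of R b] adjoin_base[of R b] adjoin_gen[of R b] units_mod_finite_adjoin[of R b]
    by (intro exI[of _ "adjoin R b"]) blast
qed

text \<open>Malcev: finitely generated linear groups are residually finite.\<close>

lemma (in Group.group) matrix_rep_imp_not_simple:
  fixes \<rho> :: "'a \<Rightarrow> nat \<Rightarrow> nat \<Rightarrow> real"
  assumes S: "finite_symmetric_generating_set G S" and inf: "infinite (carrier G)"
    and mult: "\<And>g h i j. g \<in> carrier G \<Longrightarrow> h \<in> carrier G \<Longrightarrow> i < d \<Longrightarrow> j < d \<Longrightarrow>
                 \<rho> (g \<otimes> h) i j = (\<Sum>k<d. \<rho> g i k * \<rho> h k j)"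
    and one: "\<And>i j. i < d \<Longrightarrow> j < d \<Longrightarrow> \<rho> \<one> i j = (if i = j then 1 else 0)"
    and nontrivial: "\<exists>g\<in>carrier G. \<exists>i<d. \<exists>j<d. \<rho> g i j \<noteq> (if i = j then 1 else 0)"
  shows "\<not> is_simple G"
proof
  assume simple: "is_simple G"
  define \<delta> :: "nat \<Rightarrow> nat \<Rightarrow> real" where "\<delta> i j = (if i = j then 1 else 0)" for i j
  have sum_\<delta>: "(\<Sum>k<d. f k * \<delta> k j) = f j" "(\<Sum>k<d. \<delta> j k * f k) = f j" if "j < d" for f :: "nat \<Rightarrow> real" and j
    using that by (simp_all add: \<delta>_def if_distrib if_distribR cong: if_cong)
  have SG: "finite S" "S \<subseteq> carrier G" using S by (auto simp: finite_symmetric_generating_set_def)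
  \<comment> \<open>The entries over the generators suffice: \<open>S\<close> is symmetric, so
    products of generators reach the whole group and no determinant has to be inverted.\<close>
  let ?E = "(\<lambda>(s, i, j). \<rho> s i j) ` (S \<times> {..<d} \<times> {..<d})"
  have "finite ?E" using SG by auto
  then obtain R where R: "real_subring R" "?E \<subseteq> R" "units_mod_finite R"
    using finite_subset_units_mod_finite by blast
  have \<delta>R: "\<delta> i j \<in> R" for i j using ring_0[OF R(1)] ring_1[OF R(1)] by (simp add: \<delta>_def)
  have wR: "\<rho> (foldr (\<otimes>) ws \<one>) i j \<in> R" if "set ws \<subseteq> S" "i < d" "j < d" for ws i j
    using that
  proof (induction ws arbitrary: i j)
    case Nil
    then show ?case using \<delta>R[of i j] one by (simp add: \<delta>_def)
  next
    case (Cons s ws)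
    have c: "s \<in> carrier G" "foldr (\<otimes>) ws \<one> \<in> carrier G"
      using Cons.prems SG foldr_mult_closed[of ws] by auto
    have "\<rho> (s \<otimes> foldr (\<otimes>) ws \<one>) i j \<in> R"
      unfolding mult[OF c Cons.prems(2,3)]
    proof (intro ring_sum[OF R(1)] ring_mult[OF R(1)])
      fix k assume "k \<in> {..<d}"
      then show "\<rho> s i k \<in> R" using Cons.prems R(2) by (force simp: image_subset_iff)
      show "\<rho> (foldr (\<otimes>) ws \<one>) k j \<in> R" using Cons \<open>k \<in> {..<d}\<close> by simp
    qed
    then show ?case by simp
  qed
  have \<rho>R: "\<rho> g i j \<in> R" if "g \<in> carrier G" "i < d" "j < d" for g i j
    using word_exists[OF S that(1)] wR[OF _ that(2,3)] by blast
  obtain g0 i0 j0 where g0: "g0 \<in> carrier G" "i0 < d" "j0 < d" "\<rho> g0 i0 j0 - \<delta> i0 j0 \<noteq> 0"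
    using nontrivial by (auto simp: \<delta>_def)
  moreover have "\<rho> g0 i0 j0 - \<delta> i0 j0 \<in> R" using \<rho>R g0 \<delta>R ring_diff[OF R(1)] by blast
  ultimately obtain I u where I: "proper_ideal R I" "finite_index R I"
    and u: "u \<in> R" "(\<rho> g0 i0 j0 - \<delta> i0 j0) * u - 1 \<in> I"
    using R(3) unfolding units_mod_finite_def by blast
  \<comment> \<open>The congruence subgroup of \<open>I\<close>. The chosen entry of
    \<open>g0\<close> minus the identity is a unit modulo \<open>I\<close>, which keeps
    \<open>g0\<close> outside.\<close>
  define N where "N = {g \<in> carrier G. \<forall>i<d. \<forall>j<d. \<rho> g i j - \<delta> i j \<in> I}"
  have left: "(\<Sum>k<d. \<rho> g i k * (a k - c k)) \<in> I"
    if "g \<in> carrier G" "i < d" "\<And>k. k < d \<Longrightarrow> a k - c k \<in> I" for g i a c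
    using that \<rho>R by (intro ideal_sum[OF R(1) I(1)] ideal_mult[OF R(1) I(1)]) auto
  have key: "inv g \<otimes> h \<in> N"
    if gh: "g \<in> carrier G" "h \<in> carrier G" "\<And>i j. i < d \<Longrightarrow> j < d \<Longrightarrow> \<rho> h i j - \<rho> g i j \<in> I" for g h
  proof -
    have "\<rho> (inv g \<otimes> h) i j - \<delta> i j \<in> I" if ij: "i < d" "j < d" for i j
    proof -
      have "\<delta> i j = (\<Sum>k<d. \<rho> (inv g) i k * \<rho> g k j)"
        using mult[of "inv g" g i j] one ij gh by (simp add: \<delta>_def)
      then have "\<rho> (inv g \<otimes> h) i j - \<delta> i j = (\<Sum>k<d. \<rho> (inv g) i k * (\<rho> h k j - \<rho> g k j))"
        using mult[of "inv g" h i j] ij gh by (simp add: sum_subtractf right_diff_distrib)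
      then show ?thesis using left[of "inv g" i "\<lambda>k. \<rho> h k j" "\<lambda>k. \<rho> g k j"] gh ij by simp
    qed
    then show ?thesis using gh by (simp add: N_def)
  qed
  have conv: "\<rho> (g \<otimes> x) i j - \<rho> g i j \<in> I" if "g \<in> carrier G" "x \<in> N" "i < d" "j < d" for g x i j
  proof -
    have "\<rho> (g \<otimes> x) i j - \<rho> g i j = (\<Sum>k<d. \<rho> g i k * (\<rho> x k j - \<delta> k j))"
      using that mult[of g x i j] sum_\<delta>(1)[of j "\<rho> g i"]
      by (simp add: N_def right_diff_distrib sum_subtractf)
    then show ?thesis using that left[of g i "\<lambda>k. \<rho> x k j" "\<lambda>k. \<delta> k j"] by (simp add: N_def)
  qed
  have oneN: "\<one> \<in> N" using one ideal_0[OF R(1) I(1)] by (auto simp: N_def \<delta>_def)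
  have invN: "inv x \<in> N" if x: "x \<in> N" for x
  proof -
    have "\<rho> \<one> i j - \<rho> x i j \<in> I" if "i < d" "j < d" for i j
      using x that one ideal_minus[OF R(1) I(1), of "\<rho> x i j - \<delta> i j"] by (simp add: N_def \<delta>_def)
    then have "inv x \<otimes> \<one> \<in> N" using x by (intro key) (simp_all add: N_def)
    then show ?thesis using x by (simp add: N_def)
  qed
  have "subgroup N G"
  proof (rule subgroupI)
    show "N \<subseteq> carrier G" by (auto simp: N_def)
    show "N \<noteq> {}" using oneN by blast
    show "inv x \<in> N" if "x \<in> N" for x using invN that .
    show "x \<otimes> y \<in> N" if xy: "x \<in> N" "y \<in> N" for x y
    proof -
      have "\<rho> (x \<otimes> y) i j - \<delta> i j \<in> I" if ij: "i < d" "j < d" for i j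
      proof -
        have "(\<rho> (x \<otimes> y) i j - \<rho> x i j) + (\<rho> x i j - \<delta> i j) \<in> I"
          using conv[of x y i j] xy ij by (intro ideal_add[OF R(1) I(1)]) (auto simp: N_def)
        then show ?thesis by simp
      qed
      then show ?thesis using xy by (simp add: N_def)
    qed
  qed
  moreover have "g \<otimes> x \<otimes> inv g \<in> N" if g: "g \<in> carrier G" and x: "x \<in> N" for g x
  proof -
    have xc: "x \<in> carrier G" using x by (simp add: N_def)
    have "\<rho> (g \<otimes> x \<otimes> inv g) i j - \<delta> i j \<in> I" if ij: "i < d" "j < d" for i j
    proof -
      have "\<delta> i j = (\<Sum>k<d. \<rho> g i k * \<rho> (inv g) k j)"
        using mult[of g "inv g" i j] one ij g by (simp add: \<delta>_def)
      then have "\<rho> (g \<otimes> x \<otimes> inv g) i j - \<delta> i j = (\<Sum>k<d. (\<rho> (g \<otimes> x) i k - \<rho> g i k) * \<rho> (inv g) k j)"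
        using mult[of "g \<otimes> x" "inv g" i j] ij g xc by (simp add: sum_subtractf left_diff_distrib)
      also have "\<dots> \<in> I"
      proof (rule ideal_sum[OF R(1) I(1)])
        fix k assume "k \<in> {..<d}"
        then have "\<rho> (inv g) k j * (\<rho> (g \<otimes> x) i k - \<rho> g i k) \<in> I"
          using conv[OF g x] \<rho>R ij g by (intro ideal_mult[OF R(1) I(1)]) auto
        then show "(\<rho> (g \<otimes> x) i k - \<rho> g i k) * \<rho> (inv g) k j \<in> I" by (simp add: mult.commute)
      qed
      finally show ?thesis .
    qed
    then show ?thesis using g xc by (simp add: N_def)
  qed
  ultimately have "N \<lhd> G" by (simp add: normal_inv_iff)
  moreover have "g0 \<notin> N"
  proof
    assume "g0 \<in> N"
    then have "u * (\<rho> g0 i0 j0 - \<delta> i0 j0) \<in> I"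
      using g0 u(1) by (intro ideal_mult[OF R(1) I(1)]) (auto simp: N_def)
    from ideal_diff[OF R(1) I(1) this u(2)] have "1 \<in> I" by (simp add: algebra_simps)
    then show False using ideal_1[OF R(1) I(1)] by blast
  qed
  \<comment> \<open>Pigeonhole: there are finitely many matrices modulo \<open>I\<close>, so two
    distinct elements of the infinite group are congruent and their quotient lies in
    \<open>N\<close>.\<close>
  moreover have "\<exists>x\<in>N. x \<noteq> \<one>"
  proof -
    obtain F where F: "finite F" "\<forall>x\<in>R. \<exists>y\<in>F. x - y \<in> I"
      using I(2) unfolding finite_index_def by blast
    then obtain cl where cl: "\<And>x. x \<in> R \<Longrightarrow> cl x \<in> F \<and> x - cl x \<in> I" by metis
    define \<Phi> where "\<Phi> g = (\<lambda>p\<in>{..<d} \<times> {..<d}. cl (\<rho> g (fst p) (snd p)))" for g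
    have "\<Phi> ` carrier G \<subseteq> ({..<d} \<times> {..<d}) \<rightarrow>\<^sub>E F"
    proof (rule image_subsetI)
      fix g assume "g \<in> carrier G"
      then show "\<Phi> g \<in> ({..<d} \<times> {..<d}) \<rightarrow>\<^sub>E F"
        unfolding \<Phi>_def restrict_PiE_iff using cl \<rho>R by auto
    qed
    then have "finite (\<Phi> ` carrier G)" by (rule finite_subset) (simp add: finite_PiE F(1))
    then have "\<not> inj_on \<Phi> (carrier G)" using inf finite_imageD by blast
    then obtain g h where gh: "g \<in> carrier G" "h \<in> carrier G" "\<Phi> g = \<Phi> h" "g \<noteq> h"
      unfolding inj_on_def by blast
    have "\<rho> h i j - \<rho> g i j \<in> I" if ij: "i < d" "j < d" for i j
    proof -
      have "cl (\<rho> g i j) = cl (\<rho> h i j)"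
        using fun_cong[OF gh(3), of "(i, j)"] ij by (simp add: \<Phi>_def)
      moreover have "(\<rho> h i j - cl (\<rho> h i j)) - (\<rho> g i j - cl (\<rho> g i j)) \<in> I"
        by (rule ideal_diff[OF R(1) I(1)]) (simp_all add: cl \<rho>R gh ij)
      ultimately show ?thesis by simp
    qed
    then have "inv g \<otimes> h \<in> N" using key gh by blast
    moreover have "inv g \<otimes> h \<noteq> \<one>" using gh by (metis inv_closed inv_equality inv_inv)
    ultimately show ?thesis by blast
  qed
  ultimately show False using simple g0(1) unfolding is_simple_def by blast
qed

text \<open>The kernel of \<open>c\<close> may be trivial, as for the integers. The preimage of the
  even multiples of \<open>c g\<close> works in all cases: it contains \<open>g \<otimes> g\<close>,
  which is not neutral, but not \<open>g\<close>.\<close>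

lemma (in Group.group) character_imp_not_simple:
  fixes c :: "'a \<Rightarrow> real"
  assumes mult: "\<And>g h. g \<in> carrier G \<Longrightarrow> h \<in> carrier G \<Longrightarrow> c (g \<otimes> h) = c g + c h"
    and g: "g \<in> carrier G" "c g \<noteq> 0"
  shows "\<not> is_simple G"
proof
  assume simple: "is_simple G"
  define N where "N = {x \<in> carrier G. \<exists>k::int. c x = 2 * of_int k * c g}"
  have one: "c \<one> = 0" using mult[of \<one> \<one>] by simp
  have inv: "c (inv x) = - c x" if "x \<in> carrier G" for x
    using mult[of x "inv x"] one that by simp
  have "subgroup N G"
  proof (rule subgroupI)
    show "N \<subseteq> carrier G" by (auto simp: N_def)
    show "N \<noteq> {}" using one by (auto simp: N_def intro!: exI[of _ \<one>] exI[of _ 0])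
    fix x assume x: "x \<in> N"
    then obtain k :: int where k: "c x = 2 * of_int k * c g" by (auto simp: N_def)
    have "c (inv x) = 2 * of_int (- k) * c g" using inv x k by (simp add: N_def)
    then show "inv x \<in> N" using x unfolding N_def by blast
    fix y assume y: "y \<in> N"
    then obtain l :: int where l: "c y = 2 * of_int l * c g" by (auto simp: N_def)
    have "c (x \<otimes> y) = 2 * of_int (k + l) * c g" using mult x y k l by (simp add: N_def algebra_simps)
    then show "x \<otimes> y \<in> N" using x y unfolding N_def by blast
  qed
  moreover have "h \<otimes> x \<otimes> inv h \<in> N" if "h \<in> carrier G" "x \<in> N" for h x
    using that mult inv by (auto simp: N_def)
  ultimately have "N \<lhd> G" by (simp add: normal_inv_iff)
  moreover have "g \<notin> N"
  proof
    assume "g \<in> N"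
    then obtain k :: int where "c g = 2 * of_int k * c g" by (auto simp: N_def)
    then have "real_of_int (2 * k) = of_int 1" using g by simp
    then have "2 * k = 1" by (simp only: of_int_eq_iff)
    then show False by presburger
  qed
  moreover have "g \<otimes> g \<in> N" using g mult by (auto simp: N_def intro!: exI[of _ 1])
  moreover have "g \<otimes> g \<noteq> \<one>" using mult[of g g] one g by auto
  ultimately show False using simple g(1) unfolding is_simple_def by blast
qed

section \<open>Harmonic kernels on groups without spectral gap\<close>

abbreviation lookup :: "('a \<Rightarrow>\<^sub>0 'b::zero) \<Rightarrow> 'a \<Rightarrow> 'b" where
  "lookup \<equiv> Poly_Mapping.lookup"

abbreviation keys :: "('a \<Rightarrow>\<^sub>0 'b::zero) \<Rightarrow> 'a set" where
  "keys \<equiv> Poly_Mapping.keys"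

abbreviation pt :: "'a \<Rightarrow> 'a \<Rightarrow>\<^sub>0 real" where
  "pt x \<equiv> Poly_Mapping.single x 1"

text \<open>The linear extension of \<open>h\<close> from the basis vectors \<open>pt x\<close>; for
  real \<open>h\<close> it is also the sum of \<open>h\<close> weighted by
  \<open>\<phi>\<close>.\<close>

definition lext :: "('a \<Rightarrow> 'v::real_vector) \<Rightarrow> ('a \<Rightarrow>\<^sub>0 real) \<Rightarrow> 'v" where
  "lext h \<phi> = (\<Sum>x\<in>keys \<phi>. lookup \<phi> x *\<^sub>R h x)"

lemma lext_superset:
  "finite A \<Longrightarrow> keys \<phi> \<subseteq> A \<Longrightarrow> lext h \<phi> = (\<Sum>x\<in>A. lookup \<phi> x *\<^sub>R h x)"
  unfolding lext_def by (rule sum.mono_neutral_left) (auto simp: in_keys_iff)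

lemma lookup_scaleR: "lookup (a *\<^sub>R \<phi>) x = a * lookup (\<phi> :: 'a \<Rightarrow>\<^sub>0 real) x"
proof -
  have "finite {i. a * lookup \<phi> i \<noteq> 0}"
    by (rule finite_subset[OF _ finite_lookup[of \<phi>]]) auto
  then show ?thesis by (simp add: scaleR_poly_mapping_def)
qed

lemma linear_lext: "linear (lext h)"
proof (rule linearI)
  fix \<phi> \<psi> :: "'a \<Rightarrow>\<^sub>0 real"
  let ?A = "keys \<phi> \<union> keys \<psi>"
  have *: "finite ?A" "keys \<phi> \<subseteq> ?A" "keys \<psi> \<subseteq> ?A" by auto
  have **: "keys (\<phi> + \<psi>) \<subseteq> ?A" by (rule keys_add)
  show "lext h (\<phi> + \<psi>) = lext h \<phi> + lext h \<psi>"
    unfolding lext_superset[OF *(1,2)] lext_superset[OF *(1,3)] lext_superset[OF *(1) **]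
    by (simp add: lookup_add scaleR_add_left sum.distrib)
next
  fix a and \<phi> :: "'a \<Rightarrow>\<^sub>0 real"
  have "keys (a *\<^sub>R \<phi>) \<subseteq> keys \<phi>" by (auto simp: in_keys_iff lookup_scaleR)
  from lext_superset[OF finite_keys this, of h] show "lext h (a *\<^sub>R \<phi>) = a *\<^sub>R lext h \<phi>"
    by (simp add: lext_def lookup_scaleR scaleR_sum_right)
qed

lemmas lext_add = linear_add[OF linear_lext] and lext_diff = linear_diff[OF linear_lext]
  and lext_scaleR = linear_scale[OF linear_lext]
  and lext_0 [simp] = linear_0[OF linear_lext]

lemma lext_pt [simp]: "lext h (pt x) = h x"
  by (simp add: lext_def)

lemma pt_expansion: "\<phi> = (\<Sum>x\<in>keys \<phi>. lookup \<phi> x *\<^sub>R pt x)"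
proof (rule poly_mapping_eqI)
  fix y
  have "lookup (\<Sum>x\<in>keys \<phi>. lookup \<phi> x *\<^sub>R pt x) y
      = (\<Sum>x\<in>keys \<phi>. if x = y then lookup \<phi> y else 0)"
    unfolding lookup_sum lookup_scaleR by (intro sum.cong refl) (simp add: lookup_single when_def)
  also have "\<dots> = lookup \<phi> y" by (simp add: in_keys_iff)
  finally show "lookup \<phi> y
      = lookup (\<Sum>x\<in>keys \<phi>. lookup \<phi> x *\<^sub>R pt x) y" by simp
qed

lemma linear_eq_on_pt:
  fixes f g :: "('a \<Rightarrow>\<^sub>0 real) \<Rightarrow> 'v::real_vector"
  assumes "linear f" "linear g" "\<And>x. f (pt x) = g (pt x)"
  shows "f \<phi> = g \<phi>"
proof -
  have "f (\<Sum>x\<in>keys \<phi>. lookup \<phi> x *\<^sub>R pt x)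
      = g (\<Sum>x\<in>keys \<phi>. lookup \<phi> x *\<^sub>R pt x)"
    by (simp add: linear_sum[OF assms(1)] linear_sum[OF assms(2)] linear_scale[OF assms(1)]
        linear_scale[OF assms(2)] assms(3))
  then show ?thesis by (simp flip: pt_expansion)
qed

lemma bilinear_eq_on_pt:
  fixes f g :: "('a \<Rightarrow>\<^sub>0 real) \<Rightarrow> ('a \<Rightarrow>\<^sub>0 real) \<Rightarrow> real"
  assumes f: "bilinear f" and g: "bilinear g" and eq: "\<And>x y. f (pt x) (pt y) = g (pt x) (pt y)"
  shows "f \<phi> \<psi> = g \<phi> \<psi>"
proof (rule linear_eq_on_pt[where \<phi> = \<phi>])
  show "linear (\<lambda>\<phi>. f \<phi> \<psi>)" "linear (\<lambda>\<phi>. g \<phi> \<psi>)" using f g by (simp_all add: bilinear_def)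
  show "f (pt x) \<psi> = g (pt x) \<psi>" for x
    by (rule linear_eq_on_pt[where \<phi> = \<psi>]) (use f g eq in \<open>simp_all add: bilinear_def\<close>)
qed

lemma lext_fun_add: "lext (\<lambda>x. h x + k x) \<phi> = lext h \<phi> + lext k \<phi>"
  by (simp add: lext_def scaleR_add_right sum.distrib)

lemma lext_fun_diff: "lext (\<lambda>x. h x - k x) \<phi> = lext h \<phi> - lext k \<phi>"
  by (simp add: lext_def scaleR_diff_right sum_subtractf)

lemma lext_fun_sum: "lext (\<lambda>x. \<Sum>i\<in>I. h i x) \<phi> = (\<Sum>i\<in>I. lext (h i) \<phi>)"
  unfolding lext_def by (simp add: scaleR_sum_right, rule sum.swap)

lemma lext_fun_mult: "lext (\<lambda>x. c * h x) \<phi> = c * lext h \<phi>" for h :: "'a \<Rightarrow> real"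
  by (simp add: lext_def sum_distrib_left mult_ac)

lemma lext_mono:
  fixes h k :: "'a \<Rightarrow> real"
  assumes "\<And>x. x \<in> keys \<phi> \<Longrightarrow> lookup \<phi> x \<ge> 0"
    "\<And>x. x \<in> keys \<phi> \<Longrightarrow> h x \<le> k x"
  shows "lext h \<phi> \<le> lext k \<phi>"
  unfolding lext_def using assms by (intro sum_mono) (simp add: mult_left_mono)

lemma norm_poly_mapping_sum: "norm \<phi> = (\<Sum>x\<in>keys \<phi>. \<bar>lookup \<phi> x\<bar>)"
  for \<phi> :: "'a \<Rightarrow>\<^sub>0 real"
  by (simp add: norm_poly_mapping_def dist_poly_mapping_def)

lemma lext_le_norm:
  fixes h :: "'a \<Rightarrow> real"
  assumes "\<And>x. x \<in> keys \<phi> \<Longrightarrow> \<bar>h x\<bar> \<le> M"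
  shows "\<bar>lext h \<phi>\<bar> \<le> M * norm \<phi>"
proof -
  have "\<bar>lext h \<phi>\<bar> \<le> (\<Sum>x\<in>keys \<phi>. \<bar>lookup \<phi> x\<bar> * \<bar>h x\<bar>)"
    unfolding lext_def by (rule order_trans[OF sum_abs]) (simp add: abs_mult)
  also have "\<dots> \<le> (\<Sum>x\<in>keys \<phi>. \<bar>lookup \<phi> x\<bar> * M)"
    using assms by (intro sum_mono mult_left_mono) auto
  finally show ?thesis by (simp add: norm_poly_mapping_sum sum_distrib_left mult.commute)
qed

definition kform :: "('a \<Rightarrow> 'a \<Rightarrow> real) \<Rightarrow> ('a \<Rightarrow>\<^sub>0 real) \<Rightarrow> ('a \<Rightarrow>\<^sub>0 real) \<Rightarrow> real" where
  "kform K \<phi> \<psi> = lext (\<lambda>x. lext (K x) \<psi>) \<phi>"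

lemma kform_pt [simp]: "kform K (pt x) (pt y) = K x y"
  by (simp add: kform_def)

lemma bilinear_kform: "bilinear (kform K)"
  unfolding bilinear_def kform_def
  by (auto intro!: linearI simp: lext_add lext_scaleR lext_fun_add lext_fun_mult)

definition psd_kernel :: "('a \<Rightarrow> 'a \<Rightarrow> real) \<Rightarrow> bool" where
  "psd_kernel K \<longleftrightarrow> (\<forall>x y. K x y = K y x) \<and> (\<forall>\<phi>. 0 \<le> kform K \<phi> \<phi>)"

lemma psd_form_kform: "psd_kernel K \<Longrightarrow> psd_form (kform K)"
proof
  assume K: "psd_kernel K"
  show "bilinear (kform K)" by (rule bilinear_kform)
  show "0 \<le> kform K \<phi> \<phi>" for \<phi> using K by (simp add: psd_kernel_def)
  show "kform K \<phi> \<psi> = kform K \<psi> \<phi>" for \<phi> \<psi>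
  proof (rule bilinear_eq_on_pt[OF bilinear_kform])
    show "bilinear (\<lambda>\<phi> \<psi>. kform K \<psi> \<phi>)" using bilinear_kform[of K] by (simp add: bilinear_def)
  qed (use K in \<open>simp add: psd_kernel_def\<close>)
qed

lemma tendsto_kform:
  assumes "\<And>x y. ((\<lambda>n. K n x y) \<longlongrightarrow> L x y) F"
  shows "((\<lambda>n. kform (K n) \<phi> \<psi>) \<longlongrightarrow> kform L \<phi> \<psi>) F"
  unfolding kform_def lext_def by (intro tendsto_intros assms)

definition ip :: "('a \<Rightarrow>\<^sub>0 real) \<Rightarrow> ('a \<Rightarrow>\<^sub>0 real) \<Rightarrow> real" where
  "ip = kform (\<lambda>x y. if x = y then 1 else 0)"

lemma ip_eq_lext: "ip \<phi> \<psi> = lext (lookup \<psi>) \<phi>"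
proof -
  have "lext (\<lambda>y. if x = y then 1 else 0 :: real) \<psi> = lookup \<psi> x" for x
    by (simp add: lext_def if_distrib in_keys_iff cong: if_cong)
  then show ?thesis by (simp add: ip_def kform_def)
qed

lemma ip_superset: "finite A \<Longrightarrow> keys \<phi> \<subseteq> A \<Longrightarrow>
    ip \<phi> \<psi> = (\<Sum>x\<in>A. lookup \<phi> x * lookup \<psi> x)"
  by (simp add: ip_eq_lext lext_superset)

interpretation ip: psd_form ip
  unfolding ip_def
proof (rule psd_form_kform)
  show "psd_kernel (\<lambda>x y :: 'a. if x = y then 1 else 0)"
    unfolding psd_kernel_def ip_def[symmetric]
    by (auto simp: ip_superset[OF finite_keys order_refl] intro: sum_nonneg)
qed

lemma lookup_sq_le_ip: "finite A \<Longrightarrow> (\<Sum>x\<in>A. (lookup \<phi> x)\<^sup>2) \<le> ip \<phi> \<phi>"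
proof -
  assume A: "finite A"
  have "(\<Sum>x\<in>A. (lookup \<phi> x)\<^sup>2) \<le> (\<Sum>x\<in>A \<union> keys \<phi>. (lookup \<phi> x)\<^sup>2)"
    using A by (intro sum_mono2) auto
  then show ?thesis using A by (simp add: ip_superset[of "A \<union> keys \<phi>"] power2_eq_square)
qed

section \<open>Laplacian and lazy random walk\<close>

locale fg_group = Groups.group mul e iv
  for mul :: "'a \<Rightarrow> 'a \<Rightarrow> 'a" (infixl "\<cdot>" 70) and e :: 'a and iv +
  fixes S :: "'a set" and len :: "'a \<Rightarrow> nat"
  assumes finite_S: "finite S" and iv_S: "s \<in> S \<Longrightarrow> iv s \<in> S"
    and word: "\<exists>ws. set ws \<subseteq> S \<and> length ws = len x \<and> foldr (\<cdot>) ws e = x"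
    and infinite: "infinite (UNIV :: 'a set)"
begin

lemma iv_mul_cancel [simp]: "iv g \<cdot> (g \<cdot> x) = x" "g \<cdot> (iv g \<cdot> x) = x"
  by (simp_all flip: assoc)

lemma mul_left_eq_iff [simp]: "g \<cdot> x = g \<cdot> y \<longleftrightarrow> x = y"
  by (rule left_cancel)

text \<open>The second argument of \<open>P\<close> counts letters, so that an estimate for one
  generator becomes an estimate in terms of \<open>len\<close>.\<close>

lemma word_induct [case_names e mul]:
  assumes "P e (0::nat)" "\<And>s x n. s \<in> S \<Longrightarrow> P x n \<Longrightarrow> P (s \<cdot> x) (Suc n)"
  shows "P x (len x)"
proof -
  have "P (foldr (\<cdot>) ws e) (length ws)" if "set ws \<subseteq> S" for ws
    using that by (induction ws) (auto intro: assms)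
  then show ?thesis using word[of x] by metis
qed

lemma sum_iv: "(\<Sum>s\<in>S. f (iv s)) = (\<Sum>s\<in>S. f s)"
  by (rule sum.reindex_bij_witness[of _ iv iv]) (auto simp: iv_S)

lemma S_nonempty: "S \<noteq> {}"
proof
  assume "S = {}"
  then have "x = e" for x using word[of x] by auto
  then have "(UNIV :: 'a set) = {e}" by blast
  then show False using infinite by (metis finite.emptyI finite_insert)
qed

definition tr :: "'a \<Rightarrow> ('a \<Rightarrow>\<^sub>0 real) \<Rightarrow> ('a \<Rightarrow>\<^sub>0 real)" where
  "tr g = lext (\<lambda>x. pt (g \<cdot> x))"

lemma linear_tr: "linear (tr g)"
  unfolding tr_def by (rule linear_lext)

lemmas tr_add = linear_add[OF linear_tr] and tr_diff = linear_diff[OF linear_tr]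
  and tr_scaleR = linear_scale[OF linear_tr]

lemma tr_pt [simp]: "tr g (pt x) = pt (g \<cdot> x)"
  by (simp add: tr_def)

lemma tr_tr [simp]: "tr g (tr h \<phi>) = tr (g \<cdot> h) \<phi>"
proof (rule linear_eq_on_pt[where \<phi> = \<phi>])
  show "linear (\<lambda>\<phi>. tr g (tr h \<phi>))"
    using linear_compose[OF linear_tr linear_tr] by (simp add: comp_def)
qed (simp_all add: linear_tr assoc)

lemma tr_e [simp]: "tr e \<phi> = \<phi>"
  by (rule linear_eq_on_pt[where \<phi> = \<phi>]) (simp_all add: linear_tr linear_id[unfolded id_def])

lemma lext_tr: "lext h (tr g \<phi>) = lext (\<lambda>x. h (g \<cdot> x)) \<phi>"
proof (rule linear_eq_on_pt[where \<phi> = \<phi>])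
  show "linear (\<lambda>\<phi>. lext h (tr g \<phi>))"
    using linear_compose[OF linear_tr linear_lext] by (simp add: comp_def)
qed (simp_all add: linear_lext)

lemma lookup_tr: "lookup (tr g \<phi>) x = lookup \<phi> (iv g \<cdot> x)"
proof -
  have 1: "lookup \<psi> x = lext (\<lambda>y. if y = x then 1 else 0) \<psi>" for \<psi> :: "'a \<Rightarrow>\<^sub>0 real" and x
    by (simp add: lext_def if_distrib in_keys_iff cong: if_cong)
  have "g \<cdot> y = x \<longleftrightarrow> y = iv g \<cdot> x" for y by auto
  then show ?thesis by (simp add: 1 lext_tr)
qed

lemma keys_tr: "keys (tr g \<phi>) = (\<cdot>) g ` keys \<phi>"
proof (intro equalityI subsetI)
  fix x assume "x \<in> keys (tr g \<phi>)"
  then have "iv g \<cdot> x \<in> keys \<phi>" by (simp add: in_keys_iff lookup_tr)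
  then show "x \<in> (\<cdot>) g ` keys \<phi>" by (metis iv_mul_cancel(2) imageI)
qed (auto simp: in_keys_iff lookup_tr)

lemma ip_tr: "ip (tr g \<phi>) (tr g \<psi>) = ip \<phi> \<psi>"
  by (simp add: ip_eq_lext lext_tr lookup_tr)

lemma ip_tr_left: "ip (tr g \<phi>) \<psi> = ip \<phi> (tr (iv g) \<psi>)"
  using ip_tr[of g \<phi> "tr (iv g) \<psi>"] by simp

lemma norm_tr: "norm (tr g \<phi>) = norm \<phi>"
  by (simp add: norm_poly_mapping_sum keys_tr sum.reindex inj_on_def lookup_tr)

definition lap :: "('a \<Rightarrow>\<^sub>0 real) \<Rightarrow> ('a \<Rightarrow>\<^sub>0 real)" where
  "lap \<phi> = (\<Sum>s\<in>S. \<phi> - tr s \<phi>)"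

lemma linear_lap: "linear lap"
  by (rule linearI) (simp_all add: lap_def tr_add tr_scaleR sum.distrib sum_subtractf scaleR_sum_right
      scaleR_diff_right)

lemmas lap_diff = linear_diff[OF linear_lap]
  and lap_scaleR = linear_scale[OF linear_lap]

text \<open>Expanding the right side gives two kinds of cross terms, whose sums agree because
  \<open>S\<close> is closed under inverses.\<close>

lemma ip_lap: "ip (lap \<phi>) \<psi> = (\<Sum>s\<in>S. ip (\<phi> - tr s \<phi>) (\<psi> - tr s \<psi>)) / 2"
proof -
  have "(\<Sum>s\<in>S. ip \<phi> (tr s \<psi>)) = (\<Sum>s\<in>S. ip (tr s \<phi>) \<psi>)"
    using sum_iv[of "\<lambda>s. ip \<phi> (tr s \<psi>)"] by (simp add: ip_tr_left)
  then show ?thesis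
    by (simp add: lap_def ip.sum_left ip.diff_left ip.diff_right ip_tr sum_subtractf sum.distrib sum_negf)
qed

lemma lap_sym: "ip (lap \<phi>) \<psi> = ip \<phi> (lap \<psi>)"
  using ip_lap[of \<phi> \<psi>] ip_lap[of \<psi> \<phi>] by (simp add: ip.sym)

definition energy :: "('a \<Rightarrow>\<^sub>0 real) \<Rightarrow> real" where
  "energy \<phi> = ip (lap \<phi>) \<phi>"

lemma energy_eq: "energy \<phi> = (\<Sum>s\<in>S. ip (\<phi> - tr s \<phi>) (\<phi> - tr s \<phi>)) / 2"
  by (simp add: energy_def ip_lap)

lemma energy_nonneg: "0 \<le> energy \<phi>"
  by (simp add: energy_eq sum_nonneg ip.nonneg)

lemma energy_le: "energy \<phi> \<le> 2 * card S * ip \<phi> \<phi>"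
proof -
  have "(\<Sum>s\<in>S. ip (\<phi> - tr s \<phi>) (\<phi> - tr s \<phi>)) \<le> (\<Sum>s\<in>S. 4 * ip \<phi> \<phi>)"
    using ip.diff_le[of \<phi> "tr s \<phi>" for s] by (intro sum_mono) (simp add: ip_tr)
  then show ?thesis by (simp add: energy_eq)
qed

lemma card_S_pos: "card S > 0"
  using finite_S S_nonempty by (simp add: card_gt_0_iff)

text \<open>The Laplacian has norm at most \<open>2 * card S\<close>. With this step
  \<open>walk\<close> is the lazy random walk, half the identity plus half the average over
  \<open>S\<close>, and hence a positive contraction.\<close>

definition \<kappa> :: real where "\<kappa> = 1 / (2 * card S)"

lemma \<kappa>_pos: "\<kappa> > 0"
  using card_S_pos by (simp add: \<kappa>_def)

definition walk :: "('a \<Rightarrow>\<^sub>0 real) \<Rightarrow> ('a \<Rightarrow>\<^sub>0 real)" where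
  "walk \<phi> = \<phi> - \<kappa> *\<^sub>R lap \<phi>"

lemma walk_sym: "ip (walk \<phi>) \<psi> = ip \<phi> (walk \<psi>)"
  by (simp add: walk_def ip.expand lap_sym)

lemma walk_pos: "0 \<le> ip (walk \<phi>) \<phi>"
proof -
  have "\<kappa> * energy \<phi> \<le> \<kappa> * (2 * card S * ip \<phi> \<phi>)"
    using energy_le[of \<phi>] \<kappa>_pos by (intro mult_left_mono) auto
  also have "\<dots> = ip \<phi> \<phi>" using card_S_pos by (simp add: \<kappa>_def)
  finally show ?thesis by (simp add: walk_def ip.expand energy_def)
qed

lemma walk_norm_eq: "ip (walk \<phi>) (walk \<phi>) = ip \<phi> \<phi> - 2 * \<kappa> * energy \<phi> + \<kappa>\<^sup>2 * ip (lap \<phi>) (lap \<phi>)"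
  by (simp add: walk_def ip.expand energy_def ip.sym[of \<phi> "lap \<phi>"] power2_eq_square algebra_simps)

text \<open>The exact loss of energy is the left side plus \<open>\<kappa>\<close> times the form of
  \<open>walk\<close> at \<open>lap \<phi>\<close>, and \<open>walk\<close> is positive.\<close>

lemma walk_energy_diff: "\<kappa> * ip (lap \<phi>) (lap \<phi>) \<le> energy \<phi> - energy (walk \<phi>)"
proof -
  have "energy \<phi> - energy (walk \<phi>) = \<kappa> * ip (lap \<phi>) (lap \<phi>) + \<kappa> * ip (walk (lap \<phi>)) (lap \<phi>)"
    unfolding walk_def energy_def
    by (simp add: ip.expand lap_diff lap_scaleR lap_sym[of "lap \<phi>" \<phi>] algebra_simps)
  moreover have "0 \<le> \<kappa> * ip (walk (lap \<phi>)) (lap \<phi>)"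
    using walk_pos[of "lap \<phi>"] \<kappa>_pos by simp
  ultimately show ?thesis by linarith
qed

lemma walk_norm_le: "ip (walk \<phi>) (walk \<phi>) \<le> ip \<phi> \<phi>"
proof -
  have "\<kappa> * ip (lap \<phi>) (lap \<phi>) \<le> energy \<phi>"
    using walk_energy_diff[of \<phi>] energy_nonneg[of "walk \<phi>"] by linarith
  then have "\<kappa> * (\<kappa> * ip (lap \<phi>) (lap \<phi>)) \<le> \<kappa> * energy \<phi>"
    using \<kappa>_pos by (intro mult_left_mono) auto
  moreover have "0 \<le> \<kappa> * energy \<phi>" using \<kappa>_pos energy_nonneg[of \<phi>] by simp
  ultimately show ?thesis by (simp add: walk_norm_eq power2_eq_square mult.assoc)
qed

lemma lookup_diff_le_energy:
  assumes "s \<in> S"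
  shows "(lookup \<phi> x - lookup \<phi> (s \<cdot> x))\<^sup>2 \<le> 2 * energy \<phi>"
proof -
  have "(lookup \<phi> x - lookup \<phi> (s \<cdot> x))\<^sup>2
      \<le> ip (\<phi> - tr (iv s) \<phi>) (\<phi> - tr (iv s) \<phi>)"
    using lookup_sq_le_ip[of "{x}" "\<phi> - tr (iv s) \<phi>"] by (simp add: lookup_minus lookup_tr)
  also have "\<dots> \<le> (\<Sum>s\<in>S. ip (\<phi> - tr s \<phi>) (\<phi> - tr s \<phi>))"
    using assms iv_S finite_S by (intro member_le_sum) (auto simp: ip.nonneg)
  finally show ?thesis by (simp add: energy_eq)
qed

text \<open>Functions of bounded \<open>\<ell>\<^sup>2\<close> norm whose energy tends to 0 become locally constant,
  hence, the group being infinite, tend to 0 pointwise.\<close>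

lemma pointwise_null_of_energy_null:
  assumes E: "(\<lambda>n. energy (\<psi> n)) \<longlonglongrightarrow> 0" and b: "\<And>n. ip (\<psi> n) (\<psi> n) \<le> M"
  shows "(\<lambda>n. lookup (\<psi> n) x) \<longlonglongrightarrow> 0"
proof -
  let ?f = "\<lambda>n. lookup (\<psi> n)"
  have step: "(\<lambda>n. ?f n y - ?f n (s \<cdot> y)) \<longlonglongrightarrow> 0" if "s \<in> S" for s y
  proof (rule tendsto_zero_of_square_le)
    show "(\<lambda>n. 2 * energy (\<psi> n)) \<longlonglongrightarrow> 0" using tendsto_mult_right_zero[OF E] .
    show "\<forall>\<^sub>F n in sequentially. (?f n y - ?f n (s \<cdot> y))\<^sup>2 \<le> 2 * energy (\<psi> n)"
      using lookup_diff_le_energy[OF that] by simp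
  qed
  have "(\<lambda>n. ?f n x - ?f n (g \<cdot> x)) \<longlonglongrightarrow> 0" for g
  proof (rule word_induct[of "\<lambda>g _. (\<lambda>n. ?f n x - ?f n (g \<cdot> x)) \<longlonglongrightarrow> 0"])
    fix s g assume *: "s \<in> S" "(\<lambda>n. ?f n x - ?f n (g \<cdot> x)) \<longlonglongrightarrow> 0"
    show "(\<lambda>n. ?f n x - ?f n (s \<cdot> g \<cdot> x)) \<longlonglongrightarrow> 0"
      using tendsto_add[OF *(2) step[OF *(1), of "g \<cdot> x"]] by (simp add: assoc)
  qed simp
  from this[of "y \<cdot> iv x" for y] have diff: "(\<lambda>n. ?f n x - ?f n y) \<longlonglongrightarrow> 0" for y
    by (simp add: assoc)
  show ?thesis
  proof (rule LIMSEQ_I)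
    fix r :: real assume r: "r > 0"
    \<comment> \<open>If the value at \<open>x\<close> were at least \<open>r\<close>, then
      \<open>m\<close> points with nearly the same value would exceed the norm bound
      \<open>M\<close>.\<close>
    obtain m :: nat where m: "(2 * M + 1) / r\<^sup>2 < m" using reals_Archimedean2 by blast
    obtain A :: "'a set" where A: "finite A" "card A = m"
      using infinite_arbitrarily_large[OF infinite] by blast
    have "(\<lambda>n. 2 * (\<Sum>y\<in>A. (?f n x - ?f n y)\<^sup>2)) \<longlonglongrightarrow> 2 * (\<Sum>y\<in>A. 0\<^sup>2)"
      by (intro tendsto_intros diff)
    then have "\<forall>\<^sub>F n in sequentially. 2 * (\<Sum>y\<in>A. (?f n x - ?f n y)\<^sup>2) < 1"
      by (rule order_tendstoD(2)) simp
    then obtain N where N: "\<And>n. n \<ge> N \<Longrightarrow> 2 * (\<Sum>y\<in>A. (?f n x - ?f n y)\<^sup>2) < 1"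
      unfolding eventually_sequentially by blast
    have "norm (?f n x - 0) < r" if "n \<ge> N" for n
    proof -
      have "m * (?f n x)\<^sup>2 = (\<Sum>y\<in>A. (?f n x)\<^sup>2)" using A by simp
      also have "\<dots> \<le> (\<Sum>y\<in>A. 2 * (?f n x - ?f n y)\<^sup>2 + 2 * (?f n y)\<^sup>2)"
      proof (rule sum_mono)
        fix y
        have "2 * (?f n x - ?f n y)\<^sup>2 + 2 * (?f n y)\<^sup>2 - (?f n x)\<^sup>2 = (?f n x - 2 * ?f n y)\<^sup>2"
          by (simp add: power2_eq_square algebra_simps)
        then show "(?f n x)\<^sup>2 \<le> 2 * (?f n x - ?f n y)\<^sup>2 + 2 * (?f n y)\<^sup>2"
          using zero_le_power2[of "?f n x - 2 * ?f n y"] by linarith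
      qed
      also have "\<dots> \<le> 1 + 2 * M"
        using N[OF that] lookup_sq_le_ip[OF A(1), of "\<psi> n"] b[of n]
        by (simp add: sum.distrib flip: sum_distrib_left)
      also have "\<dots> < m * r\<^sup>2" using m r by (simp add: field_simps)
      finally have "m * (?f n x)\<^sup>2 < m * r\<^sup>2" .
      moreover from this have "real m > 0" by (cases "m = 0") auto
      ultimately have "\<bar>?f n x\<bar>\<^sup>2 < r\<^sup>2" by (simp add: mult_less_cancel_left_pos)
      then show ?thesis using power2_less_imp_less[of "\<bar>?f n x\<bar>" r] r by simp
    qed
    then show "\<exists>no. \<forall>n\<ge>no. norm (?f n x - 0) < r" by blast
  qed
qed

text \<open>If \<open>lap\<close> were bounded below by \<open>\<epsilon>\<close> on its range, the walk would contract the energy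
  geometrically and dissipate the whole norm, which is then controlled by the energy.\<close>

lemma spectral_gap:
  assumes "\<epsilon> > 0" and gap: "\<And>\<phi>. \<epsilon> * energy \<phi> \<le> ip (lap \<phi>) (lap \<phi>)"
  shows "\<epsilon> * ip \<phi> \<phi> \<le> 2 * energy \<phi>"
proof -
  define \<psi> where "\<psi> n = (walk ^^ n) \<phi>" for n
  \<comment> \<open>The maximum with 0 covers the case
    \<open>\<epsilon> * \<kappa> > 1\<close>.\<close>
  let ?q = "max 0 (1 - \<epsilon> * \<kappa>)"
  have \<psi>_Suc: "\<psi> (Suc n) = walk (\<psi> n)" for n by (simp add: \<psi>_def)
  have dec: "\<epsilon> * \<kappa> * energy (\<psi> n) \<le> energy (\<psi> n) - energy (\<psi> (Suc n))" for n
  proof -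
    have "\<kappa> * (\<epsilon> * energy (\<psi> n)) \<le> \<kappa> * ip (lap (\<psi> n)) (lap (\<psi> n))"
      using \<kappa>_pos by (intro mult_left_mono gap) simp
    then show ?thesis using walk_energy_diff[of "\<psi> n"] by (simp add: \<psi>_Suc mult_ac)
  qed
  have E_le: "energy (\<psi> n) \<le> ?q ^ n * energy \<phi>" for n
  proof (induction n)
    case 0 then show ?case by (simp add: \<psi>_def)
  next
    case (Suc n)
    have "energy (\<psi> (Suc n)) \<le> (1 - \<epsilon> * \<kappa>) * energy (\<psi> n)"
      using dec[of n] by (simp add: left_diff_distrib)
    also have "\<dots> \<le> ?q * energy (\<psi> n)" by (intro mult_right_mono energy_nonneg) simp
    also have "\<dots> \<le> ?q * (?q ^ n * energy \<phi>)" by (intro mult_left_mono Suc) simp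
    finally show ?case by (simp only: power_Suc mult.assoc)
  qed
  have E0: "(\<lambda>n. energy (\<psi> n)) \<longlonglongrightarrow> 0"
  proof (rule Lim_null_comparison)
    show "\<forall>\<^sub>F n in sequentially. norm (energy (\<psi> n)) \<le> ?q ^ n * energy \<phi>"
      using E_le energy_nonneg by simp
    have "\<bar>?q\<bar> < 1" using \<open>\<epsilon> > 0\<close> \<kappa>_pos by (simp add: max_def)
    then show "(\<lambda>n. ?q ^ n * energy \<phi>) \<longlonglongrightarrow> 0"
      by (intro tendsto_mult_left_zero LIMSEQ_power_zero) simp
  qed
  \<comment> \<open>This potential does not decrease along the walk and tends to 0, so it starts out
    nonpositive. The factor 2 balances the loss \<open>2 * \<kappa>\<close> in the norm against
    \<open>\<kappa>\<close> in the energy.\<close>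
  have pot: "\<epsilon> * ip (\<psi> n) (\<psi> n) - 2 * energy (\<psi> n)
      \<le> \<epsilon> * ip (\<psi> (Suc n)) (\<psi> (Suc n)) - 2 * energy (\<psi> (Suc n))" for n
  proof -
    have "ip (\<psi> n) (\<psi> n) - ip (\<psi> (Suc n)) (\<psi> (Suc n)) \<le> 2 * \<kappa> * energy (\<psi> n)"
      using ip.nonneg[of "lap (\<psi> n)"] by (simp add: \<psi>_Suc walk_norm_eq)
    then have "\<epsilon> * (ip (\<psi> n) (\<psi> n) - ip (\<psi> (Suc n)) (\<psi> (Suc n))) \<le> \<epsilon> * (2 * \<kappa> * energy (\<psi> n))"
      using \<open>\<epsilon> > 0\<close> by (intro mult_left_mono) auto
    also have "\<dots> = 2 * (\<epsilon> * \<kappa> * energy (\<psi> n))" by simp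
    also have "\<dots> \<le> 2 * (energy (\<psi> n) - energy (\<psi> (Suc n)))" using dec[of n] by simp
    finally show ?thesis by (simp add: right_diff_distrib)
  qed
  have mono: "\<epsilon> * ip \<phi> \<phi> - 2 * energy \<phi> \<le> \<epsilon> * ip (\<psi> n) (\<psi> n) - 2 * energy (\<psi> n)" for n
  proof (induction n)
    case 0 then show ?case by (simp add: \<psi>_def)
  next
    case (Suc n) then show ?case using pot[of n] by linarith
  qed
  have norm_dec: "ip (\<psi> n) (\<psi> n) \<le> ip \<phi> \<phi>" for n
  proof (induction n)
    case 0 then show ?case by (simp add: \<psi>_def)
  next
    case (Suc n) then show ?case using walk_norm_le[of "\<psi> n"] unfolding \<psi>_Suc by linarith
  qed
  \<comment> \<open>By symmetry of the walk, the squared norm of the n-th iterate is the pairing of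
    the fixed \<open>\<phi>\<close> with the 2n-th one, so pointwise convergence on the finite
    support of \<open>\<phi>\<close> is enough.\<close>
  have shift: "ip (\<psi> (i + j)) \<eta> = ip (\<psi> i) ((walk ^^ j) \<eta>)" for i j \<eta>
  proof (induction j arbitrary: \<eta>)
    case (Suc j)
    have "ip (\<psi> (i + Suc j)) \<eta> = ip (\<psi> (i + j)) (walk \<eta>)" by (simp add: walk_sym \<psi>_Suc)
    then show ?case by (simp add: Suc.IH funpow_swap1)
  qed simp
  have "ip (\<psi> n) (\<psi> n) = ip \<phi> (\<psi> (2 * n))" for n
    using shift[of n n \<phi>] by (simp add: \<psi>_def ip.sym mult_2)
  then have eq: "ip (\<psi> n) (\<psi> n) = lext (lookup (\<psi> (2 * n))) \<phi>" for n
    by (simp add: ip_eq_lext)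
  have "(\<lambda>n. lookup (\<psi> n) x) \<longlonglongrightarrow> 0" for x
    by (rule pointwise_null_of_energy_null[OF E0 norm_dec])
  then have "(\<lambda>n. lookup (\<psi> (2 * n)) x) \<longlonglongrightarrow> 0" for x
    by (rule LIMSEQ_subseq_LIMSEQ[unfolded comp_def]) (simp add: strict_mono_def)
  then have "(\<lambda>n. ip (\<psi> n) (\<psi> n)) \<longlonglongrightarrow> (\<Sum>x\<in>keys \<phi>. lookup \<phi> x *\<^sub>R 0)"
    unfolding eq lext_def by (intro tendsto_intros)
  then have "(\<lambda>n. \<epsilon> * ip (\<psi> n) (\<psi> n) - 2 * energy (\<psi> n)) \<longlonglongrightarrow> \<epsilon> * 0 - 2 * 0"
    by (intro tendsto_intros E0) simp
  then have "\<epsilon> * ip \<phi> \<phi> - 2 * energy \<phi> \<le> 0"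
    by (intro LIMSEQ_le_const[of _ 0]) (use mono in auto)
  then show ?thesis by simp
qed

end

section \<open>Gram kernels of cocycles\<close>

lemma psd_kernel_vectors:
  assumes Q: "psd_form Q" and c: "c \<ge> 0"
  shows "psd_kernel (\<lambda>x y. c * Q (b x) (b y))"
proof -
  interpret Q: psd_form Q by fact
  have "kform (\<lambda>x y. c * Q (b x) (b y)) \<phi> \<psi> = c * Q (lext b \<phi>) (lext b \<psi>)" for \<phi> \<psi>
  proof (rule bilinear_eq_on_pt[OF bilinear_kform])
    show "bilinear (\<lambda>\<phi> \<psi>. c * Q (lext b \<phi>) (lext b \<psi>))"
      unfolding bilinear_def
      by (auto intro!: linearI simp: lext_add lext_scaleR Q.expand distrib_left)
  qed simp
  moreover have "c * Q (b x) (b y) = c * Q (b y) (b x)" for x y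
    by (simp only: Q.sym[of "b x" "b y"])
  ultimately show ?thesis using c by (simp add: psd_kernel_def Q.nonneg)
qed

lemma psd_kernel_limit:
  assumes F: "F \<noteq> bot" and K: "\<And>n. psd_kernel (K n)" and lim: "\<And>x y. ((\<lambda>n. K n x y) \<longlongrightarrow> L x y) F"
  shows "psd_kernel L"
  unfolding psd_kernel_def
proof (intro conjI allI)
  fix x y
  have "(\<lambda>n. K n x y) = (\<lambda>n. K n y x)" using K by (auto simp: psd_kernel_def)
  then show "L x y = L y x" using tendsto_unique[OF F lim[of x y]] lim[of y x] by simp
next
  fix \<phi>
  show "0 \<le> kform L \<phi> \<phi>"
    using K F by (intro tendsto_lowerbound[OF tendsto_kform[OF lim]]) (auto simp: psd_kernel_def)
qed

context fg_group begin

text \<open>For the Gram kernel of a cocycle, b(g x) - b(g) is the image of b(x) under the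
  orthogonal map of g; the left side is thus <g b x, g b y>.\<close>

definition invariant_kernel :: "('a \<Rightarrow> 'a \<Rightarrow> real) \<Rightarrow> bool" where
  "invariant_kernel K \<longleftrightarrow>
     (\<forall>g x y. K (g \<cdot> x) (g \<cdot> y) - K (g \<cdot> x) g - K g (g \<cdot> y) + K g g = K x y)"

text \<open>Without a spectral gap there are \<open>\<phi> n\<close> whose Laplacian is small
  against their energy. Normalise their coboundaries so that the squared lengths over
  \<open>S\<close> add up to 1: the harmonicity defect is, up to sign, the normalised Laplacian and
  disappears in the limit, while the normalisation persists. Values grow by at most 1 per letter,
  which makes all kernel entries bounded.\<close>

lemma harmonic_kernel_exists:
  assumes almost: "\<And>\<epsilon>. \<epsilon> > 0 \<Longrightarrow> \<exists>\<phi>. energy \<phi> < \<epsilon> * ip \<phi> \<phi>"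
  shows "\<exists>B. psd_kernel B \<and> invariant_kernel B \<and> (\<forall>y. (\<Sum>s\<in>S. B s y) = 0) \<and> (\<Sum>s\<in>S. B s s) = 1 \<and>
     (\<forall>x y. \<bar>B x y\<bar> \<le> len x * len y) \<and> (\<forall>x. B x e = 0)"
proof -
  have ex: "\<exists>\<phi>. ip (lap \<phi>) (lap \<phi>) < \<epsilon> * energy \<phi>" if \<epsilon>: "\<epsilon> > 0" for \<epsilon>
  proof (rule ccontr)
    assume "\<not> ?thesis"
    then have "\<epsilon> * energy \<phi> \<le> ip (lap \<phi>) (lap \<phi>)" for \<phi> by (auto simp: not_less)
    from spectral_gap[OF \<epsilon> this] have gap: "\<epsilon> * ip \<phi> \<phi> \<le> 2 * energy \<phi>" for \<phi> .
    obtain \<phi> where "energy \<phi> < \<epsilon> / 2 * ip \<phi> \<phi>"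
      using almost[of "\<epsilon> / 2"] \<epsilon> by auto
    then show False using gap[of \<phi>] by simp
  qed
  have "\<forall>n. \<exists>\<phi>. ip (lap \<phi>) (lap \<phi>) < 1 / real (Suc n) * energy \<phi>"
    by (intro allI ex) simp
  from choice[OF this] obtain \<phi>
    where \<phi>: "\<And>n. ip (lap (\<phi> n)) (lap (\<phi> n)) < 1 / real (Suc n) * energy (\<phi> n)" by blast
  define c where "c n = 2 * energy (\<phi> n)" for n
  have c: "c n > 0" for n
  proof -
    have "0 < 1 / real (Suc n) * energy (\<phi> n)" using \<phi>[of n] ip.nonneg[of "lap (\<phi> n)"] by linarith
    then show ?thesis by (simp add: c_def zero_less_mult_iff zero_less_divide_iff)
  qed
  define b where "b n x = tr x (\<phi> n) - \<phi> n" for n x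
  have b_mul: "b n (g \<cdot> x) = b n g + tr g (b n x)" for n g x by (simp add: b_def tr_diff)
  have b_S: "(\<Sum>s\<in>S. ip (b n s) (b n s)) = c n" for n
  proof -
    have "ip (b n s) (b n s) = ip (\<phi> n - tr s (\<phi> n)) (\<phi> n - tr s (\<phi> n))" for s
      by (simp add: b_def ip.expand algebra_simps)
    then show ?thesis by (simp add: c_def energy_eq)
  qed
  have b_le: "ip (b n x) (b n x) \<le> (len x * sqrt (c n))\<^sup>2" for n x
  proof (rule word_induct[of "\<lambda>x k. ip (b n x) (b n x) \<le> (k * sqrt (c n))\<^sup>2"])
    show "ip (b n e) (b n e) \<le> (real 0 * sqrt (c n))\<^sup>2" by (simp add: b_def)
  next
    fix s x k assume s: "s \<in> S" and IH: "ip (b n x) (b n x) \<le> (real k * sqrt (c n))\<^sup>2"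
    have "ip (b n s) (b n s) \<le> (\<Sum>s\<in>S. ip (b n s) (b n s))"
      using s finite_S by (intro member_le_sum) (auto simp: ip.nonneg)
    then have 1: "ip (b n s) (b n s) \<le> (sqrt (c n))\<^sup>2" using c[of n] by (simp add: b_S)
    have "ip (b n (s \<cdot> x)) (b n (s \<cdot> x)) \<le> (sqrt (c n) + real k * sqrt (c n))\<^sup>2"
      unfolding b_mul using IH c[of n] by (intro ip.norm_add_le[OF 1]) (auto simp: ip_tr)
    then show "ip (b n (s \<cdot> x)) (b n (s \<cdot> x)) \<le> (real (Suc k) * sqrt (c n))\<^sup>2"
      by (simp add: algebra_simps)
  qed
  define K where "K n x y = 1 / c n * ip (b n x) (b n y)" for n x y
  have K_le: "\<bar>K n x y\<bar> \<le> len x * len y" for n x y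
  proof -
    have "\<bar>ip (b n x) (b n y)\<bar> \<le> (len x * sqrt (c n)) * (len y * sqrt (c n))"
      using c[of n] by (intro ip.abs_le b_le) auto
    also have "\<dots> = c n * (len x * len y)" using c[of n] by (simp add: algebra_simps)
    finally show ?thesis using c[of n] by (simp add: K_def abs_mult field_simps)
  qed
  obtain U :: "nat filter" where U: "U \<noteq> bot" "U \<le> sequentially"
    and Ulim: "\<And>x :: nat \<Rightarrow> real. Bseq x \<Longrightarrow> (x \<longlongrightarrow> Lim U x) U"
    using bounded_limit_filter by blast
  define B where "B x y = Lim U (\<lambda>n. K n x y)" for x y
  have B: "((\<lambda>n. K n x y) \<longlongrightarrow> B x y) U" for x y
    unfolding B_def using K_le by (intro Ulim BseqI'[of _ "len x * len y"]) simp
  have psd: "psd_kernel B"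
  proof (rule psd_kernel_limit[OF U(1) _ B])
    show "psd_kernel (K n)" for n
      unfolding K_def using c[of n] by (intro psd_kernel_vectors ip.psd_form_axioms) simp
  qed
  moreover have "invariant_kernel B"
    unfolding invariant_kernel_def
  proof (intro allI)
    fix g x y
    have "K n (g \<cdot> x) (g \<cdot> y) - K n (g \<cdot> x) g - K n g (g \<cdot> y) + K n g g = K n x y" for n
    proof -
      have "ip (b n (g \<cdot> x) - b n g) (b n (g \<cdot> y) - b n g) = ip (b n x) (b n y)"
        by (simp add: b_mul ip_tr)
      then show ?thesis by (simp add: K_def ip.diff_left ip.diff_right algebra_simps flip: add_divide_distrib diff_divide_distrib)
    qed
    moreover have "((\<lambda>n. K n (g \<cdot> x) (g \<cdot> y) - K n (g \<cdot> x) g - K n g (g \<cdot> y) + K n g g) \<longlongrightarrow>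
        B (g \<cdot> x) (g \<cdot> y) - B (g \<cdot> x) g - B g (g \<cdot> y) + B g g) U"
      by (intro tendsto_intros B)
    ultimately show "B (g \<cdot> x) (g \<cdot> y) - B (g \<cdot> x) g - B g (g \<cdot> y) + B g g = B x y"
      using tendsto_unique[OF U(1) B[of x y]] by simp
  qed
  moreover have "(\<Sum>s\<in>S. B s y) = 0" for y
  proof -
    have eq: "(\<Sum>s\<in>S. K n s y) = - (1 / c n * ip (lap (\<phi> n)) (b n y))" for n
    proof -
      have "lap (\<phi> n) = - (\<Sum>s\<in>S. b n s)" by (simp add: lap_def b_def sum_subtractf)
      then have "ip (lap (\<phi> n)) (b n y) = - (\<Sum>s\<in>S. ip (b n s) (b n y))"
        by (simp add: bilinear_lneg[OF ip.bilin] ip.sum_left)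
      then show ?thesis by (simp add: K_def sum_divide_distrib)
    qed
    have "((\<lambda>n. \<Sum>s\<in>S. K n s y) \<longlongrightarrow> 0) U"
    proof (rule tendsto_zero_of_square_le)
      show "((\<lambda>n. (len y)\<^sup>2 * (1 / real (Suc n))) \<longlongrightarrow> 0) U"
        using tendsto_mult_right_zero[OF tendsto_mono[OF U(2) LIMSEQ_inverse_real_of_nat]]
        by (simp add: inverse_eq_divide)
      show "\<forall>\<^sub>F n in U. (\<Sum>s\<in>S. K n s y)\<^sup>2 \<le> (len y)\<^sup>2 * (1 / real (Suc n))"
      proof (rule always_eventually, rule allI)
        fix n
        have "(ip (lap (\<phi> n)) (b n y))\<^sup>2 \<le> ip (lap (\<phi> n)) (lap (\<phi> n)) * ip (b n y) (b n y)"
          by (rule ip.cauchy_schwarz)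
        also have "\<dots> \<le> (1 / real (Suc n) * c n) * ((len y)\<^sup>2 * c n)"
        proof (rule mult_mono)
          have "1 / real (Suc n) * energy (\<phi> n) \<le> 1 / real (Suc n) * c n"
            using energy_nonneg[of "\<phi> n"] by (intro mult_left_mono) (auto simp: c_def)
          then show "ip (lap (\<phi> n)) (lap (\<phi> n)) \<le> 1 / real (Suc n) * c n" using \<phi>[of n] by linarith
          show "ip (b n y) (b n y) \<le> (len y)\<^sup>2 * c n"
            using b_le[of n y] c[of n] by (simp add: power_mult_distrib)
        qed (use c[of n] in \<open>auto simp: ip.nonneg\<close>)
        finally have "(ip (lap (\<phi> n)) (b n y))\<^sup>2 \<le> (c n)\<^sup>2 * ((len y)\<^sup>2 * (1 / real (Suc n)))"
          by (simp add: power2_eq_square mult_ac)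
        then show "(\<Sum>s\<in>S. K n s y)\<^sup>2 \<le> (len y)\<^sup>2 * (1 / real (Suc n))"
          unfolding eq using c[of n] by (simp add: power_mult_distrib power_divide divide_le_eq mult_ac)
      qed
    qed
    moreover have "((\<lambda>n. \<Sum>s\<in>S. K n s y) \<longlongrightarrow> (\<Sum>s\<in>S. B s y)) U"
      by (intro tendsto_intros B)
    ultimately show ?thesis using tendsto_unique[OF U(1)] by blast
  qed
  moreover have "(\<Sum>s\<in>S. B s s) = 1"
  proof -
    have "(\<Sum>s\<in>S. K n s s) = 1" for n
      using b_S[of n] c[of n] by (simp add: K_def flip: sum_divide_distrib)
    moreover have "((\<lambda>n. \<Sum>s\<in>S. K n s s) \<longlongrightarrow> (\<Sum>s\<in>S. B s s)) U"
      by (intro tendsto_intros B)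
    ultimately have "((\<lambda>n. 1) \<longlongrightarrow> (\<Sum>s\<in>S. B s s)) U" by simp
    then show ?thesis using tendsto_unique[OF U(1) _ tendsto_const] by blast
  qed
  moreover have "\<bar>B x y\<bar> \<le> len x * len y" for x y
    using tendsto_upperbound[OF tendsto_rabs[OF B]] U(1) K_le by simp
  moreover have "B x e = 0" for x
  proof -
    have "K n x e = 0" for n by (simp add: K_def b_def)
    then show ?thesis using tendsto_unique[OF U(1) B[of x e]] by simp
  qed
  ultimately show ?thesis by blast
qed

text \<open>The last condition is a scale-free form of \<open>\<Sum> |\<nabla>f|\<^sup>2 / f \<le> C / r\<^sup>2\<close>, i.e. \<open>f\<close> is the
  square of a function with \<open>\<ell>\<^sup>2\<close> Foelner constant \<open>O(1/r)\<close>, supported in a ball of radius \<open>O(r)\<close>.\<close>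

definition controlled_weight :: "real \<Rightarrow> nat \<Rightarrow> ('a \<Rightarrow>\<^sub>0 real) \<Rightarrow> bool" where
  "controlled_weight C r f \<longleftrightarrow>
     (\<forall>x. 0 \<le> lookup f x) \<and> (\<forall>x\<in>keys f. real (len x) \<le> C * real r) \<and>
     lext (\<lambda>_. 1 :: real) f = 1 \<and>
     (\<forall>s\<in>S. \<forall>c :: 'a \<Rightarrow> real. \<forall>t>0. \<forall>A. finite A \<longrightarrow>
        (\<Sum>x\<in>A. \<bar>lookup f (iv s \<cdot> x) - lookup f x\<bar> * \<bar>c x\<bar>)
          \<le> C * (t / (real r)\<^sup>2
               + (\<Sum>x\<in>A. (c x)\<^sup>2 * (lookup f x + lookup f (iv s \<cdot> x))) / t))"

context
  fixes C r f
  assumes f: "controlled_weight C r f" and r: "r \<ge> 1" and C: "C > 0"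
begin

lemma weight_nonneg: "0 \<le> lookup f x"
  and weight_supp: "x \<in> keys f \<Longrightarrow> len x \<le> C * r"
  and weight_total: "lext (\<lambda>_. 1 :: real) f = 1"
  using f by (auto simp: controlled_weight_def)

text \<open>\<open>t\<close> is the free parameter of the inequality between arithmetic and
  geometric means, which replaces Cauchy-Schwarz; the finite set is the union of the two
  supports.\<close>

lemma weight_grad:
  assumes s: "s \<in> S" and t: "t > 0" and c: "\<And>x. \<bar>d x\<bar> \<le> \<bar>c x\<bar>"
  shows "\<bar>lext d (tr s f - f)\<bar> \<le> C * (t / (real r)\<^sup>2 + lext (\<lambda>x. (c x)\<^sup>2) (f + tr s f) / t)"
proof -
  let ?A = "keys f \<union> keys (tr s f)"
  have A: "finite ?A" "keys (tr s f - f) \<subseteq> ?A" "keys (f + tr s f) \<subseteq> ?A"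
    using keys_diff[of "tr s f" f] keys_add[of f "tr s f"] by auto
  have "\<bar>lext d (tr s f - f)\<bar> \<le> (\<Sum>x\<in>?A. \<bar>lookup (tr s f - f) x\<bar> * \<bar>d x\<bar>)"
    unfolding lext_superset[OF A(1,2)] by (rule order_trans[OF sum_abs]) (simp add: abs_mult)
  also have "\<dots> \<le> (\<Sum>x\<in>?A. \<bar>lookup f (iv s \<cdot> x) - lookup f x\<bar> * \<bar>c x\<bar>)"
    using c by (intro sum_mono mult_mono) (auto simp: lookup_minus lookup_tr)
  also have "\<dots> \<le> C * (t / (real r)\<^sup>2
               + (\<Sum>x\<in>?A. (c x)\<^sup>2 * (lookup f x + lookup f (iv s \<cdot> x))) / t)"
    using f s t A(1) unfolding controlled_weight_def by blast
  also have "(\<Sum>x\<in>?A. (c x)\<^sup>2 * (lookup f x + lookup f (iv s \<cdot> x)))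
      = lext (\<lambda>x. (c x)\<^sup>2) (f + tr s f)"
    unfolding lext_superset[OF A(1,3)] by (simp add: lookup_add lookup_tr mult.commute)
  finally show ?thesis .
qed

lemma norm_eq_lext_sgn: "norm \<phi> = lext (\<lambda>x. sgn (lookup \<phi> x)) \<phi>" for \<phi> :: "'a \<Rightarrow>\<^sub>0 real"
  unfolding norm_poly_mapping_sum lext_def
  by (intro sum.cong) (auto simp: abs_sgn mult.commute)

lemma norm_weight: "norm f = 1"
  using weight_total weight_nonneg by (simp add: norm_poly_mapping_sum lext_def)

lemma weight_shift_S:
  assumes s: "s \<in> S"
  shows "norm (tr s f - f) \<le> 3 * C / r"
proof -
  have "norm (tr s f - f) = lext (\<lambda>x. sgn (lookup (tr s f - f) x)) (tr s f - f)"
    by (rule norm_eq_lext_sgn)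
  \<comment> \<open>With \<open>t = r\<close> and \<open>c = 1\<close> the two terms are
    \<open>1 / r\<close> and \<open>2 / r\<close>, whence the 3.\<close>
  also have "\<dots> \<le> C * (r / (real r)\<^sup>2 + lext (\<lambda>x. 1\<^sup>2) (f + tr s f) / r)"
    using weight_grad[OF s, of r "\<lambda>x. sgn (lookup (tr s f - f) x)" "\<lambda>_. 1"] r
    by (simp add: abs_sgn_eq)
  also have "\<dots> = 3 * C / r"
    using r by (simp add: lext_add lext_tr weight_total power2_eq_square field_simps)
  finally show ?thesis .
qed

lemma weight_shift: "norm (tr g f - f) \<le> 3 * C * len g / r"
proof (rule word_induct[of "\<lambda>g k. norm (tr g f - f) \<le> 3 * C * k / r"])
  fix s g k assume s: "s \<in> S" and IH: "norm (tr g f - f) \<le> 3 * C * real k / r"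
  have "tr (s \<cdot> g) f - f = tr s (tr g f - f) + (tr s f - f)" by (simp add: tr_diff)
  then have "norm (tr (s \<cdot> g) f - f) \<le> norm (tr g f - f) + norm (tr s f - f)"
    by (metis norm_tr norm_triangle_ineq)
  also have "\<dots> \<le> 3 * C * real k / r + 3 * C / r" using IH weight_shift_S[OF s] by linarith
  finally show "norm (tr (s \<cdot> g) f - f) \<le> 3 * C * real (Suc k) / r"
    by (simp add: algebra_simps add_divide_distrib)
qed simp

text \<open>The square root of a controlled weight is almost invariant in \<open>\<ell>\<^sup>2\<close>, since
  \<open>(\<surd>a - \<surd>b)\<^sup>2 \<le> |a - b|\<close>.\<close>

lemma energy_sqrt_weight:
  shows "\<exists>\<phi>. ip \<phi> \<phi> = 1 \<and> energy \<phi> \<le> 3 * C * card S / r"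
proof -
  define \<phi> where "\<phi> = Abs_poly_mapping (\<lambda>x. sqrt (lookup f x))"
  have \<phi>: "lookup \<phi> x = sqrt (lookup f x)" for x
    by (simp add: \<phi>_def)
  have keys: "keys \<phi> = keys f" by (auto simp: in_keys_iff \<phi>)
  have "ip \<phi> \<phi> = lext (\<lambda>_. 1 :: real) f"
    unfolding ip_superset[OF finite_keys order_refl] lext_def
    by (rule sum.cong) (simp_all add: keys \<phi> weight_nonneg)
  then have "ip \<phi> \<phi> = 1" using weight_total by simp
  moreover have "ip (\<phi> - tr s \<phi>) (\<phi> - tr s \<phi>) \<le> 3 * C / r" if "s \<in> S" for s
  proof -
    let ?A = "keys f \<union> keys (tr s f)"
    have A: "finite ?A" "keys (\<phi> - tr s \<phi>) \<subseteq> ?A" "keys (tr s f - f) \<subseteq> ?A"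
      using keys_diff[of \<phi> "tr s \<phi>"] keys_diff[of "tr s f" f] by (auto simp: keys keys_tr)
    have sq: "(sqrt a - sqrt b)\<^sup>2 \<le> \<bar>b - a\<bar>" if "0 \<le> a" "0 \<le> b" for a b
    proof -
      have "0 \<le> sqrt a" "0 \<le> sqrt b" using that by simp_all
      then have "\<bar>sqrt a - sqrt b\<bar> \<le> sqrt a + sqrt b" by linarith
      then have "\<bar>sqrt a - sqrt b\<bar> * \<bar>sqrt a - sqrt b\<bar> \<le> \<bar>sqrt a - sqrt b\<bar> * (sqrt a + sqrt b)"
        by (intro mult_left_mono) auto
      also have "\<dots> = \<bar>(sqrt a - sqrt b) * (sqrt a + sqrt b)\<bar>" using that by (simp add: abs_mult)
      also have "(sqrt a - sqrt b) * (sqrt a + sqrt b) = a - b" using that by (simp add: algebra_simps)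
      finally show ?thesis by (simp add: power2_eq_square abs_minus_commute flip: abs_mult)
    qed
    have "ip (\<phi> - tr s \<phi>) (\<phi> - tr s \<phi>)
        = (\<Sum>x\<in>?A. (sqrt (lookup f x) - sqrt (lookup (tr s f) x))\<^sup>2)"
      unfolding ip_superset[OF A(1,2)] by (simp add: lookup_minus lookup_tr \<phi> power2_eq_square)
    also have "\<dots> \<le> (\<Sum>x\<in>?A. \<bar>lookup (tr s f - f) x\<bar>)"
      unfolding lookup_minus lookup_tr by (intro sum_mono sq weight_nonneg)
    also have "\<dots> = norm (tr s f - f)"
      unfolding norm_poly_mapping_sum using A by (intro sum.mono_neutral_right) (auto simp: in_keys_iff)
    also have "\<dots> \<le> 3 * C / r" by (rule weight_shift_S[OF that])
    finally show ?thesis .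
  qed
  then have sum_le: "(\<Sum>s\<in>S. ip (\<phi> - tr s \<phi>) (\<phi> - tr s \<phi>)) \<le> card S * (3 * C / r)"
    by (rule sum_bounded_above)
  define a where "a = card S * (3 * C / r)"
  have "0 \<le> a" using C by (simp add: a_def)
  then have "energy \<phi> \<le> a" using sum_le unfolding energy_eq a_def[symmetric] by linarith
  then show ?thesis using \<open>ip \<phi> \<phi> = 1\<close> by (intro exI[of _ \<phi>]) (simp add: a_def mult_ac)
qed

end

end

section \<open>The invariant form of trace class\<close>

text \<open>The weight \<open>f n\<close> has scale \<open>Suc n\<close>, which keeps every scale
  positive.\<close>

locale controlled_harmonic = fg_group mul e iv S len
  for mul :: "'a \<Rightarrow> 'a \<Rightarrow> 'a" (infixl "\<cdot>" 70) and e :: 'a and iv and S and len +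
  fixes B :: "'a \<Rightarrow> 'a \<Rightarrow> real" and C :: real and f :: "nat \<Rightarrow> 'a \<Rightarrow>\<^sub>0 real"
  assumes B_psd: "psd_kernel B" and B_inv: "invariant_kernel B"
    and B_harmonic: "(\<Sum>s\<in>S. B s y) = 0" and B_S: "(\<Sum>s\<in>S. B s s) = 1"
    and B_le: "\<bar>B x y\<bar> \<le> len x * len y" and B_e: "B x e = 0"
    and C: "C > 0" and f: "controlled_weight C (Suc n) (f n)"
begin

sublocale B: psd_form "kform B"
  by (rule psd_form_kform[OF B_psd])

lemma B_sym: "B x y = B y x"
  using B_psd by (simp add: psd_kernel_def)

text \<open>This is <g b x, b y> = <b x, inv(g) b y> for the cocycle b, where inv(g) b y = b(inv(g)
  y) - b(inv(g)).\<close>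

lemma B_swap: "B (g \<cdot> x) y - B g y = B x (iv g \<cdot> y) - B x (iv g)"
proof -
  have inv: "B (g \<cdot> x) (g \<cdot> y) - B (g \<cdot> x) g - B g (g \<cdot> y) + B g g = B x y" for y
    using B_inv by (simp add: invariant_kernel_def)
  show ?thesis using inv[of "iv g \<cdot> y"] inv[of "iv g"] by (simp add: B_e)
qed

lemma B_mul_S: "B (s \<cdot> x) s = B s s - B x (iv s)"
  using B_swap[of s x s] by (simp add: B_e)

text \<open>Expand |b s + s b x|^2. The cross term is <b x, inv(s) b s>, and inv(s) b s = -
  b(inv(s)) because b vanishes at the neutral element.\<close>

lemma B_norm_mul: "B (s \<cdot> x) (s \<cdot> x) = B x x + B s s - 2 * B x (iv s)"
proof -
  have "B (s \<cdot> x) (s \<cdot> x) - B (s \<cdot> x) s - B s (s \<cdot> x) + B s s = B x x"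
    using B_inv by (simp add: invariant_kernel_def)
  then show ?thesis using B_mul_S[of s x] B_sym[of s "s \<cdot> x"] by simp
qed

lemma B_S_le_1: "s \<in> S \<Longrightarrow> B s s \<le> 1"
proof -
  assume "s \<in> S"
  then have "B s s \<le> (\<Sum>s\<in>S. B s s)"
    using finite_S B.nonneg[of "pt s" for s] by (intro member_le_sum) auto
  then show ?thesis by (simp add: B_S)
qed

lemma B_nonneg: "0 \<le> B x x"
  using B.nonneg[of "pt x"] by simp

definition Tn :: "nat \<Rightarrow> 'a \<Rightarrow> 'a \<Rightarrow> real" where
  "Tn n x y = lext (\<lambda>z. B z x * B z y) (f n) / (real (Suc n))\<^sup>2"

lemma kform_Tn: "kform (Tn n) \<phi> \<psi>
    = lext (\<lambda>z. kform B (pt z) \<phi> * kform B (pt z) \<psi>) (f n) / (real (Suc n))\<^sup>2"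
proof (rule bilinear_eq_on_pt[OF bilinear_kform])
  let ?q = "\<lambda>z. kform B (pt z)"
  let ?Q = "\<lambda>\<phi> \<psi>. lext (\<lambda>z. ?q z \<phi> * ?q z \<psi>) (f n) / (real (Suc n))\<^sup>2"
  have "linear (?Q \<phi>)" for \<phi>
  proof (rule linearI)
    fix \<psi> \<psi>' and a :: real
    show "?Q \<phi> (\<psi> + \<psi>') = ?Q \<phi> \<psi> + ?Q \<phi> \<psi>'"
      by (simp only: B.add_right distrib_left lext_fun_add add_divide_distrib)
    have "?q z \<phi> * ?q z (a *\<^sub>R \<psi>) = a * (?q z \<phi> * ?q z \<psi>)" for z by (simp add: B.scale_right)
    then show "?Q \<phi> (a *\<^sub>R \<psi>) = a *\<^sub>R ?Q \<phi> \<psi>"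
      by (simp only: lext_fun_mult real_scaleR_def times_divide_eq_right)
  qed
  moreover have "?Q \<phi> = (\<lambda>\<psi>. ?Q \<psi> \<phi>)" for \<phi> by (simp only: mult.commute)
  ultimately show "bilinear ?Q" unfolding bilinear_def by metis
qed (simp add: Tn_def)

lemma weight_avg_le:
  assumes "\<And>z. len z \<le> C * Suc n \<Longrightarrow> h z \<le> M * (real (Suc n))\<^sup>2"
  shows "lext h (f n) / (real (Suc n))\<^sup>2 \<le> M"
proof -
  have "lext h (f n) \<le> lext (\<lambda>_. (M * (real (Suc n))\<^sup>2) * 1) (f n)"
    using assms weight_nonneg[OF f _ C] weight_supp[OF f _ C] by (intro lext_mono) auto
  also have "\<dots> = M * (real (Suc n))\<^sup>2"
    unfolding lext_fun_mult using weight_total[OF f _ C] by simp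
  finally show ?thesis by (simp add: divide_le_eq)
qed

lemma B_ball_le: "len z \<le> C * Suc n \<Longrightarrow> B z z \<le> C\<^sup>2 * (real (Suc n))\<^sup>2"
proof -
  assume "len z \<le> C * Suc n"
  then have "real (len z) * real (len z) \<le> (C * Suc n) * (C * Suc n)" by (intro mult_mono) auto
  then show ?thesis using B_le[of z z] by (simp add: power2_eq_square algebra_simps)
qed

lemma psd_kernel_Tn: "psd_kernel (Tn n)"
  unfolding psd_kernel_def
proof (intro conjI allI)
  show "Tn n x y = Tn n y x" for x y by (simp add: Tn_def mult.commute)
  show "0 \<le> kform (Tn n) \<phi> \<phi>" for \<phi>
  proof -
    have "lext (\<lambda>_. 0) (f n) \<le> lext (\<lambda>z. kform B (pt z) \<phi> * kform B (pt z) \<phi>) (f n)"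
      using weight_nonneg[OF f _ C] by (intro lext_mono) auto
    then show ?thesis by (simp add: kform_Tn lext_def)
  qed
qed

lemma Tn_bound: "kform (Tn n) \<phi> \<phi> \<le> C\<^sup>2 * kform B \<phi> \<phi>"
  unfolding kform_Tn
proof (rule weight_avg_le)
  fix z assume "len z \<le> C * Suc n"
  then have "B z z * kform B \<phi> \<phi> \<le> C\<^sup>2 * (real (Suc n))\<^sup>2 * kform B \<phi> \<phi>"
    by (intro mult_right_mono B_ball_le B.nonneg)
  then show "kform B (pt z) \<phi> * kform B (pt z) \<phi> \<le> C\<^sup>2 * kform B \<phi> \<phi> * (real (Suc n))\<^sup>2"
    using B.cauchy_schwarz[of "pt z" \<phi>] by (simp add: power2_eq_square mult_ac)
qed

text \<open>By Bessel's inequality each rank one term has trace at most |b z|^2, which on the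
  support of the weight is at most \<open>C\<^sup>2\<close> times the square of the scale.\<close>

lemma Tn_trace:
  assumes "B.orthonormal k v"
  shows "(\<Sum>i<k. kform (Tn n) (v i) (v i)) \<le> C\<^sup>2"
proof -
  have "(\<Sum>i<k. kform (Tn n) (v i) (v i))
      = lext (\<lambda>z. \<Sum>i<k. (kform B (pt z) (v i))\<^sup>2) (f n) / (real (Suc n))\<^sup>2"
    by (simp only: kform_Tn lext_fun_sum sum_divide_distrib power2_eq_square)
  also have "\<dots> \<le> C\<^sup>2"
  proof (rule weight_avg_le)
    fix z assume "len z \<le> C * Suc n"
    from B_ball_le[OF this] show "(\<Sum>i<k. (kform B (pt z) (v i))\<^sup>2) \<le> C\<^sup>2 * (real (Suc n))\<^sup>2"
      using B.bessel[OF assms, of "pt z"] by simp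
  qed
  finally show ?thesis .
qed

lemma Tn_le: "\<bar>Tn n x y\<bar> \<le> C\<^sup>2 * len x * len y"
proof -
  interpret Tn: psd_form "kform (Tn n)" by (rule psd_form_kform[OF psd_kernel_Tn])
  have *: "kform (Tn n) (pt x) (pt x) \<le> (C * len x)\<^sup>2" for x
  proof -
    have "kform (Tn n) (pt x) (pt x) \<le> C\<^sup>2 * B x x" using Tn_bound[of n "pt x"] by simp
    also have "\<dots> \<le> C\<^sup>2 * (len x)\<^sup>2"
      using B_le[of x x] by (intro mult_left_mono) (auto simp: power2_eq_square)
    finally show ?thesis by (simp add: power_mult_distrib)
  qed
  have "\<bar>kform (Tn n) (pt x) (pt y)\<bar> \<le> (C * len x) * (C * len y)"
    using C by (intro Tn.abs_le *) auto
  then show ?thesis by (simp add: power2_eq_square mult_ac)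
qed

text \<open>The difference pairs b x with the image of b w under an orthogonal map, which is as long
  as b w. This takes the place of subadditivity of \<open>len\<close>, which is not assumed.\<close>

lemma B_mul_diff_le: "\<bar>B (g \<cdot> w) x - B g x\<bar> \<le> real (len w) * real (len x)"
proof -
  let ?d = "pt (g \<cdot> w) - pt g"
  have "kform B ?d ?d = B w w"
    using B_inv by (simp add: invariant_kernel_def B.expand algebra_simps)
  then have "kform B ?d ?d \<le> (real (len w))\<^sup>2" using B_le[of w w] by (simp add: power2_eq_square)
  moreover have "kform B (pt x) (pt x) \<le> (real (len x))\<^sup>2" using B_le[of x x] by (simp add: power2_eq_square)
  ultimately have "\<bar>kform B ?d (pt x)\<bar> \<le> real (len w) * real (len x)" by (rule B.abs_le) auto
  then show ?thesis by (simp add: B.diff_left)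
qed

text \<open>With \<open>g\<close> moved to the other side, the first four terms are the average of
  \<open>Tn\<close> for the translated weight, with the cocycle recentred at \<open>iv g\<close>.
  Translating costs O(1/R) in norm against an integrand of size O(R^2), and dropping the recentring
  costs O(R); divided by R^2, both are O(1/R).\<close>

lemma Tn_almost_invariant:
  fixes g x y
  defines "l \<equiv> real (len (iv g))"
  shows "\<bar>Tn n (g \<cdot> x) (g \<cdot> y) - Tn n (g \<cdot> x) g - Tn n g (g \<cdot> y) + Tn n g g - Tn n x y\<bar>
    \<le> len x * len y * ((C + l)\<^sup>2 * (3 * C * l) + (2 * C * l + l\<^sup>2)) * (1 / Suc n)"
proof -
  define R where "R = real (Suc n)"
  define H where "H z = (B z x - B (iv g) x) * (B z y - B (iv g) y)" for z
  let ?F = "f n" and ?G = "tr (iv g) (f n)" and ?L = "real (len x) * real (len y)"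
  have R: "R \<ge> 1" by (simp add: R_def)
  have l: "l \<ge> 0" by (simp add: l_def)
  have CRl: "0 \<le> C * R + l" "C * R + l \<le> (C + l) * R"
    using C R l mult_left_mono[of 1 R l] by (auto simp: distrib_right)
  have supp: "real (len z) \<le> C * R" if "z \<in> keys ?F" for z
    using weight_supp[OF f _ C that] by (simp add: R_def)
  have swap: "B w (g \<cdot> x) - B w g = B (iv g \<cdot> w) x - B (iv g) x" for w x
    using B_swap[of "iv g" w x] by simp
  have TR: "Tn n x y = lext (\<lambda>z. B z x * B z y) ?F / R\<^sup>2" for x y
    by (simp add: Tn_def R_def)
  have "Tn n (g \<cdot> x) (g \<cdot> y) - Tn n (g \<cdot> x) g - Tn n g (g \<cdot> y) + Tn n g g
      = lext (\<lambda>w. (B w (g \<cdot> x) - B w g) * (B w (g \<cdot> y) - B w g)) ?F / R\<^sup>2"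
    unfolding TR add_divide_distrib[symmetric] diff_divide_distrib[symmetric]
      lext_fun_add[symmetric] lext_fun_diff[symmetric]
    by (simp add: algebra_simps)
  also have "\<dots> = lext H ?G / R\<^sup>2" unfolding lext_tr H_def swap ..
  also have "lext H ?G = lext H (?G - ?F) + lext H ?F" by (simp add: lext_diff)
  finally have "Tn n (g \<cdot> x) (g \<cdot> y) - Tn n (g \<cdot> x) g - Tn n g (g \<cdot> y) + Tn n g g - Tn n x y
      = (lext H (?G - ?F) + lext (\<lambda>z. H z - B z x * B z y) ?F) / R\<^sup>2"
    by (simp add: TR[of x y] lext_fun_diff diff_divide_distrib add_divide_distrib)
  note diff = this
  have "\<bar>lext H (?G - ?F)\<bar> \<le> (((C + l) * R)\<^sup>2 * ?L) * norm (?G - ?F)"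
  proof (rule lext_le_norm)
    fix z assume "z \<in> keys (?G - ?F)"
    then have z: "z \<in> keys ?F \<or> z \<in> (\<cdot>) (iv g) ` keys ?F"
      using keys_diff[of ?G ?F] by (auto simp: keys_tr)
    have "\<bar>B z x' - B (iv g) x'\<bar> \<le> ((C + l) * R) * len x'" for x'
    proof -
      have "\<bar>B z x' - B (iv g) x'\<bar> \<le> (C * R + l) * len x'"
        using z
      proof
        assume "z \<in> keys ?F"
        then have "real (len z) * len x' \<le> C * R * len x'" by (intro mult_right_mono supp) simp_all
        then show ?thesis using B_le[of z x'] B_le[of "iv g" x'] by (simp add: l_def distrib_right)
      next
        assume "z \<in> (\<cdot>) (iv g) ` keys ?F"
        then obtain w where w: "w \<in> keys ?F" "z = iv g \<cdot> w" by blast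
        have "\<bar>B z x' - B (iv g) x'\<bar> \<le> real (len w) * real (len x')" unfolding w(2) by (rule B_mul_diff_le)
        also have "\<dots> \<le> (C * R + l) * len x'" using supp[OF w(1)] l by (intro mult_right_mono) auto
        finally show ?thesis .
      qed
      also have "\<dots> \<le> ((C + l) * R) * len x'" using CRl by (intro mult_right_mono) auto
      finally show ?thesis .
    qed
    then have "\<bar>H z\<bar> \<le> (((C + l) * R) * len x) * (((C + l) * R) * len y)"
      unfolding H_def abs_mult by (intro mult_mono) (use CRl in auto)
    then show "\<bar>H z\<bar> \<le> ((C + l) * R)\<^sup>2 * ?L" by (simp add: power2_eq_square mult_ac)
  qed
  also have "\<dots> \<le> (((C + l) * R)\<^sup>2 * ?L) * (3 * C * l / R)"
  proof (rule mult_left_mono)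
    show "norm (?G - ?F) \<le> 3 * C * l / R"
      using weight_shift[OF f[of n] _ C, where g = "iv g"] by (simp add: R_def l_def)
  qed simp
  also have "\<dots> = ?L * ((C + l)\<^sup>2 * (3 * C * l)) * R"
    using R by (simp add: power2_eq_square)
  finally have 1: "\<bar>lext H (?G - ?F)\<bar> \<le> ?L * ((C + l)\<^sup>2 * (3 * C * l)) * R" .
  have "\<bar>lext (\<lambda>z. H z - B z x * B z y) ?F\<bar> \<le> (?L * (2 * C * l + l\<^sup>2) * R) * norm ?F"
  proof (rule lext_le_norm)
    fix z assume z: "z \<in> keys ?F"
    have u: "\<bar>B z x'\<bar> \<le> C * R * len x'" for x'
      using B_le[of z x'] mult_right_mono[OF supp[OF z], of "len x'"] by simp
    have a: "\<bar>B (iv g) x'\<bar> \<le> l * len x'" for x' using B_le[of "iv g" x'] by (simp add: l_def)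
    have "\<bar>B z x * B (iv g) y\<bar> \<le> (C * R * len x) * (l * len y)"
      unfolding abs_mult by (rule mult_mono[OF u a]) (use C R in auto)
    moreover have "\<bar>B (iv g) x * B z y\<bar> \<le> (l * len x) * (C * R * len y)"
      unfolding abs_mult by (rule mult_mono[OF a u]) (use l in auto)
    moreover have "\<bar>B (iv g) x * B (iv g) y\<bar> \<le> (l * len x) * (l * len y)"
      unfolding abs_mult by (rule mult_mono[OF a a]) (use l in auto)
    moreover have "(l * len x) * (l * len y) \<le> l\<^sup>2 * ?L * R"
      using mult_left_mono[OF R, of "l\<^sup>2 * ?L"] l by (simp add: power2_eq_square mult_ac)
    moreover have "H z - B z x * B z y = B (iv g) x * B (iv g) y - B z x * B (iv g) y - B (iv g) x * B z y"
      by (simp add: H_def algebra_simps)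
    ultimately have "\<bar>H z - B z x * B z y\<bar>
        \<le> l\<^sup>2 * ?L * R + (C * R * len x) * (l * len y) + (l * len x) * (C * R * len y)"
      by linarith
    then show "\<bar>H z - B z x * B z y\<bar> \<le> ?L * (2 * C * l + l\<^sup>2) * R" by (simp add: algebra_simps)
  qed
  then have 2: "\<bar>lext (\<lambda>z. H z - B z x * B z y) ?F\<bar> \<le> ?L * (2 * C * l + l\<^sup>2) * R"
    using norm_weight[OF f _ C] by simp
  have "\<bar>lext H (?G - ?F) + lext (\<lambda>z. H z - B z x * B z y) ?F\<bar>
      \<le> ?L * ((C + l)\<^sup>2 * (3 * C * l) + (2 * C * l + l\<^sup>2)) * R"
    using 1 2 by (simp add: algebra_simps)
  then have "\<bar>lext H (?G - ?F) + lext (\<lambda>z. H z - B z x * B z y) ?F\<bar> / R\<^sup>2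
      \<le> ?L * ((C + l)\<^sup>2 * (3 * C * l) + (2 * C * l + l\<^sup>2)) * R / R\<^sup>2"
    by (rule divide_right_mono) simp
  also have "\<dots> = ?L * ((C + l)\<^sup>2 * (3 * C * l) + (2 * C * l + l\<^sup>2)) * (1 / R)"
    using R by (simp add: power2_eq_square)
  finally have "\<bar>lext H (?G - ?F) + lext (\<lambda>z. H z - B z x * B z y) ?F\<bar> / R\<^sup>2
      \<le> ?L * ((C + l)\<^sup>2 * (3 * C * l) + (2 * C * l + l\<^sup>2)) * (1 / R)" .
  then show ?thesis unfolding diff abs_divide by (simp add: R_def)
qed

text \<open>Testing the identity \<open>\<Sum>\<^sub>s (B (s x) (s x) - B x x) = 1\<close> against the weight and
  summing by parts bounds 1 by the gradient of the weight paired with \<open>B x s\<close>.\<close>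

lemma Tn_lower_bound:
  assumes \<tau>: "\<tau> > 0"
  shows "2 \<le> C * card S * \<tau> + C / \<tau> * (20 * real (card S) * (1 / real (Suc n))\<^sup>2 + 24 * (\<Sum>s\<in>S. Tn n s s))"
proof -
  define R where "R = real (Suc n)"
  let ?F = "f n"
  define u where "u z = B z z" for z
  have R: "R > 0" by (simp add: R_def)
  have u_mul: "u (s \<cdot> z) = u z + B s s - 2 * B z (iv s)" for s z
    unfolding u_def by (rule B_norm_mul)
  \<comment> \<open>Harmonicity removes the cross terms, and the normalisation over \<open>S\<close>
    leaves 1.\<close>
  have sum_u: "(\<Sum>s\<in>S. u (s \<cdot> z) - u z) = 1" for z
  proof -
    have "(\<Sum>s\<in>S. B z (iv s)) = 0" using sum_iv[of "B z"] B_harmonic[of z] B_sym[of z] by simp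
    then show ?thesis by (simp add: u_mul sum_subtractf B_S flip: sum_distrib_left)
  qed
  have "1 = lext (\<lambda>z. \<Sum>s\<in>S. u (s \<cdot> z) - u z) ?F"
    unfolding sum_u using weight_total[OF f _ C] by simp
  also have "\<dots> = (\<Sum>s\<in>S. lext u (tr s ?F - ?F))"
    by (simp add: lext_fun_sum lext_fun_diff lext_diff lext_tr)
  finally have 1: "(\<Sum>s\<in>S. lext u (tr s ?F - ?F)) = 1" by simp
  \<comment> \<open>The shifted \<open>u\<close> gives -1, after \<open>s\<close> and
    \<open>iv s\<close> are exchanged. Subtracting leaves differences of \<open>u\<close> at
    neighbours, which are affine in \<open>B z s\<close>, whereas \<open>u\<close> itself has
    quadratic growth.\<close>
  have "(\<Sum>s\<in>S. lext (\<lambda>z. u (iv s \<cdot> z)) (tr s ?F - ?F)) = (\<Sum>s\<in>S. lext u (?F - tr (iv s) ?F))"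
    by (simp add: lext_diff lext_tr)
  also have "\<dots> = (\<Sum>s\<in>S. lext u (?F - tr s ?F))" by (rule sum_iv)
  also have "\<dots> = - 1"
    using 1 by (simp add: lext_diff sum_subtractf)
  finally have "(\<Sum>s\<in>S. lext (\<lambda>z. u z - u (iv s \<cdot> z)) (tr s ?F - ?F)) = 2"
    using 1 by (simp add: lext_fun_diff sum_subtractf)
  moreover have "lext (\<lambda>z. u z - u (iv s \<cdot> z)) (tr s ?F - ?F)
      \<le> C * (\<tau> + (20 / R\<^sup>2 + 8 * Tn n s s + 16 * Tn n (iv s) (iv s)) / \<tau>)" if s: "s \<in> S" for s
  proof -
    define c where "c z = 1 + 2 * \<bar>B z s\<bar>" for z
    have c2: "(c z)\<^sup>2 \<le> 2 + 8 * (B z s)\<^sup>2" for z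
    proof -
      have "0 \<le> (1 - 2 * \<bar>B z s\<bar>)\<^sup>2" by simp
      then show ?thesis by (simp add: c_def power2_eq_square algebra_simps)
    qed
    have "\<bar>(\<lambda>z. u z - u (iv s \<cdot> z)) z\<bar> \<le> \<bar>c z\<bar>" for z
      using u_mul[of "iv s" z] B_S_le_1[OF iv_S[OF s]] B_nonneg[of "iv s"] by (simp add: c_def)
    \<comment> \<open>Taking \<open>t\<close> proportional to the square of the scale makes the
      first term \<open>\<tau>\<close> and turns the second into values of
      \<open>Tn n\<close>.\<close>
    note weight_grad[OF f[of n] _ C s, where t = "\<tau> * R\<^sup>2" and c = c and d = "\<lambda>z. u z - u (iv s \<cdot> z)", OF _ _ this]
    then have "lext (\<lambda>z. u z - u (iv s \<cdot> z)) (tr s ?F - ?F)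
        \<le> C * (\<tau> * R\<^sup>2 / R\<^sup>2 + lext (\<lambda>z. (c z)\<^sup>2) (?F + tr s ?F) / (\<tau> * R\<^sup>2))"
      using \<tau> R by (simp add: R_def)
    also have "lext (\<lambda>z. (c z)\<^sup>2) (?F + tr s ?F) = lext (\<lambda>z. (c z)\<^sup>2 + (c (s \<cdot> z))\<^sup>2) ?F"
      by (simp add: lext_add lext_tr lext_fun_add)
    also have "C * (\<tau> * R\<^sup>2 / R\<^sup>2 + lext (\<lambda>z. (c z)\<^sup>2 + (c (s \<cdot> z))\<^sup>2) ?F / (\<tau> * R\<^sup>2))
        \<le> C * (\<tau> + (20 / R\<^sup>2 + 8 * Tn n s s + 16 * Tn n (iv s) (iv s)) / \<tau>)"
    proof -
      \<comment> \<open>At \<open>z\<close> the bound is 2 plus 8 squares; at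
        \<open>s \<cdot> z\<close> it is 2 + 8 * 2 = 18 plus 8 * 2 = 16 squares. This explains 20, 8
        and 16.\<close>
      have "lext (\<lambda>z. (c z)\<^sup>2 + (c (s \<cdot> z))\<^sup>2) ?F
          \<le> lext (\<lambda>z. 20 * 1 + 8 * (B z s * B z s) + 16 * (B z (iv s) * B z (iv s))) ?F"
      proof (rule lext_mono)
        fix z
        have "(B (s \<cdot> z) s)\<^sup>2 \<le> 2 + 2 * (B z (iv s))\<^sup>2"
        proof -
          have "0 \<le> (B s s + B z (iv s))\<^sup>2" by simp
          moreover have "B s s * B s s \<le> 1 * 1"
            using B_S_le_1[OF s] B_nonneg[of s] by (intro mult_mono) auto
          ultimately show ?thesis by (simp add: B_mul_S power2_eq_square algebra_simps)
        qed
        then show "(c z)\<^sup>2 + (c (s \<cdot> z))\<^sup>2 \<le> 20 * 1 + 8 * (B z s * B z s) + 16 * (B z (iv s) * B z (iv s))"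
          using c2[of z] c2[of "s \<cdot> z"] by (simp add: power2_eq_square)
      qed (use weight_nonneg[OF f _ C] in simp)
      also have "\<dots> = 20 + 8 * (Tn n s s * R\<^sup>2) + 16 * (Tn n (iv s) (iv s) * R\<^sup>2)"
        unfolding lext_fun_add lext_fun_mult using weight_total[OF f _ C] R
        by (simp add: Tn_def R_def)
      finally have "lext (\<lambda>z. (c z)\<^sup>2 + (c (s \<cdot> z))\<^sup>2) ?F / (\<tau> * R\<^sup>2)
          \<le> (20 + 8 * (Tn n s s * R\<^sup>2) + 16 * (Tn n (iv s) (iv s) * R\<^sup>2)) / (\<tau> * R\<^sup>2)"
        using \<tau> R by (intro divide_right_mono) auto
      also have "\<dots> = (20 / R\<^sup>2 + 8 * Tn n s s + 16 * Tn n (iv s) (iv s)) / \<tau>"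
        using \<tau> R by (simp add: field_simps)
      finally show ?thesis using C R by (intro mult_left_mono add_mono) auto
    qed
    finally show ?thesis .
  qed
  ultimately have "2 \<le> (\<Sum>s\<in>S. C * (\<tau> + (20 / R\<^sup>2 + 8 * Tn n s s + 16 * Tn n (iv s) (iv s)) / \<tau>))"
    using sum_mono[of S "\<lambda>s. lext (\<lambda>z. u z - u (iv s \<cdot> z)) (tr s ?F - ?F)"] by fastforce
  also have "\<dots> = C * card S * \<tau> + C / \<tau> * (20 * real (card S) * (1 / R)\<^sup>2 + 24 * (\<Sum>s\<in>S. Tn n s s))"
    using sum_iv[of "\<lambda>s. Tn n s s"] \<tau>
    by (simp add: sum.distrib power_divide algebra_simps flip: sum_distrib_left sum_divide_distrib)
      (simp add: field_simps)
  finally show ?thesis by (simp add: R_def)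
qed

end

section \<open>The linear action attached to an invariant kernel\<close>

context fg_group begin

text \<open>With this action \<open>pt\<close> itself is a cocycle: \<open>pt (g \<cdot> x)\<close>
  is \<open>pt g\<close> plus the action of \<open>g\<close> on \<open>pt x\<close>. Invariance of a
  kernel says that the action preserves its form.\<close>

definition affine_act :: "'a \<Rightarrow> ('a \<Rightarrow>\<^sub>0 real) \<Rightarrow> ('a \<Rightarrow>\<^sub>0 real)" where
  "affine_act g = lext (\<lambda>x. pt (g \<cdot> x) - pt g)"

lemma linear_affine_act: "linear (affine_act g)"
  unfolding affine_act_def by (rule linear_lext)

lemma affine_act_pt [simp]: "affine_act g (pt x) = pt (g \<cdot> x) - pt g"
  by (simp add: affine_act_def)

lemma affine_act_mul: "affine_act (g \<cdot> h) \<phi> = affine_act g (affine_act h \<phi>)"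
proof (rule linear_eq_on_pt[where \<phi> = \<phi>])
  show "linear (\<lambda>\<phi>. affine_act g (affine_act h \<phi>))"
    using linear_compose[OF linear_affine_act linear_affine_act] by (simp add: comp_def)
qed (simp_all add: linear_affine_act linear_diff[OF linear_affine_act] assoc)

lemma kform_affine_act:
  assumes K: "invariant_kernel K"
  shows "kform K (affine_act g \<phi>) (affine_act g \<psi>) = kform K \<phi> \<psi>"
proof (rule bilinear_eq_on_pt[OF _ bilinear_kform])
  have lin: "linear (kform K \<phi>)" "linear (\<lambda>\<phi>. kform K \<phi> \<psi>)" for \<phi> \<psi>
    using bilinear_kform[of K] by (simp_all add: bilinear_def)
  show "bilinear (\<lambda>\<phi> \<psi>. kform K (affine_act g \<phi>) (affine_act g \<psi>))"
    using linear_compose[OF linear_affine_act lin(1)] linear_compose[OF linear_affine_act lin(2)]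
    by (simp add: bilinear_def comp_def)
  show "kform K (affine_act g (pt x)) (affine_act g (pt y)) = kform K (pt x) (pt y)" for x y
    using K bilinear_kform[of K] by (simp add: invariant_kernel_def bilinear_lsub bilinear_rsub algebra_simps)
qed

end

context controlled_harmonic begin

lemma linear_rep_or_character:
  obtains (rep) d :: nat and \<rho> :: "'a \<Rightarrow> nat \<Rightarrow> nat \<Rightarrow> real"
    where "\<And>g h i j. i < d \<Longrightarrow> j < d \<Longrightarrow> \<rho> (g \<cdot> h) i j = (\<Sum>k<d. \<rho> g i k * \<rho> h k j)"
      "\<And>i j. i < d \<Longrightarrow> j < d \<Longrightarrow> \<rho> e i j = (if i = j then 1 else 0)"
      "\<exists>g i j. i < d \<and> j < d \<and> \<rho> g i j \<noteq> (if i = j then 1 else 0)"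
  | (character) c :: "'a \<Rightarrow> real"
    where "\<And>g h. c (g \<cdot> h) = c g + c h" "\<exists>g. c g \<noteq> 0"
proof -
  obtain U :: "nat filter" where U: "U \<noteq> bot" "U \<le> sequentially"
    and Ulim: "\<And>x :: nat \<Rightarrow> real. Bseq x \<Longrightarrow> (x \<longlongrightarrow> Lim U x) U"
    using bounded_limit_filter by blast
  have inv0: "((\<lambda>n. 1 / real (Suc n)) \<longlongrightarrow> 0) U"
    using tendsto_mono[OF U(2) LIMSEQ_inverse_real_of_nat] by (simp add: inverse_eq_divide)
  define T where "T x y = Lim U (\<lambda>n. Tn n x y)" for x y
  have T: "((\<lambda>n. Tn n x y) \<longlongrightarrow> T x y) U" for x y
    unfolding T_def using Tn_le[of _ x y] by (intro Ulim BseqI'[of _ "C\<^sup>2 * len x * len y"]) simp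
  have T_psd: "psd_kernel T" by (rule psd_kernel_limit[OF U(1) psd_kernel_Tn T])
  interpret T: psd_form "kform T" by (rule psd_form_kform[OF T_psd])
  have T_inv: "invariant_kernel T"
    unfolding invariant_kernel_def
  proof (intro allI)
    fix g x y
    let ?d = "\<lambda>n. Tn n (g \<cdot> x) (g \<cdot> y) - Tn n (g \<cdot> x) g - Tn n g (g \<cdot> y) + Tn n g g - Tn n x y"
    have "(?d \<longlongrightarrow> T (g \<cdot> x) (g \<cdot> y) - T (g \<cdot> x) g - T g (g \<cdot> y) + T g g - T x y) U"
      by (intro tendsto_intros T)
    moreover have "(?d \<longlongrightarrow> 0) U"
    proof (rule Lim_null_comparison)
      let ?l = "real (len (iv g))"
      let ?M = "len x * len y * ((C + ?l)\<^sup>2 * (3 * C * ?l) + (2 * C * ?l + ?l\<^sup>2))"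
      show "\<forall>\<^sub>F n in U. norm (?d n) \<le> ?M * (1 / real (Suc n))"
        using Tn_almost_invariant[of _ g x y] by simp
      show "((\<lambda>n. ?M * (1 / real (Suc n))) \<longlongrightarrow> 0) U" by (rule tendsto_mult_right_zero[OF inv0])
    qed
    ultimately have "T (g \<cdot> x) (g \<cdot> y) - T (g \<cdot> x) g - T g (g \<cdot> y) + T g g - T x y = 0"
      by (rule tendsto_unique[OF U(1)])
    then show "T (g \<cdot> x) (g \<cdot> y) - T (g \<cdot> x) g - T g (g \<cdot> y) + T g g = T x y" by simp
  qed
  have T_bound: "kform T \<phi> \<phi> \<le> C\<^sup>2 * kform B \<phi> \<phi>" for \<phi>
    by (rule tendsto_upperbound[OF tendsto_kform[OF T]]) (simp_all add: Tn_bound U)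
  have T_trace: "(\<Sum>i<k. kform T (v i) (v i)) \<le> C\<^sup>2" if "B.orthonormal k v" for k v
  proof (rule tendsto_upperbound)
    show "((\<lambda>n. \<Sum>i<k. kform (Tn n) (v i) (v i)) \<longlongrightarrow> (\<Sum>i<k. kform T (v i) (v i))) U"
      by (intro tendsto_sum tendsto_kform T)
  qed (simp_all add: Tn_trace[OF that] U)
  have T_S: "(\<Sum>s\<in>S. T s s) > 0"
  proof -
    \<comment> \<open>Makes the term \<open>C * card S * \<tau>\<close> of
      \<open>Tn_lower_bound\<close> equal to 1, half of the left side.\<close>
    define \<tau> where "\<tau> = 1 / (C * card S)"
    have \<tau>: "\<tau> > 0" using C card_S_pos by (simp add: \<tau>_def)
    have "((\<lambda>n. C * card S * \<tau> + C / \<tau> * (20 * real (card S) * (1 / real (Suc n))\<^sup>2 + 24 * (\<Sum>s\<in>S. Tn n s s)))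
        \<longlongrightarrow> C * card S * \<tau> + C / \<tau> * (20 * real (card S) * 0\<^sup>2 + 24 * (\<Sum>s\<in>S. T s s))) U"
      by (intro tendsto_intros T inv0)
    then have "2 \<le> C * card S * \<tau> + C / \<tau> * (20 * real (card S) * 0\<^sup>2 + 24 * (\<Sum>s\<in>S. T s s))"
      by (rule tendsto_lowerbound) (use Tn_lower_bound[OF \<tau>] U in simp_all)
    then have "1 \<le> C / \<tau> * 24 * (\<Sum>s\<in>S. T s s)" using C card_S_pos by (simp add: \<tau>_def)
    moreover have "C / \<tau> * 24 > 0" using C \<tau> by simp
    ultimately show ?thesis by (metis less_le_trans zero_less_mult_pos zero_less_one)
  qed
  have T_nontrivial: "\<exists>\<phi>. kform T \<phi> \<phi> > 0"
  proof -
    have "\<exists>s\<in>S. T s s > 0" using T_S by (meson not_less sum_nonpos)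
    then show ?thesis by (metis kform_pt)
  qed
  \<comment> \<open>The neutral element sends \<open>pt x\<close> to \<open>pt x - pt e\<close>,
    which agrees with \<open>pt x\<close> for \<open>B\<close> because \<open>pt e\<close> is
    \<open>B\<close>-null.\<close>
  interpret action: trace_class_action "kform B" "kform T" "C\<^sup>2" mul e iv affine_act pt
  proof
    show "kform B (affine_act e \<phi>) \<psi> = kform B \<phi> \<psi>" for \<phi> \<psi>
    proof (rule bilinear_eq_on_pt[OF _ bilinear_kform])
      have "linear (\<lambda>\<phi>. kform B \<phi> \<psi>)" for \<psi> using B.bilin by (simp add: bilinear_def)
      from linear_compose[OF linear_affine_act this]
      show "bilinear (\<lambda>\<phi>. kform B (affine_act e \<phi>))"
        using B.bilin by (simp add: bilinear_def comp_def)
      show "kform B (affine_act e (pt x)) (pt y) = kform B (pt x) (pt y)" for x y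
        using B_e[of y] B_sym[of e y] by (simp add: B.diff_left)
    qed
    show "\<exists>F a. finite F \<and> \<phi> = (\<Sum>g\<in>F. a g *\<^sub>R pt g)" for \<phi> :: "'a \<Rightarrow>\<^sub>0 real"
      using pt_expansion[of \<phi>] finite_keys by blast
  qed (simp_all add: T_bound T_trace T_nontrivial linear_affine_act affine_act_mul
      linear_add[OF linear_affine_act] linear_scale[OF linear_affine_act]
      kform_affine_act[OF B_inv] kform_affine_act[OF T_inv])
  show thesis
    by (rule action.linear_rep_or_character) (blast intro: rep character)+
qed

end

section \<open>Weights from coloured partitions\<close>

locale fin_add_prob =
  fixes \<Omega> :: "'x set" and \<nu> :: "'x set \<Rightarrow> real"
  assumes \<nu>_nonneg: "A \<subseteq> \<Omega> \<Longrightarrow> 0 \<le> \<nu> A" and \<nu>_total: "\<nu> \<Omega> = 1"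
    and \<nu>_add: "A \<subseteq> \<Omega> \<Longrightarrow> A' \<subseteq> \<Omega> \<Longrightarrow> A \<inter> A' = {} \<Longrightarrow> \<nu> (A \<union> A') = \<nu> A + \<nu> A'"
begin

lemma \<nu>_UN:
  assumes "finite I" "\<And>i. i \<in> I \<Longrightarrow> A i \<subseteq> \<Omega>" "disjoint_family_on A I"
  shows "\<nu> (\<Union>i\<in>I. A i) = (\<Sum>i\<in>I. \<nu> (A i))"
  using assms
proof (induction I rule: finite_induct)
  case empty
  show ?case using \<nu>_add[of "{}" "{}"] by simp
next
  case (insert i I)
  have "A i \<inter> (\<Union>j\<in>I. A j) = {}"
    using insert.prems(2) insert.hyps(2) by (fastforce simp: disjoint_family_on_def)
  then have "\<nu> (A i \<union> (\<Union>j\<in>I. A j)) = \<nu> (A i) + \<nu> (\<Union>j\<in>I. A j)"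
    using insert.prems(1) by (intro \<nu>_add) auto
  moreover have "disjoint_family_on A I"
    using insert.prems(2) by (rule disjoint_family_on_mono[rotated]) auto
  ultimately show ?case using insert by simp
qed

text \<open>The integral for functions of finite range, for which finite additivity of
  \<open>\<nu>\<close> is enough.\<close>

definition mean :: "('x \<Rightarrow> real) \<Rightarrow> real" where
  "mean F = (\<Sum>v\<in>F ` \<Omega>. v * \<nu> {x \<in> \<Omega>. F x = v})"

definition fin_range :: "('x \<Rightarrow> 'y) \<Rightarrow> bool" where
  "fin_range F \<longleftrightarrow> finite (F ` \<Omega>)"

lemma fin_range_comp2: "fin_range F \<Longrightarrow> fin_range H \<Longrightarrow> fin_range (\<lambda>x. h (F x) (H x))"
  unfolding fin_range_def
  by (rule finite_subset[of _ "(\<lambda>(a, b). h a b) ` (F ` \<Omega> \<times> H ` \<Omega>)"]) auto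

lemma fin_range_comp: "fin_range F \<Longrightarrow> fin_range (\<lambda>x. h (F x))"
  using fin_range_comp2[of F F "\<lambda>a _. h a"] by simp

lemma fin_range_const: "fin_range (\<lambda>_. c)"
  unfolding fin_range_def by (rule finite_subset[of _ "{c}"]) auto

lemma fin_range_sum: "(\<And>i. i \<in> I \<Longrightarrow> fin_range (F i)) \<Longrightarrow> fin_range (\<lambda>x. \<Sum>i\<in>I. F i x)"
  for F :: "'i \<Rightarrow> 'x \<Rightarrow> real"
  by (induction I rule: infinite_finite_induct) (auto simp: fin_range_const intro: fin_range_comp2)

lemma mean_comp:
  assumes \<Phi>: "fin_range \<Phi>"
  shows "mean (\<lambda>x. h (\<Phi> x)) = (\<Sum>y\<in>\<Phi> ` \<Omega>. h y * \<nu> {x \<in> \<Omega>. \<Phi> x = y})"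
proof -
  have fin: "finite (\<Phi> ` \<Omega>)" using \<Phi> by (simp add: fin_range_def)
  have "(\<Sum>y\<in>\<Phi> ` \<Omega>. h y * \<nu> {x \<in> \<Omega>. \<Phi> x = y})
      = (\<Sum>v\<in>h ` \<Phi> ` \<Omega>. \<Sum>y\<in>{y \<in> \<Phi> ` \<Omega>. h y = v}. h y * \<nu> {x \<in> \<Omega>. \<Phi> x = y})"
    by (rule sum.image_gen[OF fin])
  also have "\<dots> = (\<Sum>v\<in>h ` \<Phi> ` \<Omega>. v * \<nu> {x \<in> \<Omega>. h (\<Phi> x) = v})"
  proof (rule sum.cong[OF refl])
    fix v
    have "{x \<in> \<Omega>. h (\<Phi> x) = v} = (\<Union>y\<in>{y \<in> \<Phi> ` \<Omega>. h y = v}. {x \<in> \<Omega>. \<Phi> x = y})" by auto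
    also have "\<nu> \<dots> = (\<Sum>y\<in>{y \<in> \<Phi> ` \<Omega>. h y = v}. \<nu> {x \<in> \<Omega>. \<Phi> x = y})"
      using fin by (intro \<nu>_UN) (auto simp: disjoint_family_on_def)
    finally show "(\<Sum>y\<in>{y \<in> \<Phi> ` \<Omega>. h y = v}. h y * \<nu> {x \<in> \<Omega>. \<Phi> x = y}) = v * \<nu> {x \<in> \<Omega>. h (\<Phi> x) = v}"
      by (simp add: sum_distrib_left)
  qed
  finally show ?thesis by (simp add: mean_def image_image)
qed

text \<open>The common level sets of \<open>F\<close> and \<open>H\<close> refine those of both, so
  additivity and monotonicity of the mean become statements about one finite sum.\<close>

lemma mean_comp2:
  assumes "fin_range F" "fin_range H"
  shows "mean (\<lambda>x. h (F x) (H x))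
    = (\<Sum>p\<in>(\<lambda>x. (F x, H x)) ` \<Omega>. h (fst p) (snd p) * \<nu> {x \<in> \<Omega>. (F x, H x) = p})"
  using mean_comp[of "\<lambda>x. (F x, H x)" "\<lambda>p. h (fst p) (snd p)"] fin_range_comp2[OF assms, of Pair] by simp

lemma mean_add:
  assumes "fin_range F" "fin_range H"
  shows "mean (\<lambda>x. F x + H x) = mean F + mean H"
  using mean_comp2[OF assms, of "(+)"] mean_comp2[OF assms, of "\<lambda>a b. a"] mean_comp2[OF assms, of "\<lambda>a b. b"]
  by (simp add: distrib_right sum.distrib)

lemma mean_mono:
  assumes "fin_range F" "fin_range H" "\<And>x. x \<in> \<Omega> \<Longrightarrow> F x \<le> H x"
  shows "mean F \<le> mean H"
proof -
  have "(\<Sum>p\<in>(\<lambda>x. (F x, H x)) ` \<Omega>. fst p * \<nu> {x \<in> \<Omega>. (F x, H x) = p})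
      \<le> (\<Sum>p\<in>(\<lambda>x. (F x, H x)) ` \<Omega>. snd p * \<nu> {x \<in> \<Omega>. (F x, H x) = p})"
    using assms(3) by (intro sum_mono mult_right_mono \<nu>_nonneg) auto
  then show ?thesis
    using mean_comp2[OF assms(1,2), of "\<lambda>a b. a"] mean_comp2[OF assms(1,2), of "\<lambda>a b. b"] by simp
qed

lemma mean_scale: "fin_range F \<Longrightarrow> mean (\<lambda>x. c * F x) = c * mean F"
proof -
  assume F: "fin_range F"
  show ?thesis
    unfolding mean_comp[OF F, of "\<lambda>a. c * a"] mean_def[of F] by (simp add: sum_distrib_left mult.assoc)
qed

lemma mean_const: "mean (\<lambda>_. c) = c"
proof -
  have "\<Omega> \<noteq> {}" using \<nu>_total \<nu>_add[of "{}" "{}"] by auto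
  then have "(\<lambda>_. c) ` \<Omega> = {c}" by auto
  then show ?thesis by (simp add: mean_def \<nu>_total)
qed

lemma mean_sum:
  assumes "\<And>i. i \<in> I \<Longrightarrow> fin_range (F i)"
  shows "mean (\<lambda>x. \<Sum>i\<in>I. F i x) = (\<Sum>i\<in>I. mean (F i))"
  using assms
proof (induction I rule: infinite_finite_induct)
  case (insert i I)
  then show ?case by (simp add: mean_add fin_range_sum)
qed (simp_all add: mean_const)

lemma mean_nonneg: "fin_range F \<Longrightarrow> (\<And>x. x \<in> \<Omega> \<Longrightarrow> 0 \<le> F x) \<Longrightarrow> 0 \<le> mean F"
  using mean_mono[OF fin_range_const[of 0], of F] by (simp add: mean_const)

lemma mean_cong: "(\<And>x. x \<in> \<Omega> \<Longrightarrow> F x = H x) \<Longrightarrow> mean F = mean H"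
proof -
  assume eq: "\<And>x. x \<in> \<Omega> \<Longrightarrow> F x = H x"
  then have "F ` \<Omega> = H ` \<Omega>" by (intro image_cong) auto
  moreover have "{x \<in> \<Omega>. F x = v} = {x \<in> \<Omega>. H x = v}" for v using eq by auto
  ultimately show ?thesis by (simp add: mean_def)
qed

lemma mean_shift:
  assumes "bij_betw \<tau> \<Omega> \<Omega>" and inv: "\<And>A. A \<subseteq> \<Omega> \<Longrightarrow> \<nu> (\<tau> ` A) = \<nu> A"
  shows "mean (\<lambda>x. F (\<tau> x)) = mean F"
proof -
  have "(\<lambda>x. F (\<tau> x)) ` \<Omega> = F ` \<Omega>"
    using bij_betw_imp_surj_on[OF assms(1)] by (metis image_image)
  moreover have "\<nu> {x \<in> \<Omega>. F (\<tau> x) = v} = \<nu> {x \<in> \<Omega>. F x = v}" for v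
  proof -
    have "\<tau> ` {x \<in> \<Omega>. F (\<tau> x) = v} = {x \<in> \<Omega>. F x = v}"
      using bij_betw_imp_surj_on[OF assms(1)] by auto
    then show ?thesis using inv[of "{x \<in> \<Omega>. F (\<tau> x) = v}"] by simp
  qed
  ultimately show ?thesis by (simp add: mean_def)
qed

end

context Group.group begin

text \<open>Inversion exchanges the two sides, so the image of a left invariant measure works. Right
  invariance is needed because the word metric is left invariant: the moves of length at most 1 take
  x to x s.\<close>

lemma amenable_right_invariant:
  assumes "amenable G"
  shows "\<exists>\<nu>. fin_add_prob (carrier G) \<nu> \<and>
    (\<forall>g\<in>carrier G. \<forall>A\<subseteq>carrier G. \<nu> ((\<lambda>x. x \<otimes> g) ` A) = \<nu> A)"
proof -
  define P where "P \<mu> \<longleftrightarrow> (\<forall>A. A \<subseteq> carrier G \<longrightarrow> \<mu> A \<ge> 0) \<and> \<mu> (carrier G) = 1 \<and>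
      (\<forall>A B. A \<subseteq> carrier G \<longrightarrow> B \<subseteq> carrier G \<longrightarrow> A \<inter> B = {} \<longrightarrow> \<mu> (A \<union> B) = \<mu> A + \<mu> B) \<and>
      (\<forall>g\<in>carrier G. \<forall>A. A \<subseteq> carrier G \<longrightarrow> \<mu> (g <# A) = \<mu> A)" for \<mu> :: "'a set \<Rightarrow> real"
  obtain \<mu> where "P \<mu>" using assms unfolding amenable_def P_def[symmetric] by blast
  then have nn: "A \<subseteq> carrier G \<Longrightarrow> \<mu> A \<ge> 0" and tot: "\<mu> (carrier G) = 1"
    and add: "A \<subseteq> carrier G \<Longrightarrow> B \<subseteq> carrier G \<Longrightarrow> A \<inter> B = {} \<Longrightarrow> \<mu> (A \<union> B) = \<mu> A + \<mu> B"
    and left: "g \<in> carrier G \<Longrightarrow> A \<subseteq> carrier G \<Longrightarrow> \<mu> (g <# A) = \<mu> A" for A B g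
    by (simp_all add: P_def)
  define \<nu> where "\<nu> A = \<mu> (m_inv G ` A)" for A
  have inv_carrier: "m_inv G ` carrier G = carrier G"
  proof (intro equalityI subsetI)
    fix x assume "x \<in> carrier G"
    then have "x = m_inv G (m_inv G x)" "m_inv G x \<in> carrier G" by simp_all
    then show "x \<in> m_inv G ` carrier G" by (rule image_eqI)
  qed auto
  have "fin_add_prob (carrier G) \<nu>"
  proof
    show "0 \<le> \<nu> A" if "A \<subseteq> carrier G" for A
      unfolding \<nu>_def using that by (intro nn) auto
    show "\<nu> (carrier G) = 1" by (simp add: \<nu>_def inv_carrier tot)
    fix A B assume AB: "A \<subseteq> carrier G" "B \<subseteq> carrier G" "A \<inter> B = {}"
    have "m_inv G ` A \<inter> m_inv G ` B = {}"
    proof -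
      have "m_inv G ` A \<inter> m_inv G ` B = m_inv G ` (A \<inter> B)"
        by (rule inj_on_image_Int[OF inv_inj AB(1,2), symmetric])
      then show ?thesis using AB by simp
    qed
    then show "\<nu> (A \<union> B) = \<nu> A + \<nu> B"
      unfolding \<nu>_def image_Un using AB by (intro add) auto
  qed
  moreover have "\<nu> ((\<lambda>x. x \<otimes> g) ` A) = \<nu> A" if "g \<in> carrier G" "A \<subseteq> carrier G" for g A
  proof -
    have "m_inv G ` (\<lambda>x. x \<otimes> g) ` A = inv g <# (m_inv G ` A)"
      unfolding l_coset_def UNION_singleton_eq_range image_image
      using that by (intro image_cong) (auto simp: inv_mult_group)
    then show ?thesis using that left[of "inv g" "m_inv G ` A"] by (auto simp: \<nu>_def)
  qed
  ultimately show ?thesis by blast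
qed

lemma finite_word_ball:
  assumes S: "finite_symmetric_generating_set G S"
  shows "finite {g \<in> carrier G. word_length G S g \<le> n}"
proof (rule finite_subset)
  show "{g \<in> carrier G. word_length G S g \<le> n}
      \<subseteq> (\<lambda>ws. foldr (\<otimes>) ws \<one>) ` {ws. set ws \<subseteq> S \<and> length ws \<le> n}"
  proof
    fix g assume "g \<in> {g \<in> carrier G. word_length G S g \<le> n}"
    then have "g \<in> carrier G" "word_length G S g \<le> n" by auto
    with word_of_minimal_length[OF S this(1)]
    show "g \<in> (\<lambda>ws. foldr (\<otimes>) ws \<one>) ` {ws. set ws \<subseteq> S \<and> length ws \<le> n}"
      by (metis (mono_tags, lifting) image_eqI mem_Collect_eq)
  qed
  show "finite ((\<lambda>ws. foldr (\<otimes>) ws \<one>) ` {ws. set ws \<subseteq> S \<and> length ws \<le> n})"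
    using S finite_lists_length_le by (auto simp: finite_symmetric_generating_set_def)
qed

end

section \<open>Word metrics with values in the natural numbers\<close>

locale word_group = Group.group G for G :: "('a, 'b) monoid_scheme" (structure) +
  fixes S :: "'a set"
  assumes S: "finite_symmetric_generating_set G S"
begin

abbreviation wlen :: "'a \<Rightarrow> nat" where "wlen \<equiv> word_length G S"

abbreviation wd :: "'a \<Rightarrow> 'a \<Rightarrow> nat" where "wd x y \<equiv> wlen (inv x \<otimes> y)"

lemma S_carrier: "S \<subseteq> carrier G" and S_inv: "s \<in> S \<Longrightarrow> inv s \<in> S" and S_finite: "finite S"
  using S by (simp_all add: finite_symmetric_generating_set_def)

lemma inv_mul_cancel_left: "x \<in> carrier G \<Longrightarrow> g \<in> carrier G \<Longrightarrow> inv x \<otimes> (x \<otimes> g) = g"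
  using m_assoc[of "inv x" x g] by simp

lemma mul_inv_cancel_left: "x \<in> carrier G \<Longrightarrow> g \<in> carrier G \<Longrightarrow> x \<otimes> (inv x \<otimes> g) = g"
  using m_assoc[of x "inv x" g] by simp

lemma wlen_S: "s \<in> S \<Longrightarrow> wlen s \<le> 1"
proof -
  assume s: "s \<in> S"
  then have "s \<in> carrier G" using S_carrier by blast
  then show ?thesis using word_length_le[of "[s]" S s] s by simp
qed

lemma wd_triangle:
  assumes "x \<in> carrier G" "y \<in> carrier G" "z \<in> carrier G"
  shows "wd x z \<le> wd x y + wd y z"
proof -
  have "(inv x \<otimes> y) \<otimes> (inv y \<otimes> z) = inv x \<otimes> z"
  proof -
    have "(inv x \<otimes> y) \<otimes> (inv y \<otimes> z) = inv x \<otimes> (y \<otimes> inv y) \<otimes> z"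
      using assms by (simp only: m_assoc m_closed inv_closed)
    then show ?thesis using assms by simp
  qed
  then show ?thesis
    using word_length_mult_le[OF S, of "inv x \<otimes> y" "inv y \<otimes> z"] assms by simp
qed

lemma wd_sym:
  assumes "x \<in> carrier G" "y \<in> carrier G"
  shows "wd x y = wd y x"
proof (rule antisym)
  have "inv (inv x \<otimes> y) = inv y \<otimes> x" "inv (inv y \<otimes> x) = inv x \<otimes> y"
    using assms by (simp_all add: inv_mult_group)
  then show "wd x y \<le> wd y x" "wd y x \<le> wd x y"
    using word_length_inv_le[OF S, of "inv x \<otimes> y"] word_length_inv_le[OF S, of "inv y \<otimes> x"] assms
    by simp_all
qed

lemma wd_mul_S:
  assumes "x \<in> carrier G" "s \<in> S"
  shows "wd x (x \<otimes> s) \<le> 1" "wd (x \<otimes> s) x \<le> 1"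
proof -
  have sG: "s \<in> carrier G" using assms S_carrier by blast
  have "inv x \<otimes> (x \<otimes> s) = s" by (rule inv_mul_cancel_left[OF assms(1) sG])
  then show "wd x (x \<otimes> s) \<le> 1" using wlen_S[OF assms(2)] by simp
  then show "wd (x \<otimes> s) x \<le> 1" using wd_sym[of x "x \<otimes> s"] assms sG by simp
qed

end

text \<open>A partition as in the definition of Assouad--Nagata dimension, at scale \<open>2R\<close>.\<close>

locale coloured_partition = word_group +
  fixes P :: "'a set set" and col :: "'a set \<Rightarrow> nat" and n R D :: nat
  assumes part: "partition_on (carrier G) P" and col: "A \<in> P \<Longrightarrow> col A \<le> n"
    and diam: "A \<in> P \<Longrightarrow> x \<in> A \<Longrightarrow> y \<in> A \<Longrightarrow> wd x y \<le> D"
    and disj: "A \<in> P \<Longrightarrow> A' \<in> P \<Longrightarrow> col A = col A' \<Longrightarrow> A \<noteq> A' \<Longrightarrow> x \<in> A \<Longrightarrow> y \<in> A' \<Longrightarrow> 2 * R < wd x y"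
    and R: "R \<ge> 1"
begin

definition base :: "'a set \<Rightarrow> 'a" where "base A = (SOME a. a \<in> A)"

definition dset :: "'a \<Rightarrow> 'a set \<Rightarrow> nat" where "dset x A = (LEAST k. \<exists>a\<in>A. wd x a = k)"

definition block :: "'a \<Rightarrow> 'a set" where "block x = (THE A. A \<in> P \<and> x \<in> A)"

lemma block_unique: "A \<in> P \<Longrightarrow> A' \<in> P \<Longrightarrow> x \<in> A \<Longrightarrow> x \<in> A' \<Longrightarrow> A = A'"
  using partition_onD2[OF part] disjointD[of P A A'] by blast

lemma block_eq: "A \<in> P \<Longrightarrow> x \<in> A \<Longrightarrow> block x = A"
  unfolding block_def by (rule the_equality, blast) (rule block_unique, blast+)

lemma block: "x \<in> carrier G \<Longrightarrow> block x \<in> P \<and> x \<in> block x"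
proof -
  assume "x \<in> carrier G"
  then obtain A where "A \<in> P" "x \<in> A" using partition_onD1[OF part] by blast
  then show ?thesis by (simp add: block_eq)
qed

lemma P_carrier: "A \<in> P \<Longrightarrow> A \<subseteq> carrier G"
  using part by (auto simp: partition_on_def)

lemma base_in: "A \<in> P \<Longrightarrow> base A \<in> A"
proof -
  assume "A \<in> P"
  then have "A \<noteq> {}" using part by (auto simp: partition_on_def)
  then show ?thesis by (simp add: base_def some_in_eq)
qed

lemma dset_attained: "A \<in> P \<Longrightarrow> \<exists>a\<in>A. wd x a = dset x A"
  unfolding dset_def by (rule LeastI_ex) (use base_in in blast)

lemma dset_le: "a \<in> A \<Longrightarrow> dset x A \<le> wd x a"
  unfolding dset_def by (rule Least_le) blast

lemma dset_step:
  assumes "x \<in> carrier G" "x' \<in> carrier G" "A \<in> P" "wd x' x \<le> 1"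
  shows "dset x' A \<le> dset x A + 1"
proof -
  obtain a where a: "a \<in> A" "wd x a = dset x A" using dset_attained[OF assms(3)] by blast
  have "dset x' A \<le> wd x' a" by (rule dset_le[OF a(1)])
  also have "\<dots> \<le> wd x' x + wd x a" using assms a P_carrier by (intro wd_triangle) auto
  finally show ?thesis using a assms by linarith
qed

text \<open>Each block is represented by its base point, which carries the bump of the block seen from \<open>x\<close>.\<close>

definition bump :: "'a \<Rightarrow> 'a \<Rightarrow> real" where
  "bump x y = (if y \<in> carrier G \<and> y = base (block y) then real (R - dset x (block y)) else 0)"

lemma bump_nonzero:
  assumes "bump x y \<noteq> 0"
  shows "y \<in> carrier G" "y = base (block y)" "dset x (block y) < R" "block y \<in> P"
proof -
  have y: "y \<in> carrier G \<and> y = base (block y)"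
    using assms unfolding bump_def by presburger
  then show "y \<in> carrier G" "y = base (block y)" by blast+
  show "dset x (block y) < R" using assms unfolding bump_def if_P[OF y] by simp
  show "block y \<in> P" using y block by blast
qed

lemma bump_range: "bump x y \<in> real ` {..R}"
  by (auto simp: bump_def)

lemma bump_supp:
  assumes "x \<in> carrier G" "bump x y \<noteq> 0"
  shows "wd x y \<le> R + D"
proof -
  note y = bump_nonzero[OF assms(2)]
  obtain a where a: "a \<in> block y" "wd x a = dset x (block y)" using dset_attained[OF y(4)] by blast
  have "wd x y \<le> wd x a + wd a y"
    using assms y a P_carrier[OF y(4)] by (intro wd_triangle) auto
  also have "wd a y \<le> D" using diam[OF y(4) a(1)] block[OF y(1)] by blast
  finally show ?thesis using a y(3) by linarith
qed

lemma bump_total: "x \<in> carrier G \<Longrightarrow> bump x (base (block x)) = R"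
proof -
  assume x: "x \<in> carrier G"
  let ?y = "base (block x)"
  have A: "block x \<in> P" "x \<in> block x" using block[OF x] by auto
  have y: "?y \<in> block x" "?y \<in> carrier G" using base_in[OF A(1)] P_carrier[OF A(1)] by auto
  have "block ?y = block x" by (rule block_eq[OF A(1) y(1)])
  moreover have "dset x (block x) \<le> wd x x" by (rule dset_le[OF A(2)])
  moreover have "wd x x = 0" using word_length_eq_0_iff[OF S, of "inv x \<otimes> x"] x by simp
  ultimately show ?thesis using y by (simp add: bump_def)
qed

text \<open>Distinct nearby blocks have distinct colours.\<close>

lemma bump_card:
  assumes x: "x \<in> carrier G"
  shows "finite {y. bump x y \<noteq> 0}" "card {y. bump x y \<noteq> 0} \<le> n + 1"
proof -
  let ?Y = "{y. bump x y \<noteq> 0}" and ?c = "\<lambda>y. col (block y)"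
  have inj: "inj_on ?c ?Y"
  proof (rule inj_onI)
    fix y y' assume "y \<in> ?Y" "y' \<in> ?Y" and eq: "?c y = ?c y'"
    then have y: "bump x y \<noteq> 0" "bump x y' \<noteq> 0" by auto
    note b = bump_nonzero[OF y(1)] and b' = bump_nonzero[OF y(2)]
    obtain a where a: "a \<in> block y" "wd x a = dset x (block y)" using dset_attained[OF b(4)] by blast
    obtain a' where a': "a' \<in> block y'" "wd x a' = dset x (block y')" using dset_attained[OF b'(4)] by blast
    have c: "a \<in> carrier G" "a' \<in> carrier G" using a a' P_carrier b(4) b'(4) by blast+
    have "wd a a' \<le> wd a x + wd x a'" using x c by (intro wd_triangle)
    then have "wd a a' < 2 * R" using wd_sym[of a x] x c a a' b(3) b'(3) by simp
    then have "block y = block y'" using disj[OF b(4) b'(4) eq _ a(1) a'(1)] by force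
    then show "y = y'" using b(2) b'(2) by simp
  qed
  have sub: "?c ` ?Y \<subseteq> {..n}" using bump_nonzero(4) col by auto
  show "finite ?Y" using inj_on_finite[OF inj sub] by simp
  show "card ?Y \<le> n + 1" using card_inj_on_le[OF inj sub] by simp
qed

lemma bump_step:
  assumes "x \<in> carrier G" "x' \<in> carrier G" "wd x x' \<le> 1" "wd x' x \<le> 1"
  shows "\<bar>bump x' y - bump x y\<bar> \<le> 1"
proof (cases "y \<in> carrier G \<and> y = base (block y)")
  case True
  then have A: "block y \<in> P" using block by blast
  have "dset x' (block y) \<le> dset x (block y) + 1" "dset x (block y) \<le> dset x' (block y) + 1"
    using dset_step assms A by blast+
  then have "R - dset x' (block y) \<le> (R - dset x (block y)) + 1"
    "R - dset x (block y) \<le> (R - dset x' (block y)) + 1" by linarith+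
  then have "real (R - dset x' (block y)) \<le> real ((R - dset x (block y)) + 1)"
    "real (R - dset x (block y)) \<le> real ((R - dset x' (block y)) + 1)" by (simp_all only: of_nat_le_iff)
  then show ?thesis using True by (simp add: bump_def)
next
  case False
  then show ?thesis unfolding bump_def if_not_P[OF False] by simp
qed

lemma bump_grad:
  assumes "x \<in> carrier G" "x' \<in> carrier G" "wd x x' \<le> 1" "wd x' x \<le> 1" "finite B"
  shows "(\<Sum>y\<in>B. (bump x' y - bump x y)\<^sup>2) \<le> 2 * (real n + 1)"
proof -
  let ?Y = "{y. bump x y \<noteq> 0} \<union> {y. bump x' y \<noteq> 0}"
  have Y: "finite ?Y" using bump_card(1)[OF assms(1)] bump_card(1)[OF assms(2)] by simp
  have "(\<Sum>y\<in>B. (bump x' y - bump x y)\<^sup>2) = (\<Sum>y\<in>B \<inter> ?Y. (bump x' y - bump x y)\<^sup>2)"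
    using assms(5) by (intro sum.mono_neutral_right) auto
  also have "\<dots> \<le> (\<Sum>y\<in>B \<inter> ?Y. 1)"
    using bump_step[OF assms(1-4)] by (intro sum_mono) (simp add: abs_square_le_1)
  also have "\<dots> = real (card (B \<inter> ?Y))" by simp
  finally have le: "(\<Sum>y\<in>B. (bump x' y - bump x y)\<^sup>2) \<le> real (card (B \<inter> ?Y))" .
  have "card (B \<inter> ?Y) \<le> card ?Y" using Y by (rule card_mono) simp
  also have "card ?Y \<le> (n + 1) + (n + 1)"
    by (rule order_trans[OF card_Un_le add_mono[OF bump_card(2)[OF assms(1)] bump_card(2)[OF assms(2)]]])
  finally have "card (B \<inter> ?Y) \<le> 2 * (n + 1)" by simp
  then have "real (card (B \<inter> ?Y)) \<le> real (2 * (n + 1))" by (simp only: of_nat_le_iff)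
  then show ?thesis using le by simp
qed

text \<open>Average over \<open>x\<close> the squares of \<open>g \<mapsto> bump x (x g)\<close>. By right invariance of the mean, a
  translation of \<open>g\<close> becomes a unit move of \<open>x\<close>, which changes at most \<open>2(n + 1)\<close> bumps by at most 1.\<close>

lemma controlled_function:
  assumes am: "amenable G"
  shows "\<exists>f :: 'a \<Rightarrow> real. (\<forall>g. 0 \<le> f g) \<and> (\<forall>g. f g \<noteq> 0 \<longrightarrow> g \<in> carrier G \<and> wlen g \<le> R + D) \<and>
    (\<Sum>g | f g \<noteq> 0. f g) = 1 \<and>
    (\<forall>s\<in>S. \<forall>c t B. t > 0 \<longrightarrow> finite B \<longrightarrow> B \<subseteq> carrier G \<longrightarrow>
       (\<Sum>g\<in>B. \<bar>f (inv s \<otimes> g) - f g\<bar> * \<bar>c g\<bar>)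
         \<le> (real n + 1) * (t / (real R)\<^sup>2) + (\<Sum>g\<in>B. (c g)\<^sup>2 * (f g + f (inv s \<otimes> g))) / t)"
proof -
  obtain \<nu> where \<nu>: "fin_add_prob (carrier G) \<nu>"
    and \<nu>_shift: "\<forall>g\<in>carrier G. \<forall>A\<subseteq>carrier G. \<nu> ((\<lambda>x. x \<otimes> g) ` A) = \<nu> A"
    using amenable_right_invariant[OF am] by (elim exE conjE)
  have \<nu>_inv: "\<nu> ((\<lambda>x. x \<otimes> g) ` A) = \<nu> A" if "g \<in> carrier G" "A \<subseteq> carrier G" for g A
    by (rule \<nu>_shift[rule_format, OF that])
  interpret fin_add_prob "carrier G" \<nu> by (rule \<nu>)
  have fr: "fin_range (\<lambda>x. bump (\<sigma> x) (\<tau> x))" for \<sigma> \<tau>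
    unfolding fin_range_def
    by (rule finite_subset[OF image_subsetI[OF bump_range]]) simp
  have fr2: "fin_range (\<lambda>x. (bump (\<sigma> x) (\<tau> x))\<^sup>2)" for \<sigma> \<tau>
    by (rule fin_range_comp[OF fr])
  \<comment> \<open>\<open>g\<close> is the position, relative to \<open>x\<close>, of the base
    point that carries the bump.\<close>
  define h where "h g = (if g \<in> carrier G then mean (\<lambda>x. (bump x (x \<otimes> g))\<^sup>2) else 0)" for g
  have h_nonneg: "0 \<le> h g" for g
    unfolding h_def using fr2 by (auto intro: mean_nonneg)
  have h_supp: "g \<in> carrier G \<and> wlen g \<le> R + D" if "h g \<noteq> 0" for g
  proof -
    have g: "g \<in> carrier G" using that by (auto simp: h_def split: if_splits)
    have "\<exists>x\<in>carrier G. bump x (x \<otimes> g) \<noteq> 0"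
    proof (rule ccontr)
      assume "\<not> ?thesis"
      then have "mean (\<lambda>x. (bump x (x \<otimes> g))\<^sup>2) = mean (\<lambda>_. 0)" by (intro mean_cong) simp
      then show False using that g by (simp add: h_def mean_const)
    qed
    then obtain x where x: "x \<in> carrier G" "bump x (x \<otimes> g) \<noteq> 0" by blast
    have "inv x \<otimes> (x \<otimes> g) = g" by (rule inv_mul_cancel_left[OF x(1) g])
    then show ?thesis using bump_supp[OF x] g by simp
  qed
  let ?W = "{g \<in> carrier G. wlen g \<le> R + D}"
  have W: "finite ?W" by (rule finite_word_ball[OF S])
  define Z where "Z = (\<Sum>g\<in>?W. h g)"
  \<comment> \<open>The block containing \<open>x\<close> alone contributes the square of the full
    height \<open>R\<close>. Dividing by \<open>Z\<close> later yields the factor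
    \<open>1 / R\<^sup>2\<close>.\<close>
  have "(real R)\<^sup>2 \<le> Z"
  proof -
    have "mean (\<lambda>_. (real R)\<^sup>2) \<le> mean (\<lambda>x. \<Sum>g\<in>?W. (bump x (x \<otimes> g))\<^sup>2)"
    proof (rule mean_mono[OF fin_range_const fin_range_sum[OF fr2]])
      fix x assume x: "x \<in> carrier G"
      define g where "g = inv x \<otimes> base (block x)"
      have b: "base (block x) \<in> carrier G" using block[OF x] base_in P_carrier by blast
      have xg: "x \<otimes> g = base (block x)" using x b by (simp add: g_def mul_inv_cancel_left)
      have "bump x (x \<otimes> g) \<noteq> 0" using bump_total[OF x] R by (simp add: xg)
      then have "g \<in> ?W" using bump_supp[OF x, of "x \<otimes> g"] x b by (simp add: xg) (simp add: g_def)
      then have "(bump x (x \<otimes> g))\<^sup>2 \<le> (\<Sum>g\<in>?W. (bump x (x \<otimes> g))\<^sup>2)"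
        using W by (intro member_le_sum) auto
      then show "(real R)\<^sup>2 \<le> (\<Sum>g\<in>?W. (bump x (x \<otimes> g))\<^sup>2)" by (simp add: xg bump_total[OF x])
    qed
    also have "\<dots> = (\<Sum>g\<in>?W. mean (\<lambda>x. (bump x (x \<otimes> g))\<^sup>2))" by (rule mean_sum[OF fr2])
    also have "\<dots> = Z" unfolding Z_def by (intro sum.cong) (auto simp: h_def)
    finally show ?thesis by (simp add: mean_const)
  qed
  then have Z: "Z > 0" "(real R)\<^sup>2 \<le> Z" using R by (auto intro: less_le_trans[of 0 "(real R)\<^sup>2"])
  have grad: "(\<Sum>g\<in>B. \<bar>h (inv s \<otimes> g) - h g\<bar> * \<bar>c g\<bar>)
      \<le> (real n + 1) * t + (\<Sum>g\<in>B. (c g)\<^sup>2 * (h g + h (inv s \<otimes> g))) / t"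
    if s: "s \<in> S" and t: "t > 0" and B: "finite B" "B \<subseteq> carrier G" for s c t B
  proof -
    have sG: "s \<in> carrier G" using s S_carrier by blast
    have shift: "h (inv s \<otimes> g) = mean (\<lambda>x. (bump (x \<otimes> s) (x \<otimes> g))\<^sup>2)" if g: "g \<in> carrier G" for g
    proof -
      have "h (inv s \<otimes> g) = mean (\<lambda>x. (bump x (x \<otimes> (inv s \<otimes> g)))\<^sup>2)" using g sG by (simp add: h_def)
      also have "\<dots> = mean (\<lambda>x. (bump (x \<otimes> s) (x \<otimes> s \<otimes> (inv s \<otimes> g)))\<^sup>2)"
      proof (rule mean_shift[symmetric, of "\<lambda>x. x \<otimes> s" "\<lambda>x. (bump x (x \<otimes> (inv s \<otimes> g)))\<^sup>2"])
        show "bij_betw (\<lambda>x. x \<otimes> s) (carrier G) (carrier G)"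
          by (rule bij_betwI[of _ _ _ "\<lambda>x. x \<otimes> inv s"]) (use sG in \<open>auto simp: m_assoc\<close>)
        show "\<nu> ((\<lambda>x. x \<otimes> s) ` A) = \<nu> A" if "A \<subseteq> carrier G" for A
          by (rule \<nu>_inv[OF sG that])
      qed
      also have "\<dots> = mean (\<lambda>x. (bump (x \<otimes> s) (x \<otimes> g))\<^sup>2)"
      proof (rule mean_cong)
        fix x assume x: "x \<in> carrier G"
        have "x \<otimes> s \<otimes> (inv s \<otimes> g) = x \<otimes> (s \<otimes> inv s) \<otimes> g"
          using x sG g by (simp only: m_assoc m_closed inv_closed)
        then show "(bump (x \<otimes> s) (x \<otimes> s \<otimes> (inv s \<otimes> g)))\<^sup>2 = (bump (x \<otimes> s) (x \<otimes> g))\<^sup>2"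
          using x sG g by simp
      qed
      finally show ?thesis .
    qed
    let ?a = "\<lambda>g x. bump x (x \<otimes> g)" and ?b = "\<lambda>g x. bump (x \<otimes> s) (x \<otimes> g)"
    have pointwise: "\<bar>h (inv s \<otimes> g) - h g\<bar> * \<bar>c g\<bar>
        \<le> t / 2 * mean (\<lambda>x. (?b g x - ?a g x)\<^sup>2) + (c g)\<^sup>2 / t * (h g + h (inv s \<otimes> g))"
      if g: "g \<in> B" for g
    proof -
      have gG: "g \<in> carrier G" using g B by blast
      have frd: "fin_range (\<lambda>x. (?b g x - ?a g x)\<^sup>2)"
        using fin_range_comp2[OF fr fr, of "\<lambda>u v. (u - v)\<^sup>2"] by simp
      have frs: "fin_range (\<lambda>x. (?a g x)\<^sup>2 + (?b g x)\<^sup>2)"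
        using fin_range_comp2[OF fr2 fr2, of "\<lambda>u v. u + v"] by simp
      let ?M = "\<lambda>x. t / 2 * (?b g x - ?a g x)\<^sup>2 + (c g)\<^sup>2 / t * ((?a g x)\<^sup>2 + (?b g x)\<^sup>2)"
      have M: "mean ?M = t / 2 * mean (\<lambda>x. (?b g x - ?a g x)\<^sup>2) + (c g)\<^sup>2 / t * (h g + h (inv s \<otimes> g))"
      proof -
        have "mean ?M = mean (\<lambda>x. t / 2 * (?b g x - ?a g x)\<^sup>2)
            + mean (\<lambda>x. (c g)\<^sup>2 / t * ((?a g x)\<^sup>2 + (?b g x)\<^sup>2))"
          by (rule mean_add[OF fin_range_comp[OF frd] fin_range_comp[OF frs]])
        also have "\<dots> = t / 2 * mean (\<lambda>x. (?b g x - ?a g x)\<^sup>2)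
            + (c g)\<^sup>2 / t * mean (\<lambda>x. (?a g x)\<^sup>2 + (?b g x)\<^sup>2)"
          by (simp only: mean_scale[OF frd] mean_scale[OF frs])
        also have "mean (\<lambda>x. (?a g x)\<^sup>2 + (?b g x)\<^sup>2) = mean (\<lambda>x. (?a g x)\<^sup>2) + mean (\<lambda>x. (?b g x)\<^sup>2)"
          by (rule mean_add[OF fr2 fr2])
        also have "\<dots> = h g + h (inv s \<otimes> g)"
          unfolding shift[OF gG] using gG by (simp add: h_def)
        finally show ?thesis .
      qed
      have frM: "fin_range ?M"
        using fin_range_comp2[OF frd frs, of "\<lambda>u v. t / 2 * u + (c g)\<^sup>2 / t * v"] by simp
      \<comment> \<open>The two signs \<open>\<kappa>\<close> cover both directions of the absolute
        value. The difference of squares is p q, and the square of t p - \<open>\<kappa>\<close> |c|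
        q being nonnegative separates the gradient p from the mass q.\<close>
      have le: "\<kappa> * \<bar>c g\<bar> * ((?b g x)\<^sup>2 - (?a g x)\<^sup>2) \<le> ?M x" if "\<kappa> = 1 \<or> \<kappa> = -1" for \<kappa> x
      proof -
        let ?p = "?b g x - ?a g x" and ?q = "?b g x + ?a g x"
        have "0 \<le> (t * ?p - \<kappa> * \<bar>c g\<bar> * ?q)\<^sup>2" by simp
        also have "\<dots> = t\<^sup>2 * ?p\<^sup>2 - 2 * t * (\<kappa> * \<bar>c g\<bar> * (?p * ?q)) + \<kappa>\<^sup>2 * (c g)\<^sup>2 * ?q\<^sup>2"
          by (simp add: power2_eq_square algebra_simps)
        finally have "2 * t * (\<kappa> * \<bar>c g\<bar> * (?p * ?q)) \<le> t\<^sup>2 * ?p\<^sup>2 + (c g)\<^sup>2 * ?q\<^sup>2"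
          using that by auto
        also have "\<dots> \<le> t\<^sup>2 * ?p\<^sup>2 + (c g)\<^sup>2 * (2 * ((?a g x)\<^sup>2 + (?b g x)\<^sup>2))"
        proof (intro add_left_mono mult_left_mono)
          have "0 \<le> ?p\<^sup>2" by simp
          then show "?q\<^sup>2 \<le> 2 * ((?a g x)\<^sup>2 + (?b g x)\<^sup>2)" by (simp add: power2_eq_square algebra_simps)
        qed simp
        also have "\<dots> = 2 * t * ?M x" using t by (simp add: field_simps power2_eq_square)
        finally have "\<kappa> * \<bar>c g\<bar> * (?p * ?q) \<le> ?M x" using t by (simp add: mult_le_cancel_left_pos)
        moreover have "?p * ?q = (?b g x)\<^sup>2 - (?a g x)\<^sup>2" by (simp add: power2_eq_square algebra_simps)
        ultimately show ?thesis by simp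
      qed
      have "\<kappa> * \<bar>c g\<bar> * (h (inv s \<otimes> g) - h g) \<le> mean ?M" if \<kappa>: "\<kappa> = 1 \<or> \<kappa> = -1" for \<kappa>
      proof -
        have "mean (\<lambda>x. \<kappa> * \<bar>c g\<bar> * (?b g x)\<^sup>2 + (- (\<kappa> * \<bar>c g\<bar>)) * (?a g x)\<^sup>2) \<le> mean ?M"
        proof (rule mean_mono[OF _ frM])
          show "fin_range (\<lambda>x. \<kappa> * \<bar>c g\<bar> * (?b g x)\<^sup>2 + (- (\<kappa> * \<bar>c g\<bar>)) * (?a g x)\<^sup>2)"
            using fin_range_comp2[OF fr2 fr2, of "\<lambda>u v. \<kappa> * \<bar>c g\<bar> * u + (- (\<kappa> * \<bar>c g\<bar>)) * v"] .
          show "\<kappa> * \<bar>c g\<bar> * (?b g x)\<^sup>2 + (- (\<kappa> * \<bar>c g\<bar>)) * (?a g x)\<^sup>2 \<le> ?M x" for x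
            using le[OF \<kappa>, of x] by (simp add: right_diff_distrib)
        qed
        also have "mean (\<lambda>x. \<kappa> * \<bar>c g\<bar> * (?b g x)\<^sup>2 + (- (\<kappa> * \<bar>c g\<bar>)) * (?a g x)\<^sup>2)
            = mean (\<lambda>x. \<kappa> * \<bar>c g\<bar> * (?b g x)\<^sup>2) + mean (\<lambda>x. (- (\<kappa> * \<bar>c g\<bar>)) * (?a g x)\<^sup>2)"
          by (rule mean_add[OF fin_range_comp[OF fr2] fin_range_comp[OF fr2]])
        also have "\<dots> = \<kappa> * \<bar>c g\<bar> * h (inv s \<otimes> g) + (- (\<kappa> * \<bar>c g\<bar>)) * h g"
          unfolding mean_scale[OF fr2] shift[OF gG] using gG by (simp add: h_def)
        finally show ?thesis by (simp add: right_diff_distrib)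
      qed
      from this[of 1] this[of "-1"] show ?thesis
        unfolding M by (auto simp: abs_if algebra_simps split: if_splits)
    qed
    have le1: "(\<Sum>g\<in>B. \<bar>h (inv s \<otimes> g) - h g\<bar> * \<bar>c g\<bar>)
        \<le> t / 2 * (\<Sum>g\<in>B. mean (\<lambda>x. (?b g x - ?a g x)\<^sup>2)) + (\<Sum>g\<in>B. (c g)\<^sup>2 * (h g + h (inv s \<otimes> g))) / t"
      using sum_mono[OF pointwise] by (simp add: sum.distrib sum_distrib_left sum_divide_distrib)
    have le2: "(\<Sum>g\<in>B. mean (\<lambda>x. (?b g x - ?a g x)\<^sup>2)) \<le> 2 * (real n + 1)"
    proof -
      have frd: "fin_range (\<lambda>x. (?b g x - ?a g x)\<^sup>2)" for g
        using fin_range_comp2[OF fr fr, of "\<lambda>u v. (u - v)\<^sup>2"] by simp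
      have "(\<Sum>g\<in>B. mean (\<lambda>x. (?b g x - ?a g x)\<^sup>2)) = mean (\<lambda>x. \<Sum>g\<in>B. (?b g x - ?a g x)\<^sup>2)"
        by (rule mean_sum[OF frd, symmetric])
      also have "\<dots> \<le> mean (\<lambda>_. 2 * (real n + 1))"
      proof (rule mean_mono[OF fin_range_sum[OF frd] fin_range_const])
        fix x assume x: "x \<in> carrier G"
        \<comment> \<open>Substituting y = x g turns the sum over \<open>g\<close> into a sum over
          bumps, compared at \<open>x\<close> and at its neighbour
          \<open>x \<otimes> s\<close>.\<close>
        have "(\<Sum>g\<in>B. (?b g x - ?a g x)\<^sup>2) = (\<Sum>y\<in>(\<lambda>g. x \<otimes> g) ` B. (bump (x \<otimes> s) y - bump x y)\<^sup>2)"
          by (simp add: sum.reindex[OF inj_on_subset[OF inj_on_cmult[OF x] B(2)]])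
        also have "\<dots> \<le> 2 * (real n + 1)"
          using B x sG wd_mul_S[OF x s] by (intro bump_grad) auto
        finally show "(\<Sum>g\<in>B. (?b g x - ?a g x)\<^sup>2) \<le> 2 * (real n + 1)" .
      qed
      finally show ?thesis by (simp add: mean_const)
    qed
    have "t / 2 * (\<Sum>g\<in>B. mean (\<lambda>x. (?b g x - ?a g x)\<^sup>2)) \<le> t / 2 * (2 * (real n + 1))"
      using t by (intro mult_left_mono[OF le2]) simp
    also have "\<dots> = (real n + 1) * t" by simp
    finally show ?thesis using le1 by linarith
  qed
  define f where "f g = h g / Z" for g
  have f0: "f g \<noteq> 0 \<longleftrightarrow> h g \<noteq> 0" for g using Z(1) by (simp add: f_def)
  have "(\<Sum>g | f g \<noteq> 0. f g) = (\<Sum>g\<in>?W. f g)"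
    using h_supp W f0 by (intro sum.mono_neutral_left) auto
  also have "\<dots> = 1" using Z(1) by (simp add: f_def Z_def flip: sum_divide_distrib)
  finally have f1: "(\<Sum>g | f g \<noteq> 0. f g) = 1" .
  have "(\<Sum>g\<in>B. \<bar>f (inv s \<otimes> g) - f g\<bar> * \<bar>c g\<bar>)
         \<le> (real n + 1) * (t / (real R)\<^sup>2) + (\<Sum>g\<in>B. (c g)\<^sup>2 * (f g + f (inv s \<otimes> g))) / t"
    if "s \<in> S" "t > 0" "finite B" "B \<subseteq> carrier G" for s c t B
  proof -
    have "(\<Sum>g\<in>B. \<bar>f (inv s \<otimes> g) - f g\<bar> * \<bar>c g\<bar>) = (\<Sum>g\<in>B. \<bar>h (inv s \<otimes> g) - h g\<bar> * \<bar>c g\<bar>) / Z"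
      using Z(1) unfolding sum_divide_distrib f_def diff_divide_distrib[symmetric]
      by (intro sum.cong) (simp_all add: abs_divide)
    also have "\<dots> \<le> ((real n + 1) * t + (\<Sum>g\<in>B. (c g)\<^sup>2 * (h g + h (inv s \<otimes> g))) / t) / Z"
      using Z(1) by (intro divide_right_mono grad that) simp
    also have "\<dots> = (real n + 1) * (t / Z) + (\<Sum>g\<in>B. (c g)\<^sup>2 * (f g + f (inv s \<otimes> g))) / t"
      by (simp add: f_def add_divide_distrib[symmetric] sum_divide_distrib[symmetric])
        (simp add: add_divide_distrib mult.commute)
    also have "\<dots> \<le> (real n + 1) * (t / (real R)\<^sup>2) + (\<Sum>g\<in>B. (c g)\<^sup>2 * (f g + f (inv s \<otimes> g))) / t"
      using Z R that(2) by (intro add_right_mono mult_left_mono divide_left_mono) auto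
    finally show ?thesis .
  qed
  moreover have "0 \<le> f g" for g using h_nonneg Z(1) by (simp add: f_def)
  ultimately show ?thesis using f1 h_supp f0 by (intro exI[of _ f]) blast
qed

end

section \<open>Simple groups of finite Assouad--Nagata dimension\<close>

lemma AN_dim_at_most_of_finite:
  assumes "AN_dim M d < \<infinity>" shows "\<exists>n. AN_dim_at_most M d n"
proof (rule ccontr)
  assume "\<not> ?thesis"
  then have "AN_dim M d = \<infinity>" by (simp add: AN_dim_def top_enat_def)
  with assms show False by simp
qed

context word_group begin

text \<open>The definition is applied at r = 2R: this exceeds 1, and it separates the
  R-neighbourhoods of blocks of equal colour, where bumps of height \<open>R\<close> live. Word
  distances are integers, so the diameter bound may be rounded down.\<close>

lemma coloured_partitions_exist:
  assumes "AN_dim (carrier G) (word_dist G S) < \<infinity>"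
  shows "\<exists>n. \<exists>K\<ge>1. \<forall>R\<ge>1. \<exists>P col. coloured_partition G S P col n R (nat \<lfloor>K * (2 * real R)\<rfloor>)"
proof -
  obtain n where "AN_dim_at_most (carrier G) (word_dist G S) n"
    using AN_dim_at_most_of_finite[OF assms] by blast
  then obtain K where K: "K \<ge> 1"
    and part: "\<forall>r>1. \<exists>P (c :: 'a set \<Rightarrow> nat). partition_on (carrier G) P \<and> c ` P \<subseteq> {..n} \<and>
      (\<forall>A\<in>P. \<forall>x\<in>A. \<forall>y\<in>A. word_dist G S x y \<le> K * r) \<and>
      (\<forall>i\<le>n. r_disjoint (word_dist G S) r {A \<in> P. c A = i})"
    unfolding AN_dim_at_most_def by blast
  have "\<exists>P col. coloured_partition G S P col n R (nat \<lfloor>K * (2 * real R)\<rfloor>)" if R: "R \<ge> 1" for R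
  proof -
    have "2 * real R > 1" using R by simp
    from part[rule_format, OF this] obtain P and c :: "'a set \<Rightarrow> nat"
      where P: "partition_on (carrier G) P" "c ` P \<subseteq> {..n}"
        and diam: "\<forall>A\<in>P. \<forall>x\<in>A. \<forall>y\<in>A. word_dist G S x y \<le> K * (2 * real R)"
        and disj: "\<forall>i\<le>n. r_disjoint (word_dist G S) (2 * real R) {A \<in> P. c A = i}"
      by (elim exE conjE)
    have "coloured_partition G S P c n R (nat \<lfloor>K * (2 * real R)\<rfloor>)"
    proof
      show "partition_on (carrier G) P" by (rule P(1))
      show "c A \<le> n" if "A \<in> P" for A using P(2) that by blast
      show "wd x y \<le> nat \<lfloor>K * (2 * real R)\<rfloor>" if "A \<in> P" "x \<in> A" "y \<in> A" for A x y
        using diam that by (intro le_nat_floor) (auto simp: word_dist_def)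
      show "2 * R < wd x y"
        if A: "A \<in> P" "A' \<in> P" "c A = c A'" "A \<noteq> A'" and xy: "x \<in> A" "y \<in> A'" for A A' x y
      proof -
        have "c A \<le> n" using P(2) A(1) by blast
        then have "2 * real R < set_distance (word_dist G S) A A'"
          using disj A unfolding r_disjoint_def by auto
        also have "\<dots> \<le> word_dist G S x y"
          unfolding set_distance_def
          by (rule order_trans[OF cINF_lower[of _ "A \<times> A'" "(x, y)"]])
            (use xy in \<open>auto intro!: bdd_belowI[of _ 0] simp: word_dist_def\<close>)
        finally have "real (2 * R) < real (wd x y)" by (simp add: word_dist_def)
        then show ?thesis by (simp only: of_nat_less_iff)
      qed
      show "R \<ge> 1" by (rule R)
    qed
    then show ?thesis by blast
  qed
  then show ?thesis using K by blast
qed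

lemma countable_carrier: "countable (carrier G)"
proof -
  have "carrier G = (\<Union>n. {g \<in> carrier G. wlen g \<le> n})" by auto
  also have "countable \<dots>"
    using finite_word_ball[OF S] by (intro countable_UN) (auto intro: countable_finite)
  finally show ?thesis .
qed

text \<open>An infinite finitely generated group is transported to the type of natural numbers,
  so that the analysis takes place on a full type.\<close>

lemma not_simple_of_finite_AN_dim:
  assumes inf: "infinite (carrier G)" and am: "amenable G"
    and dim: "AN_dim (carrier G) (word_dist G S) < \<infinity>"
  shows "\<not> is_simple G"
proof -
  obtain h :: "nat \<Rightarrow> 'a" where h: "bij_betw h UNIV (carrier G)"
    using bij_betw_from_nat_into[OF countable_carrier inf] by blast
  define k where "k = inv_into UNIV h"
  have h_carrier [simp]: "h a \<in> carrier G" for a using h by (auto simp: bij_betw_def)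
  have hk [simp]: "h (k g) = g" if "g \<in> carrier G" for g
    using bij_betw_inv_into_right[OF h that] by (simp add: k_def)
  have kh [simp]: "k (h a) = a" for a
    using bij_betw_inv_into_left[OF h] by (simp add: k_def)
  have inj_h: "inj_on h A" for A using h by (auto simp: bij_betw_def intro: inj_on_subset)
  define mul where "mul a b = k (h a \<otimes> h b)" for a b
  define iv where "iv a = k (inv (h a))" for a
  define S' where "S' = k ` S"
  have fold: "foldr mul (map k ws) (k \<one>) = k (foldr (\<otimes>) ws \<one>)" if "set ws \<subseteq> carrier G" for ws
    using that by (induction ws) (simp_all add: mul_def foldr_mult_closed)
  interpret N: fg_group mul "k \<one>" iv S' "\<lambda>a. wlen (h a)"
  proof
    show "mul (mul a b) c = mul a (mul b c)" for a b c by (simp add: mul_def m_assoc)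
    show "mul (k \<one>) a = a" for a by (simp add: mul_def)
    show "mul (iv a) a = k \<one>" for a by (simp add: mul_def iv_def)
    show "finite S'" using S_finite by (simp add: S'_def)
    show "iv s \<in> S'" if "s \<in> S'" for s
    proof -
      from that obtain s0 where s0: "s0 \<in> S" "s = k s0" unfolding S'_def by blast
      then have "s0 \<in> carrier G" using S_carrier by blast
      then show ?thesis using s0 S_inv[OF s0(1)] by (simp add: iv_def S'_def)
    qed
    show "\<exists>ws. set ws \<subseteq> S' \<and> length ws = wlen (h x) \<and> foldr mul ws (k \<one>) = x" for x
    proof -
      obtain ws where ws: "set ws \<subseteq> S" "foldr (\<otimes>) ws \<one> = h x" "length ws = wlen (h x)"
        using word_of_minimal_length[OF S h_carrier] .
      then show ?thesis
        using fold[of ws] S_carrier by (intro exI[of _ "map k ws"]) (auto simp: S'_def)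
    qed
    show "infinite (UNIV :: nat set)" by (rule infinite_UNIV_nat)
  qed
  obtain n K where K: "K \<ge> 1"
    and part: "\<forall>R\<ge>1. \<exists>P col. coloured_partition G S P col n R (nat \<lfloor>K * (2 * real R)\<rfloor>)"
    using coloured_partitions_exist[OF dim] by blast
  \<comment> \<open>\<open>n + 1\<close> serves the gradient estimate and \<open>1 + 2 * K\<close>
    the support radius R + 2KR; \<open>C\<close> being at least 1 lets the same constant stand
    before the second gradient term.\<close>
  define C where "C = real n + 1 + 2 * K"
  have C: "C > 0" "C \<ge> real n + 1" "C \<ge> 1" using K by (simp_all add: C_def)
  have weight: "\<exists>f. N.controlled_weight C R f" if R: "R \<ge> 1" for R
  proof -
    let ?D = "nat \<lfloor>K * (2 * real R)\<rfloor>"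
    obtain P col where "coloured_partition G S P col n R ?D"
      using part R by blast
    from coloured_partition.controlled_function[OF this am] obtain f :: "'a \<Rightarrow> real"
      where f0: "\<forall>g. 0 \<le> f g" and supp: "\<forall>g. f g \<noteq> 0 \<longrightarrow> g \<in> carrier G \<and> wlen g \<le> R + ?D"
        and total: "(\<Sum>g | f g \<noteq> 0. f g) = 1"
        and grad: "\<forall>s\<in>S. \<forall>c t B. t > 0 \<longrightarrow> finite B \<longrightarrow> B \<subseteq> carrier G \<longrightarrow>
          (\<Sum>g\<in>B. \<bar>f (inv s \<otimes> g) - f g\<bar> * \<bar>c g\<bar>)
            \<le> (real n + 1) * (t / (real R)\<^sup>2) + (\<Sum>g\<in>B. (c g)\<^sup>2 * (f g + f (inv s \<otimes> g))) / t"
      by (elim exE conjE)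
    have "finite {g. f g \<noteq> 0}"
      by (rule finite_subset[OF _ finite_word_ball[OF S, of "R + ?D"]]) (use supp in auto)
    then have fin: "finite {a. f (h a) \<noteq> 0}"
      using finite_vimageI[OF _ inj_h, of "{g. f g \<noteq> 0}"] by (simp add: vimage_def)
    define F where "F = Abs_poly_mapping (\<lambda>a. f (h a))"
    have F: "lookup F a = f (h a)" for a using fin by (simp add: F_def)
    have keys: "keys F = {a. f (h a) \<noteq> 0}" by (auto simp: in_keys_iff F)
    have himg: "h ` {a. f (h a) \<noteq> 0} = {g. f g \<noteq> 0}"
    proof (intro equalityI subsetI)
      fix g assume "g \<in> {g. f g \<noteq> 0}"
      then have "g = h (k g)" "k g \<in> {a. f (h a) \<noteq> 0}" using supp by simp_all
      then show "g \<in> h ` {a. f (h a) \<noteq> 0}" by (rule image_eqI)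
    qed auto
    have "N.controlled_weight C R F"
      unfolding N.controlled_weight_def
    proof (intro conjI allI ballI impI)
      show "0 \<le> lookup F a" for a using f0 by (simp add: F)
      show "real (wlen (h a)) \<le> C * real R" if "a \<in> keys F" for a
      proof -
        have "wlen (h a) \<le> R + ?D" using that supp by (simp add: keys)
        then have "real (wlen (h a)) \<le> real R + real ?D" by linarith
        also have "real ?D \<le> K * (2 * real R)" using K by (intro of_nat_floor) simp
        also have "real R + K * (2 * real R) \<le> C * real R" by (simp add: C_def algebra_simps)
        finally show ?thesis by simp
      qed
      have "lext (\<lambda>_. 1 :: real) F = (\<Sum>a | f (h a) \<noteq> 0. f (h a))"
        by (simp add: lext_def keys F)
      also have "\<dots> = (\<Sum>g | f g \<noteq> 0. f g)"
        unfolding himg[symmetric] by (simp add: sum.reindex[OF inj_h])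
      finally show "lext (\<lambda>_. 1 :: real) F = 1" using total by simp
    next
      fix s c and t :: real and A :: "nat set" assume s: "s \<in> S'" and t: "t > 0" and A: "finite A"
      obtain s0 where s0: "s0 \<in> S" "s = k s0" using s unfolding S'_def by blast
      then have s0c: "s0 \<in> carrier G" using S_carrier by blast
      have shift: "lookup F (mul (iv s) a) = f (inv s0 \<otimes> h a)" for a
        using s0c by (simp add: F mul_def iv_def s0(2))
      let ?D = "(\<Sum>a\<in>A. \<bar>lookup F (mul (iv s) a) - lookup F a\<bar> * \<bar>c a\<bar>)"
      let ?E = "(\<Sum>a\<in>A. (c a)\<^sup>2 * (lookup F a + lookup F (mul (iv s) a)))"
      have "?D
          = (\<Sum>g\<in>h ` A. \<bar>f (inv s0 \<otimes> g) - f g\<bar> * \<bar>c (k g)\<bar>)"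
        unfolding shift by (simp add: sum.reindex[OF inj_h] F)
      also have "\<dots> \<le> (real n + 1) * (t / (real R)\<^sup>2)
          + (\<Sum>g\<in>h ` A. (c (k g))\<^sup>2 * (f g + f (inv s0 \<otimes> g))) / t"
        by (rule grad[rule_format, OF s0(1) t]) (use A in auto)
      also have "(\<Sum>g\<in>h ` A. (c (k g))\<^sup>2 * (f g + f (inv s0 \<otimes> g)))
          = ?E"
        unfolding shift by (simp add: sum.reindex[OF inj_h] F)
      also have "(real n + 1) * (t / (real R)\<^sup>2)
            + ?E / t
          \<le> C * (t / (real R)\<^sup>2)
            + C * (?E / t)"
      proof (rule add_mono)
        show "(real n + 1) * (t / (real R)\<^sup>2) \<le> C * (t / (real R)\<^sup>2)"
          using C(2) t by (intro mult_right_mono) auto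
        have "0 \<le> ?E / t"
          using t f0 by (intro divide_nonneg_pos sum_nonneg) (simp_all add: F)
        from mult_right_mono[OF C(3) this]
        show "?E / t
          \<le> C * (?E / t)"
          by simp
      qed
      finally show "?D
          \<le> C * (t / (real R)\<^sup>2
            + ?E / t)"
        by (simp only: distrib_left)
    qed
    then show ?thesis by blast
  qed
  have "\<exists>\<phi>. N.energy \<phi> < \<epsilon> * ip \<phi> \<phi>" if \<epsilon>: "\<epsilon> > 0" for \<epsilon>
  proof -
    \<comment> \<open>Large enough for the bound of \<open>energy_sqrt_weight\<close> to fall below
      \<open>\<epsilon>\<close>.\<close>
    obtain R :: nat where R: "3 * C * card S' / \<epsilon> < R" using reals_Archimedean2 by blast
    have "0 \<le> 3 * C * card S' / \<epsilon>" using C \<epsilon> by simp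
    then have R1: "R \<ge> 1" using R by (cases R) auto
    obtain f where "N.controlled_weight C R f" using weight[OF R1] by blast
    from N.energy_sqrt_weight[OF this R1 C(1)] obtain \<phi>
      where \<phi>: "ip \<phi> \<phi> = 1" "N.energy \<phi> \<le> 3 * C * card S' / R" by blast
    have "3 * C * card S' / R < \<epsilon>" using R R1 \<epsilon> by (simp add: field_simps)
    then show ?thesis using \<phi> by (intro exI[of _ \<phi>]) simp
  qed
  then have "\<exists>B. psd_kernel B \<and> N.invariant_kernel B \<and>
      (\<forall>y. (\<Sum>s\<in>S'. B s y) = 0) \<and> (\<Sum>s\<in>S'. B s s) = 1 \<and>
      (\<forall>x y. \<bar>B x y\<bar> \<le> real (wlen (h x) * wlen (h y))) \<and> (\<forall>x. B x (k \<one>) = 0)"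
    by (rule N.harmonic_kernel_exists)
  then obtain B where B: "psd_kernel B" "N.invariant_kernel B"
    "\<forall>y. (\<Sum>s\<in>S'. B s y) = 0" "(\<Sum>s\<in>S'. B s s) = 1"
    "\<forall>x y. \<bar>B x y\<bar> \<le> real (wlen (h x) * wlen (h y))" "\<forall>x. B x (k \<one>) = 0"
    by (elim exE conjE)
  have "\<forall>n. \<exists>f. N.controlled_weight C (Suc n) f" by (intro allI weight) simp
  from choice[OF this] obtain f where f: "\<forall>n. N.controlled_weight C (Suc n) (f n)" ..
  interpret H: controlled_harmonic mul "k \<one>" iv S' "\<lambda>a. wlen (h a)" B C f
    by unfold_locales (use B C f in auto)
  have k_mult: "k (g \<otimes> g') = mul (k g) (k g')" if "g \<in> carrier G" "g' \<in> carrier G" for g g'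
    using that by (simp add: mul_def)
  show ?thesis
  proof (cases rule: H.linear_rep_or_character)
    case (rep d \<rho>)
    show ?thesis
    proof (rule matrix_rep_imp_not_simple[OF S inf, of d "\<lambda>g. \<rho> (k g)"])
      show "\<rho> (k (g \<otimes> g')) i j = (\<Sum>l<d. \<rho> (k g) i l * \<rho> (k g') l j)"
        if "g \<in> carrier G" "g' \<in> carrier G" "i < d" "j < d" for g g' i j
        unfolding k_mult[OF that(1,2)] by (rule rep(1)[OF that(3,4)])
      show "\<rho> (k \<one>) i j = (if i = j then 1 else 0)" if "i < d" "j < d" for i j
        by (rule rep(2)[OF that])
      obtain a i j where "i < d" "j < d" "\<rho> a i j \<noteq> (if i = j then 1 else 0)" using rep(3) by blast
      then show "\<exists>g\<in>carrier G. \<exists>i<d. \<exists>j<d. \<rho> (k g) i j \<noteq> (if i = j then 1 else 0)"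
        by (intro bexI[of _ "h a"] exI[of _ i] exI[of _ j] conjI) simp_all
    qed
  next
    case (character c)
    obtain a where "c a \<noteq> 0" using character(2) by blast
    show ?thesis
    proof (rule character_imp_not_simple[of "\<lambda>g. c (k g)" "h a"])
      show "c (k (g \<otimes> g')) = c (k g) + c (k g')" if "g \<in> carrier G" "g' \<in> carrier G" for g g'
        unfolding k_mult[OF that] by (rule character(1))
    qed (use \<open>c a \<noteq> 0\<close> in simp_all)
  qed
qed

end

theorem corollary1p2:
  fixes G :: "('a, 'b) monoid_scheme" and S :: "'a set"
  assumes "group G"
    and "finite_symmetric_generating_set G S"
    and "infinite (carrier G)"
    and "amenable G"
    and "AN_dim (carrier G) (word_dist G S) < \<infinity>"
  shows "\<not> is_simple G"
proof -
  interpret word_group G S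
    using assms(1,2) by (simp add: word_group_def word_group_axioms_def)
  show ?thesis by (rule not_simple_of_finite_AN_dim[OF assms(3-5)])
qed

end
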